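(* Let $m\ge1$ and $n\ge m-1$ be integers and let $x_1,\dots,x_m$ be nonzero. Put $$F=\prod_{1\le i<j\le m}(1-x_ix_j)\,P_n(x_1,\dots,x_m).$$ If $n+m$ is odd, then $F$ is equal to each of the following four expressions: (1) $$\frac{(-1)^{\binom m2}q^{-\frac12\binom{m+1}3-\frac n2\binom{m+1}2}}{(1-q)^m}\prod_{i=1}^m\frac{(q^{n+1-m+i};q)_i}{(q^{(1-n-m)/2},-q^{(3+n-m)/2};q)_{i-1}}\,x_i^{(n+m-1)/2}$$ $$\times\sum_{k_1,\dots,k_m=0}^{(n+m-1)/2}\left(\prod_{1\le i<j\le m}(q^{k_j}-q^{k_i})\prod_{i=1}^m\frac{(q^{(1-n-m)/2},-q^{(3+n-m)/2},qx_i,q/x_i;q)_{k_i}}{(q,q,q^{3/2},-q^{3/2};q)_{k_i}}\,q^{k_i}\right);$$ (2) $$\frac{q^{-\frac14nm}(-q;q)_{(n+1-m)/2}^m}{(q;q)_{(n+m-1)/2}^m}\prod_{i=1}^m\frac{(q^{n+1-m+i};q)_{i-1}(q^{3/2};q)_{(n+m+1-2i)/2}}{(-q^{1/2};q)_{(n+m+1-2i)/2}}\,x_i^{(n+m-1)/2}$$ $$\times\sum_{k_1,\dots,k_m=0}^{(n+m-1)/2}\left(\prod_{1\le i<j\le m}(q^{k_j}-q^{k_i})\prod_{i=1}^m\frac{(q^{(1-n-m)/2},-q^{(3+n-m)/2},q^{1/2}x_i,q^{1/2}/x_i;q)_{k_i}}{(q,q^{1/2},q^{3/2},-q;q)_{k_i}}\,q^{k_i}\right);$$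 (3) $$\frac{q^{-\frac12nm}}{(1-q)^m(q^{3+n-m};q^2)_{m-1}^m}\prod_{i=1}^m(q^{n+1-m+i};q)_m\,x_i^{(n+m-1)/2}$$ $$\times\sum_{k_1,\dots,k_m=0}^{(n+m-1)/2}\left(\prod_{1\le i<j\le m}(q^{2k_j}-q^{2k_i})\prod_{i=1}^m\frac{(q^{1-n-m},q^{3+n-m},qx_i,q/x_i;q^2)_{k_i}}{(q,q^2,q^2,q^3;q^2)_{k_i}}\,q^{2k_i}\right);$$ (4) $$\frac{q^{-nm}}{(1-q)^{2m}(q^{3+n-m};q^2)_{m-1}^m}\prod_{i=1}^m(q^{n+1-m+i};q)_i^2\,x_i^{(n+m-1)/2}$$ $$\times\sum_{k_1,\dots,k_m=0}^{(n+m-1)/2}\left(\prod_{1\le i<j\le m}(q^{2k_j}-q^{2k_i})\prod_{i=1}^m\frac{(q^{1-n-m},q^{3+n-m},q^2x_i,q^2/x_i;q^2)_{k_i}}{(q^2,q^2,q^3,q^3;q^2)_{k_i}}\,q^{2k_i}\right).$$ If $n+m$ is even, then $F$ is equal to each of the following four expressions: (5) $$\frac{(-1)^{\binom m2}q^{-\frac12\binom{m+1}3-\frac{n-1}2\binom{m+1}2}}{(1-q)^{2m}}\prod_{i=1}^m\frac{(q^{n+1-m+i};q)_i}{(q^{(2-n-m)/2},-q^{(4+n-m)/2};q)_{i-1}}\prod_{i=1}^m(1-x_i)x_i^{(n+m-2)/2}$$ $$\times\sum_{k_1,\dots,k_m=0}^{(n+m-2)/2}\left(\prod_{1\le i<j\le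 m}(q^{k_j}-q^{k_i})\prod_{i=1}^m\frac{(q^{(2-n-m)/2},-q^{(4+n-m)/2},qx_i,q/x_i;q)_{k_i}}{(q,q^2,q^{3/2},-q^{3/2};q)_{k_i}}\,q^{k_i}\right);$$ (6) $$\frac{q^{-\frac14(n-1)m}(-q;q)_{(n+2-m)/2}^m}{(1-q)^m(q;q)_{(n+m-2)/2}^m}\prod_{i=1}^m\frac{(q^{n+1-m+i};q)_{i-1}(q^{3/2};q)_{(n+m-2i)/2}}{(-q^{3/2};q)_{(n+m-2i)/2}}\prod_{i=1}^m(1-x_i)x_i^{(n+m-2)/2}$$ $$\times\sum_{k_1,\dots,k_m=0}^{(n+m-2)/2}\left(\prod_{1\le i<j\le m}(q^{k_j}-q^{k_i})\prod_{i=1}^m\frac{(q^{(2-n-m)/2},-q^{(4+n-m)/2},q^{1/2}x_i,q^{1/2}/x_i;q)_{k_i}}{(q,q^{3/2},q^{3/2},-q;q)_{k_i}}\,q^{k_i}\right);$$ (7) $$\frac{q^{-\frac12(n-1)m}}{(1-q)^{2m}(q^{4+n-m};q^2)_{m-2}^m}\prod_{i=1}^m(q^{n+1-m+i};q)_{i-1}^2\prod_{i=1}^m(1-x_i)x_i^{(n+m-2)/2}$$ $$\times\sum_{k_1,\dots,k_m=0}^{(n+m-2)/2}\left(\prod_{1\le i<j\le m}(q^{2k_j}-q^{2k_i})\prod_{i=1}^m\frac{(q^{2-n-m},q^{4+n-m},qx_i,q/x_i;q^2)_{k_i}}{(q^2,q^2,q^3,q^3;q^2)_{k_i}}\,q^{2k_i}\right);$$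 (8) $$\frac{q^{-(n-1)m}}{(1-q)^{2m}(1-q^2)^m(q^{4+n-m};q^2)_{m-2}^m}\prod_{i=1}^m(q^{n+1-m+i};q)_m\prod_{i=1}^m(1-x_i)x_i^{(n+m-2)/2}$$ $$\times\sum_{k_1,\dots,k_m=0}^{(n+m-2)/2}\left(\prod_{1\le i<j\le m}(q^{2k_j}-q^{2k_i})\prod_{i=1}^m\frac{(q^{2-n-m},q^{4+n-m},q^2x_i,q^2/x_i;q^2)_{k_i}}{(q^2,q^3,q^3,q^4;q^2)_{k_i}}\,q^{2k_i}\right).$$
   Context: $q$ is a generic complex parameter: $q\neq 0$ and $q$ is not a root of unity; a square root $q^{1/2}$ is fixed, and all half-integer powers of $q$ are powers of it (every exponent of $q$ occurring is a half-integer). $(a;q)_k=(1-a)(1-aq)\cdots(1-aq^{k-1})$, $(a_1,\dots,a_r;q)_k=(a_1;q)_k\cdots(a_r;q)_k$, and similarly with base $q^2$; $(a;q)_k^m$ means $\big((a;q)_k\big)^m$. For subscript $-1$ (occurring only in (7), (8) when $m=1$) the usual convention $(a;q^2)_{-1}=1/(1-aq^{-2})$ is used. For integers $n\ge 0$, $m\ge1$, $$P_n(x_1,\dots,x_m)=\frac{(-q;q)_n^m}{(q;q)_n^m}\sum_{k_1,\dots,k_m=0}^n\ \prod_{1\le i<j\le m}\frac{q^{k_j}-q^{k_i}}{q^{k_j}+q^{k_i}}\prod_{i=1}^m\frac{(-q,q^{-n};q)_{k_i}}{(q,-q^{-n};q)_{k_i}}\,x_i^{k_i}.$$ *)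

theory Defs
  imports Complex_Main "HOL-Library.FuncSet"
begin

definition qpoch :: "complex \<Rightarrow> complex \<Rightarrow> nat \<Rightarrow> complex" where
  "qpoch a b k = (\<Prod>j<k. 1 - a * b ^ j)"

definition qpochs :: "complex list \<Rightarrow> complex \<Rightarrow> nat \<Rightarrow> complex" where
  "qpochs as b k = (\<Prod>a\<leftarrow>as. qpoch a b k)"

(* The usual extension to negative subscripts, (a; b)_{-k} = 1 / ((1 - a/b) ... (1 - a/b^k)). *)
definition qpoch_int :: "complex \<Rightarrow> complex \<Rightarrow> int \<Rightarrow> complex" where
  "qpoch_int a b k =
     (if k \<ge> 0 then qpoch a b (nat k) else 1 / (\<Prod>j=1..nat (- k). 1 - a / b ^ j))"

lemma qpoch_int_of_nat: "qpoch_int a b (int k) = qpoch a b k"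
  by (simp add: qpoch_int_def)

lemma qpoch_int_minus_one: "qpoch_int a b (- 1) = 1 / (1 - a / b)"
  by (simp add: qpoch_int_def)

(* The variables are x 1, ..., x m.  The summation indices (k_1, ..., k_m) are the functions k
   that are extensional on {1..m}, so that each tuple is counted exactly once. *)
definition Pn :: "complex \<Rightarrow> nat \<Rightarrow> nat \<Rightarrow> (nat \<Rightarrow> complex) \<Rightarrow> complex" where
  "Pn q n m x =
     qpoch (- q) q n ^ m / qpoch q q n ^ m *
     (\<Sum>k\<in>{1..m} \<rightarrow>\<^sub>E {0..n}.
        (\<Prod>i=1..m. \<Prod>j=i+1..m. (q ^ k j - q ^ k i) / (q ^ k j + q ^ k i)) *
        (\<Prod>i=1..m. qpochs [- q, q powi (- int n)] q (k i) /
                    qpochs [q, - (q powi (- int n))] q (k i) * x i ^ k i))"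

(* Convention for the theorem: s is the fixed square root of q, and q^(e/2) is
   written s powi e.  All subtractions on nat and all uses of div there are exact, since
   m <= n + 1, and n * m (resp. (n - 1) * m) is even when n + m is odd (resp. even). *)

end

theory Submission
  imports Defs "Jordan_Normal_Form.Determinant"
begin

text \<open>
  For one variable, the coefficient of \<open>x^k\<close> in \<open>P_n\<close> is \<open>(-1)^k g_k g_(n-k)\<close> with
  \<open>g_k = (-q;q)_k / (q;q)_k\<close>. So \<open>P_n\<close> is a Rogers (continuous q-ultraspherical)
  polynomial with parameter \<open>-q\<close>, written in \<open>x = - exp (-2 i \<theta>)\<close>, and it
  satisfies \<open>P_(n+1) = c_(n+1) (1 - x) P_n + x P_(n-1)\<close> with
  \<open>c_k = (1 + q^k) / (1 - q^k)\<close> (\<open>rogers_rec\<close>).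

  For several variables, the product of the \<open>(q^(k_j) - q^(k_i)) / (q^(k_j) + q^(k_i))\<close>
  is Schur's Pfaffian. Expanding it along a row reduces \<open>P_n (x_1, ..., x_m)\<close> to fewer
  variables, at the cost of a kernel: \<open>P_n (x)\<close> for odd \<open>m\<close> and \<open>P_n (x, y)\<close> for even
  \<open>m\<close>. The second kernel obeys the Christoffel-Darboux type formula \<open>rogers2_eq\<close>,
  \<open>c_(n+1) (1 - x y) P_n (x, y) = P_(n+1) (x) y P_(n-1) (y) - P_(n+1) (y) x P_(n-1) (x)\<close>.
  A determinant whose columns are, up to a common power of \<open>x_i\<close>, the columns
  \<open>P_(n+1) (x_i)\<close> and \<open>x_i P_(n-1) (x_i)\<close> times powers of \<open>x_i + 1 / x_i\<close> satisfies the
  same row expansion (\<open>reciprocal_det_expand\<close>), where for odd \<open>m\<close> a row for the argument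
  \<open>1\<close> is adjoined; this is where the factors \<open>1 - x_i x_j\<close> come from, as \<open>x + 1 / x\<close>
  takes equal values at \<open>x_i\<close> and \<open>1 / x_i\<close>. Running the recurrence up and down from the
  indices \<open>n + 1\<close> and \<open>n - 1\<close> turns that determinant into
  \<open>det (x_i^j P_(n+m-1-2j) (x_i))\<close> with \<open>0 \<le> j < m\<close>, which is therefore \<open>F\<close> times a
  product of numbers \<open>c_k\<close> (\<open>mrogers_rogers_det\<close>).

  Only polynomials whose index has the parity of \<open>n + m - 1\<close> occur in this determinant,
  and this parity separates the two halves of the theorem. Those of even index \<open>2 K\<close>,
  and likewise those of odd index \<open>2 K + 1\<close>, are, up to elementary factors, terminating
  balanced 4-phi-3 series in four ways, with base \<open>q\<close> or \<open>q^2\<close> (\<open>rogers_as_phi43\<close>). In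
  each family, the \<open>k\<close>-th terms of the series in one row of the determinant are a common
  weight times polynomials in \<open>b^k\<close>, where \<open>b\<close> is the base. By multilinearity the
  determinant becomes an \<open>m\<close>-fold sum of determinants of such polynomials, and each of
  these is a constant times the Vandermonde product in the \<open>b^(k_i)\<close> (\<open>phi43_det\<close>). Four
  series and two parities give the eight formulas; what remains is to identify the
  constants.
\<close>

section \<open>Determinants of index functions\<close>

text \<open>
  Entries are given by a function on \<open>nat\<close>, so that the size can vary in an induction
  and rows and columns are deleted by composition with \<open>insert_index\<close>.
\<close>
definition detf :: "nat \<Rightarrow> (nat \<Rightarrow> nat \<Rightarrow> 'a) \<Rightarrow> 'a :: comm_ring_1" where
  "detf m f = det (mat m m (\<lambda>(i, j). f i j))"

lemma detf_leibniz:
  "detf m f = (\<Sum>p\<in>{p. p permutes {0..<m}}. signof p * (\<Prod>i<m. f i (p i)))"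
proof -
  have "detf m f = (\<Sum>p\<in>{p. p permutes {0..<m}}. signof p *
          (\<Prod>i=0..<m. mat m m (\<lambda>(i, j). f i j) $$ (i, p i)))"
    unfolding detf_def by (rule det_def') simp
  also have "\<dots> = (\<Sum>p\<in>{p. p permutes {0..<m}}. signof p * (\<Prod>i<m. f i (p i)))"
    by (intro sum.cong refl arg_cong2[where f = "(*)"])
       (auto simp: atLeast0LessThan permutes_in_image intro!: prod.cong)
  finally show ?thesis .
qed

lemma detf_cong:
  "m = m' \<Longrightarrow> (\<And>i j. i < m \<Longrightarrow> j < m \<Longrightarrow> f i j = g i j) \<Longrightarrow> detf m f = detf m' g"
  unfolding detf_def by (auto intro!: arg_cong[where f = det] cong_mat)

lemma detf_0 [simp]: "detf 0 f = 1"
  by (simp add: detf_def det_dim_zero)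

lemma detf_expand_row:
  assumes "p < Suc m"
  shows "detf (Suc m) f = (\<Sum>j<Suc m. (-1) ^ (p + j) * f p j *
           detf m (\<lambda>i j'. f (insert_index p i) (insert_index j j')))"
proof -
  let ?A = "mat (Suc m) (Suc m) (\<lambda>(i, j). f i j)"
  have "det ?A = (\<Sum>j<Suc m. ?A $$ (p, j) * cofactor ?A p j)"
    by (rule laplace_expansion_row) (use assms in auto)
  also have "\<dots> = (\<Sum>j<Suc m. (-1) ^ (p + j) * f p j *
           detf m (\<lambda>i j'. f (insert_index p i) (insert_index j j')))"
  proof (intro sum.cong refl, goal_cases)
    case j: (1 j)
    have "mat_delete ?A p j = mat m m (\<lambda>(i, j'). f (insert_index p i) (insert_index j j'))"
      using assms j by (intro eq_matI) (auto simp: mat_delete_def insert_index_def)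
    then show ?case
      using j assms by (simp add: cofactor_def detf_def)
  qed
  finally show ?thesis by (simp add: detf_def)
qed

lemma detf_mult:
  "detf m (\<lambda>i j. \<Sum>k<m. f i k * g k j) = detf m f * detf m g"
proof -
  let ?F = "mat m m (\<lambda>(i, j). f i j)" and ?G = "mat m m (\<lambda>(i, j). g i j)"
  have "mat m m (\<lambda>(i, j). \<Sum>k<m. f i k * g k j) = ?F * ?G"
    by (intro eq_matI) (auto simp: scalar_prod_def atLeast0LessThan)
  then show ?thesis
    by (simp add: detf_def det_mult[of ?F m ?G])
qed

lemma detf_scale:
  "detf m (\<lambda>i j. a i * b j * f i j) = (\<Prod>i<m. a i) * (\<Prod>j<m. b j) * detf m f"
proof -
  have "(\<Prod>i<m. a i * b (p i) * f i (p i)) = (\<Prod>i<m. a i) * (\<Prod>j<m. b j) * (\<Prod>i<m. f i (p i))"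
    if "p permutes {0..<m}" for p
  proof -
    have "(\<Prod>i<m. b (p i)) = (\<Prod>j<m. b j)"
      using permutes_imp_bij[OF that] prod.reindex_bij_betw[of p "{0..<m}" "{0..<m}" b]
      by (simp add: atLeast0LessThan)
    then show ?thesis by (simp add: prod.distrib)
  qed
  then show ?thesis
    unfolding detf_leibniz by (simp add: sum_distrib_left mult_ac)
qed

text \<open>
  If \<open>p\<close> contributes a nonzero term to the Leibniz sum, then \<open>h i \<le> h (p i)\<close> for all
  \<open>i\<close>, strictly unless \<open>p i = i\<close>; as \<open>h\<close> and \<open>h \<circ> p\<close> have the same sum, \<open>p\<close> is the
  identity. Ranking the indices by \<open>h\<close> makes it unnecessary to sort them, and to follow
  the sign of the sorting permutation.
\<close>
lemma detf_ranked_triangular: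
  fixes h :: "nat \<Rightarrow> nat"
  assumes "\<And>i j. i < m \<Longrightarrow> j < m \<Longrightarrow> i \<noteq> j \<Longrightarrow> f i j \<noteq> 0 \<Longrightarrow> h i < h j"
  shows "detf m f = (\<Prod>i<m. f i i)"
proof -
  have z: "(\<Prod>i<m. f i (p i)) = 0" if p: "p permutes {0..<m}" and "p \<noteq> id" for p
  proof (rule ccontr)
    assume nz: "(\<Prod>i<m. f i (p i)) \<noteq> 0"
    have in_rng: "p i < m" if "i < m" for i
      using permutes_in_image[OF p, of i] that by simp
    have fnz: "f i (p i) \<noteq> 0" if "i < m" for i
    proof
      assume "f i (p i) = 0"
      then have "(\<Prod>i<m. f i (p i)) = 0"
        using that by (metis finite_lessThan lessThan_iff prod_zero)
      with nz show False by simp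
    qed
    have le: "h i \<le> h (p i)" if "i < m" for i
      using assms[OF that in_rng[OF that] _ fnz[OF that]] by (cases "p i = i") auto
    obtain i0 where i0: "i0 < m" "p i0 \<noteq> i0"
      using \<open>p \<noteq> id\<close> p by (metis atLeastLessThan_iff eq_id_iff permutes_def)
    have "(\<Sum>i<m. h i) < (\<Sum>i<m. h (p i))"
      using assms[OF i0(1) in_rng[OF i0(1)] i0(2)[symmetric] fnz[OF i0(1)]] i0(1) le
      by (intro sum_strict_mono_ex1) auto
    also have "\<dots> = (\<Sum>i<m. h i)"
      using permutes_imp_bij[OF p] sum.reindex_bij_betw[of p "{0..<m}" "{0..<m}" h]
      by (simp add: atLeast0LessThan)
    finally show False by simp
  qed
  have "detf m f = (\<Sum>p\<in>{p. p permutes {0..<m}}. if p = id then (\<Prod>i<m. f i i) else 0)"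
    unfolding detf_leibniz by (intro sum.cong refl) (use z in auto)
  also have "\<dots> = (\<Prod>i<m. f i i)"
    by (simp add: finite_permutations permutes_id)
  finally show ?thesis .
qed

text \<open>
  The operations amount to right multiplication by a matrix that is unipotent triangular
  for the ranking \<open>h\<close>.
\<close>
lemma detf_col_ops:
  fixes h :: "nat \<Rightarrow> nat"
  assumes "\<And>k j. k < m \<Longrightarrow> j < m \<Longrightarrow> c k j \<noteq> 0 \<Longrightarrow> h k < h j"
  shows "detf m (\<lambda>i j. f i j + (\<Sum>k<m. f i k * c k j)) = detf m f"
proof -
  let ?g = "\<lambda>k j. (if k = j then 1 else 0) + c k j"
  have "detf m (\<lambda>i j. f i j + (\<Sum>k<m. f i k * c k j)) = detf m (\<lambda>i j. \<Sum>k<m. f i k * ?g k j)"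
  proof (intro detf_cong refl)
    fix i j assume "j < m"
    have "(\<Sum>k<m. f i k * ?g k j) = (\<Sum>k<m. (if k = j then f i j else 0) + f i k * c k j)"
      by (intro sum.cong refl) (auto simp: distrib_left)
    then show "f i j + (\<Sum>k<m. f i k * c k j) = (\<Sum>k<m. f i k * ?g k j)"
      using \<open>j < m\<close> by (simp add: sum.distrib)
  qed
  also have "\<dots> = detf m f * detf m ?g" by (rule detf_mult)
  also have "detf m ?g = (\<Prod>i<m. ?g i i)"
    by (rule detf_ranked_triangular[where h = h]) (use assms in auto)
  also have "\<dots> = 1"
  proof (intro prod.neutral ballI)
    fix i assume "i \<in> {..<m}"
    then show "?g i i = 1" using assms[of i i] by auto
  qed
  finally show ?thesis by simp
qed

text \<open>
  The step from a determinant of single sums to one multiple sum.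
\<close>
lemma detf_multilinear:
  assumes "finite S"
  shows "detf m (\<lambda>i j. \<Sum>k\<in>S. w i k * g k j) =
           (\<Sum>k\<in>{..<m} \<rightarrow>\<^sub>E S. (\<Prod>i<m. w i (k i)) * detf m (\<lambda>i j. g (k i) j))"
proof -
  have "detf m (\<lambda>i j. \<Sum>k\<in>S. w i k * g k j) =
      (\<Sum>p\<in>{p. p permutes {0..<m}}. signof p * (\<Sum>k\<in>{..<m} \<rightarrow>\<^sub>E S. \<Prod>i<m. w i (k i) * g (k i) (p i)))"
    unfolding detf_leibniz by (simp add: prod_sum_PiE assms)
  also have "\<dots> = (\<Sum>k\<in>{..<m} \<rightarrow>\<^sub>E S. (\<Prod>i<m. w i (k i)) * detf m (\<lambda>i j. g (k i) j))"
    unfolding detf_leibniz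
    by (simp add: sum_distrib_left prod.distrib mult_ac) (rule sum.swap)
  finally show ?thesis .
qed

lemma prod_insert_index:
  assumes "p \<le> m"
  shows "(\<Prod>i<Suc m. g i) = g p * (\<Prod>i<m. g (insert_index p i))"
proof -
  have "{..<Suc m} = insert p (insert_index p ` {..<m})"
    using assms insert_index_image[of p m] by (auto simp: atLeast0LessThan)
  moreover have "p \<notin> insert_index p ` {..<m}" by (auto simp: insert_index_def split: if_splits)
  ultimately have "(\<Prod>i<Suc m. g i) = g p * (\<Prod>i\<in>insert_index p ` {..<m}. g i)"
    by simp
  also have "(\<Prod>i\<in>insert_index p ` {..<m}. g i) = (\<Prod>i<m. g (insert_index p i))"
    by (subst prod.reindex) (auto intro: insert_index_inj_on)
  finally show ?thesis .
qed

text \<open>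
  The pairs containing \<open>p\<close> are \<open>(j, p)\<close> for \<open>j < p\<close> and \<open>(p, j + 1)\<close> for \<open>j \<ge> p\<close>;
  the first product runs over both kinds at once.
\<close>
lemma pair_prod_insert_index:
  assumes "p \<le> m"
  shows "(\<Prod>j<Suc m. \<Prod>i<j. h i j) =
     (\<Prod>j<m. if j < p then h j p else h p (Suc j)) *
     (\<Prod>j<m. \<Prod>i<j. h (insert_index p i) (insert_index p j))"
  using assms
proof (induction m)
  case 0
  then show ?case by simp
next
  case (Suc m)
  show ?case
  proof (cases "p = Suc m")
    case True
    have "(\<Prod>j<Suc m. \<Prod>i<j. h (insert_index p i) (insert_index p j)) = (\<Prod>j<Suc m. \<Prod>i<j. h i j)"
      by (intro prod.cong refl) (auto simp: True insert_index_def)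
    moreover have "(\<Prod>j<Suc m. if j < p then h j p else h p (Suc j)) = (\<Prod>j<Suc m. h j p)"
      by (intro prod.cong refl) (auto simp: True)
    ultimately show ?thesis
      by (simp only: prod.lessThan_Suc[of _ "Suc m"]) (simp add: True mult_ac)
  next
    case False
    then have p: "p \<le> m" using Suc by simp
    have "(\<Prod>j<Suc (Suc m). \<Prod>i<j. h i j) = (\<Prod>j<Suc m. \<Prod>i<j. h i j) * (\<Prod>i<Suc m. h i (Suc m))"
      by simp
    also have "(\<Prod>i<Suc m. h i (Suc m)) = h p (Suc m) * (\<Prod>i<m. h (insert_index p i) (Suc m))"
      by (rule prod_insert_index[OF p])
    also note Suc.IH[OF p]
    finally have "(\<Prod>j<Suc (Suc m). \<Prod>i<j. h i j) =
        (\<Prod>j<m. if j < p then h j p else h p (Suc j)) *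
        (\<Prod>j<m. \<Prod>i<j. h (insert_index p i) (insert_index p j)) *
        (h p (Suc m) * (\<Prod>i<m. h (insert_index p i) (insert_index p m)))"
      using p by simp
    then show ?thesis using p by (simp only: prod.lessThan_Suc[of _ m] prod.lessThan_Suc[of _ "Suc m"]) (simp add: mult_ac)
  qed
qed

text \<open>
  Subtracting \<open>y m\<close> times each column from the next one clears the last row except for
  its first entry.
\<close>
lemma vandermonde_det:
  "detf m (\<lambda>i j. y i ^ j) = (\<Prod>j<m. \<Prod>i<j. y j - y i :: 'a :: comm_ring_1)"
proof (induction m)
  case 0
  then show ?case by simp
next
  case (Suc m)
  let ?c = "\<lambda>k j. if j = Suc k then - y m else 0"
  let ?g = "\<lambda>i j. y i ^ j + (\<Sum>k<Suc m. y i ^ k * ?c k j)"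
  have g0: "?g i 0 = 1" for i by simp
  have gS: "?g i (Suc j) = y i ^ j * (y i - y m)" if "j < m" for i j
  proof -
    have "(\<Sum>k<Suc m. y i ^ k * ?c k (Suc j)) = (\<Sum>k<Suc m. if k = j then - y m * y i ^ j else 0)"
      by (intro sum.cong refl) auto
    also have "\<dots> = - y m * y i ^ j" using that by (simp add: sum.delta)
    finally show ?thesis by (simp add: algebra_simps)
  qed
  have "detf (Suc m) (\<lambda>i j. y i ^ j) = detf (Suc m) ?g"
    by (rule detf_col_ops[where h = id, symmetric]) (auto split: if_splits)
  also have "\<dots> = (\<Sum>j<Suc m. (-1) ^ (m + j) * ?g m j *
           detf m (\<lambda>i j'. ?g (insert_index m i) (insert_index j j')))"
    by (rule detf_expand_row) simp
  also have "\<dots> = (\<Sum>j<Suc m. if j = 0 then (-1) ^ m * detf m (\<lambda>i j. ?g i (Suc j)) else 0)"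
  proof (intro sum.cong refl, goal_cases)
    case j: (1 j)
    show ?case
    proof (cases j)
      case 0
      have "detf m (\<lambda>i j'. ?g (insert_index m i) (insert_index 0 j')) = detf m (\<lambda>i j. ?g i (Suc j))"
        by (intro detf_cong refl) (simp add: insert_index_def)
      then show ?thesis using 0 by simp
    next
      case (Suc j')
      then show ?thesis using j gS[of j' m] by simp
    qed
  qed
  also have "\<dots> = (-1) ^ m * detf m (\<lambda>i j. ?g i (Suc j))" by simp
  also have "detf m (\<lambda>i j. ?g i (Suc j)) = detf m (\<lambda>i j. (y i - y m) * 1 * y i ^ j)"
    by (intro detf_cong refl) (subst gS, auto)
  also have "\<dots> = (\<Prod>i<m. y i - y m) * detf m (\<lambda>i j. y i ^ j)"
    by (subst detf_scale) simp
  also have "(-1) ^ m * ((\<Prod>i<m. y i - y m) * detf m (\<lambda>i j. y i ^ j)) =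
      (\<Prod>i<m. y m - y i) * detf m (\<lambda>i j. y i ^ j)"
  proof -
    have "(-1) ^ m * (\<Prod>i<m. y i - y m) = (\<Prod>i<m. (-1) * (y i - y m))"
      by (subst prod.distrib) simp
    then show ?thesis by (simp only: mult.assoc[symmetric]) simp
  qed
  finally show ?case using Suc.IH by (simp add: mult_ac)
qed

text \<open>
  The matrix is the Vandermonde matrix of the \<open>y i\<close> times the matrix of coefficients.
\<close>
lemma polynomial_det:
  fixes p :: "nat \<Rightarrow> 'a :: comm_ring_1 poly"
  assumes "\<And>j. j < m \<Longrightarrow> degree (p j) < m"
  shows "detf m (\<lambda>i j. poly (p j) (y i)) =
    detf m (\<lambda>k j. coeff (p j) k) * (\<Prod>j<m. \<Prod>i<j. y j - y i)"
proof -
  have "detf m (\<lambda>i j. poly (p j) (y i)) = detf m (\<lambda>i j. \<Sum>k<m. y i ^ k * coeff (p j) k)"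
  proof (intro detf_cong refl)
    fix i j assume "j < m"
    have "poly (p j) (y i) = (\<Sum>k\<le>degree (p j). coeff (p j) k * y i ^ k)"
      by (rule poly_altdef)
    also have "\<dots> = (\<Sum>k<m. coeff (p j) k * y i ^ k)"
      by (rule sum.mono_neutral_left) (use assms[OF \<open>j < m\<close>] in \<open>auto simp: coeff_eq_0\<close>)
    finally show "poly (p j) (y i) = (\<Sum>k<m. y i ^ k * coeff (p j) k)" by (simp add: mult.commute)
  qed
  then show ?thesis by (simp only: detf_mult vandermonde_det) (rule mult.commute)
qed

section \<open>Polynomial functions and perturbation of parameters\<close>

text \<open>
  Speaking of functions instead of elements of \<open>complex poly\<close> allows determinants and
  sums to be compared in the shape in which they arise.
\<close>
definition polyfun :: "nat \<Rightarrow> (complex \<Rightarrow> complex) \<Rightarrow> bool" where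
  "polyfun d f \<longleftrightarrow> (\<exists>p. degree p \<le> d \<and> f = poly p)"

lemma polyfun_const: "polyfun 0 (\<lambda>x. c)"
  unfolding polyfun_def by (rule exI[of _ "[:c:]"]) auto

lemma polyfun_linear: "polyfun 1 (\<lambda>x. c + d * x)"
  unfolding polyfun_def by (rule exI[of _ "[:c, d:]"]) (auto simp: mult.commute)

lemma polyfun_mono: "polyfun d f \<Longrightarrow> d \<le> e \<Longrightarrow> polyfun e f"
  unfolding polyfun_def by (metis order_trans)

lemma polyfun_mult: "polyfun d f \<Longrightarrow> polyfun e g \<Longrightarrow> polyfun (d + e) (\<lambda>x. f x * g x)"
  unfolding polyfun_def
proof clarify
  fix p q :: "complex poly" assume "degree p \<le> d" "degree q \<le> e"
  then show "\<exists>r. degree r \<le> d + e \<and> (\<lambda>x. poly p x * poly q x) = poly r"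
    by (intro exI[of _ "p * q"]) (auto intro: order_trans[OF degree_mult_le])
qed

lemma polyfun_cmult: "polyfun d f \<Longrightarrow> polyfun d (\<lambda>x. c * f x)"
  using polyfun_mult[OF polyfun_const] by simp

lemma polyfun_sum:
  assumes "\<And>i. i \<in> S \<Longrightarrow> polyfun d (f i)"
  shows "polyfun d (\<lambda>x. \<Sum>i\<in>S. f i x)"
proof -
  obtain p where p: "\<And>i. i \<in> S \<Longrightarrow> degree (p i) \<le> d \<and> f i = poly (p i)"
    using assms unfolding polyfun_def by metis
  show ?thesis
    unfolding polyfun_def
    by (rule exI[of _ "\<Sum>i\<in>S. p i"])
       (use p in \<open>cases "finite S"; auto intro!: degree_sum_le simp: poly_sum\<close>)
qed

lemma polyfun_add: "polyfun d f \<Longrightarrow> polyfun d g \<Longrightarrow> polyfun d (\<lambda>x. f x + g x)"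
  unfolding polyfun_def
proof clarify
  fix p q :: "complex poly" assume "degree p \<le> d" "degree q \<le> d"
  then show "\<exists>r. degree r \<le> d \<and> (\<lambda>x. poly p x + poly q x) = poly r"
    by (intro exI[of _ "p + q"]) (auto intro: degree_add_le)
qed

lemma polyfun_prod:
  assumes "finite S" "\<And>i. i \<in> S \<Longrightarrow> polyfun 1 (f i)"
  shows "polyfun (card S) (\<lambda>x. \<Prod>i\<in>S. f i x)"
  using assms
proof (induction S rule: finite_induct)
  case empty
  then show ?case by (simp add: polyfun_const)
next
  case (insert i S)
  then show ?case using polyfun_mult[of 1 "f i" "card S"] by simp
qed

lemma polyfun_power: "polyfun d f \<Longrightarrow> polyfun (d * k) (\<lambda>x. f x ^ k)"
proof (induction k)
  case 0
  then show ?case by (simp add: polyfun_const)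
next
  case (Suc k)
  then show ?case using polyfun_mult[of d f "d * k"] by (simp add: add.commute)
qed

lemma polyfun_eqI:
  assumes "polyfun d f" "polyfun d g" "finite S" "card S > d"
    and "\<And>x. x \<in> S \<Longrightarrow> f x = g x"
  shows "f = g"
proof -
  obtain p q where pq: "degree p \<le> d" "f = poly p" "degree q \<le> d" "g = poly q"
    using assms(1,2) unfolding polyfun_def by metis
  have "p = q"
    by (rule poly_eqI_degree[of S]) (use assms pq in auto)
  with pq show ?thesis by simp
qed

text \<open>
  Extends identities from generic to exceptional parameters: one moves the parameters
  along a line through the exceptional point and lets \<open>t \<rightarrow> 0\<close>.
\<close>
lemma eq_by_perturbation:
  fixes f g :: "complex \<Rightarrow> complex"
  assumes "isCont f 0" "isCont g 0" "eventually (\<lambda>t. f t = g t) (at 0)"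
  shows "f 0 = g 0"
proof -
  have "f \<midarrow>0\<rightarrow> f 0" "g \<midarrow>0\<rightarrow> g 0" using assms by (auto simp: isCont_def)
  moreover have "f \<midarrow>0\<rightarrow> g 0"
    using tendsto_cong[OF assms(3)] \<open>g \<midarrow>0\<rightarrow> g 0\<close> by blast
  ultimately show ?thesis using LIM_unique by blast
qed

lemma eventually_affine_nonzero:
  fixes u v :: complex
  assumes "u \<noteq> 0 \<or> v \<noteq> 0"
  shows "eventually (\<lambda>t. u + t * v \<noteq> 0) (at 0)"
proof (cases "u = 0")
  case True
  then show ?thesis using assms by (auto simp: eventually_at_filter)
next
  case False
  have "(\<lambda>t. u + t * v) \<midarrow>0\<rightarrow> u + 0 * v" by (intro tendsto_intros)
  then show ?thesis using tendsto_imp_eventually_ne[of _ "u + 0 * v"] False by simp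
qed

lemma eventually_perturbed_inj:
  "eventually (\<lambda>t. inj_on (\<lambda>i. a i + t * (of_nat i :: complex)) {..<m}) (at 0)"
proof -
  have "eventually (\<lambda>t. \<forall>i\<in>{..<m}. \<forall>j\<in>{..<m}. i \<noteq> j \<longrightarrow>
          (a i - a j) + t * (of_nat i - of_nat j) \<noteq> 0) (at 0)"
    unfolding eventually_ball_finite_distrib[OF finite_lessThan]
  proof (intro ballI)
    fix i j :: nat
    show "eventually (\<lambda>t. i \<noteq> j \<longrightarrow> (a i - a j) + t * (of_nat i - of_nat j) \<noteq> 0) (at 0)"
      by (cases "i = j") (auto intro: eventually_affine_nonzero)
  qed
  then show ?thesis
    by (rule eventually_mono) (fastforce simp: inj_on_def algebra_simps)
qed

section \<open>Recursions for Schur's Pfaffian\<close>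

text \<open>
  For even \<open>m\<close> this product is Schur's evaluation of the Pfaffian of the matrix with
  entries \<open>(a j - a i) / (a j + a i)\<close>; for odd \<open>m\<close> it is the Pfaffian of that matrix
  bordered by ones.
\<close>
definition schur :: "nat \<Rightarrow> (nat \<Rightarrow> complex) \<Rightarrow> complex" where
  "schur m a = (\<Prod>j<m. \<Prod>i<j. (a j - a i) / (a j + a i))"

text \<open>
  Lagrange interpolation of \<open>u \<mapsto> \<Prod>j<m. 1 - u * a j\<close> at the points
  \<open>- 1 / a l\<close>. At such a point only the summand \<open>i = l\<close> survives and the two sides
  agree; they differ at most by a multiple of \<open>\<Prod>j<m. 1 + u * a j\<close>, and \<open>u = 0\<close>
  shows that the factor is \<open>1 - (\<Sum>i<m. W i)\<close>. Comparing the coefficients of \<open>u^m\<close>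
  for odd \<open>m\<close> gives the value \<open>0\<close> for this factor.
\<close>
lemma lagrange_reflection:
  fixes a :: "nat \<Rightarrow> complex" and m :: nat
  assumes "odd m" "inj_on a {..<m}" and ns: "\<And>i j. i < m \<Longrightarrow> j < m \<Longrightarrow> a i + a j \<noteq> 0"
  defines "W \<equiv> \<lambda>i. \<Prod>j\<in>{..<m} - {i}. (a i + a j) / (a i - a j)"
  shows "(\<Prod>j<m. 1 - u * a j) = (\<Sum>i<m. W i * (1 - u * a i) * (\<Prod>j\<in>{..<m} - {i}. 1 + u * a j))"
    and "(\<Sum>i<m. W i) = 1"
proof -
  define f where "f u = (\<Prod>j<m. 1 - u * a j)" for u
  define g where "g u = (\<Sum>i<m. W i * (1 - u * a i) * (\<Prod>j\<in>{..<m} - {i}. 1 + u * a j))" for u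
  define h where "h u = (1 - (\<Sum>i<m. W i)) * (\<Prod>j<m. 1 + u * a j)" for u
  have nz: "a i \<noteq> 0" if "i < m" for i using ns[OF that that] by auto
  have pf: "polyfun m f"
    using polyfun_prod[of "{..<m}" "\<lambda>j u. 1 - u * a j"] polyfun_linear[of 1 "- a _"]
    unfolding f_def by (simp add: mult.commute)
  have ph: "polyfun m h"
    using polyfun_cmult[OF polyfun_prod[of "{..<m}" "\<lambda>j u. 1 + u * a j"]] polyfun_linear[of 1 "a _"]
    unfolding h_def by (simp add: mult.commute)
  have pg: "polyfun m g"
    unfolding g_def
  proof (rule polyfun_sum)
    fix i assume "i \<in> {..<m}"
    then have c: "1 + card ({..<m} - {i}) = m" by auto
    have "polyfun (1 + card ({..<m} - {i})) (\<lambda>x. (W i + (- W i * a i) * x) * (\<Prod>j\<in>{..<m} - {i}. 1 + a j * x))"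
      by (intro polyfun_mult polyfun_linear polyfun_prod) auto
    then show "polyfun m (\<lambda>x. W i * (1 - x * a i) * (\<Prod>j\<in>{..<m} - {i}. 1 + x * a j))"
      unfolding c by (simp add: algebra_simps)
  qed
  let ?S = "insert 0 ((\<lambda>i. - 1 / a i) ` {..<m})"
  have "inj_on (\<lambda>i. - 1 / a i) {..<m}"
    using assms(2) nz by (auto simp: inj_on_def field_simps)
  then have card: "card ((\<lambda>i. - 1 / a i) ` {..<m}) = m" by (simp add: card_image)
  have "0 \<notin> (\<lambda>i. - 1 / a i) ` {..<m}" using nz by auto
  with card have cardS: "card ?S = Suc m" by simp
  have fgh: "f = (\<lambda>u. g u + h u)"
  proof (rule polyfun_eqI[OF pf polyfun_add[OF pg ph], of ?S])
    show "card ?S > m" using cardS by simp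
    fix u assume "u \<in> ?S"
    then consider "u = 0" | l where "l < m" "u = - 1 / a l" by auto
    then show "f u = g u + h u"
    proof cases
      case 1
      then show ?thesis by (simp add: f_def g_def h_def)
    next
      case 2
      have l0: "1 + u * a l = 0" using nz 2 by simp
      then have h0: "h u = 0" using 2 unfolding h_def
        by (metis (mono_tags, lifting) finite_lessThan lessThan_iff mult_zero_right prod_zero)
      have "g u = (\<Sum>i<m. if i = l then W l * (1 - u * a l) * (\<Prod>j\<in>{..<m} - {l}. 1 + u * a j) else 0)"
        unfolding g_def
      proof (intro sum.cong refl, goal_cases)
        case (1 i)
        have "(\<Prod>j\<in>{..<m} - {i}. 1 + u * a j) = 0" if "i \<noteq> l"
          using that 2 l0 by (intro prod_zero) auto
        then show ?case by auto
      qed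
      also have "\<dots> = (1 - u * a l) * (W l * (\<Prod>j\<in>{..<m} - {l}. 1 + u * a j))" using 2 by simp
      also have "W l * (\<Prod>j\<in>{..<m} - {l}. 1 + u * a j) = (\<Prod>j\<in>{..<m} - {l}. 1 - u * a j)"
        unfolding W_def prod.distrib[symmetric]
      proof (intro prod.cong refl)
        fix j assume j: "j \<in> {..<m} - {l}"
        have "a l \<noteq> a j" using j assms(2) 2 by (auto simp: inj_on_def)
        show "(a l + a j) / (a l - a j) * (1 + u * a j) = 1 - u * a j"
        proof -
          have "(a l + a j) * (1 + u * a j) - (1 - u * a j) * (a l - a j) = 2 * a j * (1 + u * a l)"
            by (simp add: algebra_simps)
          then show ?thesis using l0 \<open>a l \<noteq> a j\<close> by (simp add: divide_simps)
        qed
      qed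
      also have "(1 - u * a l) * \<dots> = f u"
        unfolding f_def using 2 by (subst prod.remove[of _ l]) auto
      finally show ?thesis using h0 by simp
    qed
  qed simp
  \<comment> \<open>\<open>F v = v^m * f (1 / v)\<close>, and likewise for \<open>G\<close> and \<open>H\<close>: the values at \<open>0\<close> are the
    coefficients of \<open>u^m\<close>.\<close>
  define F where "F v = (\<Prod>j<m. v - a j)" for v
  define G where "G v = (\<Sum>i<m. W i * (v - a i) * (\<Prod>j\<in>{..<m} - {i}. v + a j))" for v
  define H where "H v = (1 - (\<Sum>i<m. W i)) * (\<Prod>j<m. v + a j)" for v
  have ev: "F v = G v + H v" if "v \<noteq> 0" for v
  proof -
    have "v ^ m * f (1 / v) = F v"
    proof -
      have "v ^ m * f (1 / v) = (\<Prod>j<m. v * (1 - 1 / v * a j))" by (simp add: f_def prod.distrib)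
      also have "\<dots> = F v" unfolding F_def using that by (intro prod.cong refl) (simp add: field_simps)
      finally show ?thesis .
    qed
    moreover have "v ^ m * h (1 / v) = H v"
    proof -
      have "v ^ m * h (1 / v) = (1 - (\<Sum>i<m. W i)) * (\<Prod>j<m. v * (1 + 1 / v * a j))"
        by (simp add: h_def prod.distrib)
      also have "(\<Prod>j<m. v * (1 + 1 / v * a j)) = (\<Prod>j<m. v + a j)"
        using that by (intro prod.cong refl) (simp add: field_simps)
      finally show ?thesis by (simp add: H_def)
    qed
    moreover have "v ^ m * g (1 / v) = G v"
      unfolding g_def G_def sum_distrib_left
    proof (intro sum.cong refl)
      fix i assume i: "i \<in> {..<m}"
      have vm: "v ^ m = v * (\<Prod>j\<in>{..<m} - {i}. v)"
        using i prod.remove[of "{..<m}" i "\<lambda>_. v"] by simp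
      have "v ^ m * (W i * (1 - 1 / v * a i) * (\<Prod>j\<in>{..<m} - {i}. 1 + 1 / v * a j)) =
          W i * (v * (1 - 1 / v * a i)) * (\<Prod>j\<in>{..<m} - {i}. v * (1 + 1 / v * a j))"
        unfolding vm prod.distrib by (simp only: mult_ac)
      also have "(\<Prod>j\<in>{..<m} - {i}. v * (1 + 1 / v * a j)) = (\<Prod>j\<in>{..<m} - {i}. v + a j)"
        using that by (intro prod.cong refl) (simp add: field_simps)
      also have "v * (1 - 1 / v * a i) = v - a i" using that by (simp add: field_simps)
      finally show "v ^ m * (W i * (1 - 1 / v * a i) * (\<Prod>j\<in>{..<m} - {i}. 1 + 1 / v * a j)) =
          W i * (v - a i) * (\<Prod>j\<in>{..<m} - {i}. v + a j)" .
    qed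
    ultimately show ?thesis using fgh by (metis (no_types, lifting) distrib_left)
  qed
  have "F 0 = (\<lambda>v. G v + H v) 0"
    by (rule eq_by_perturbation)
       (auto simp: F_def[abs_def] G_def[abs_def] H_def[abs_def] eventually_at_filter ev[unfolded F_def G_def H_def] intro!: continuous_intros always_eventually)
  moreover have "F 0 = - (\<Prod>j<m. a j)"
    unfolding F_def using prod.distrib[of "\<lambda>_. - 1" a "{..<m}"] \<open>odd m\<close> by simp
  moreover have "G 0 = - (\<Sum>i<m. W i) * (\<Prod>j<m. a j)"
    unfolding G_def sum_distrib_right sum_negf[symmetric]
  proof (intro sum.cong refl)
    fix i assume "i \<in> {..<m}"
    then show "W i * (0 - a i) * (\<Prod>j\<in>{..<m} - {i}. 0 + a j) = - W i * (\<Prod>j<m. a j)"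
      by (subst prod.remove[of "{..<m}" i a]) auto
  qed
  moreover have "H 0 = (1 - (\<Sum>i<m. W i)) * (\<Prod>j<m. a j)" by (simp add: H_def)
  ultimately have "(1 - (\<Sum>i<m. W i)) * (\<Prod>j<m. a j) = 0"
    by (simp add: algebra_simps)
  moreover have "(\<Prod>j<m. a j) \<noteq> 0" using nz by simp
  ultimately show W1: "(\<Sum>i<m. W i) = 1" by simp
  show "(\<Prod>j<m. 1 - u * a j) = (\<Sum>i<m. W i * (1 - u * a i) * (\<Prod>j\<in>{..<m} - {i}. 1 + u * a j))"
    using fun_cong[OF fgh, of u] W1 by (simp add: f_def g_def h_def)
qed

text \<open>
  The Lagrange weight at \<open>p\<close> cancels the factors of the Pfaffian that involve \<open>a p\<close>.
  They agree up to sign, and the \<open>m - p\<close> sign changes amount to \<open>(-1) ^ p\<close> because \<open>m\<close>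
  is even.
\<close>
lemma schur_delete:
  assumes "even m" "p \<le> m" "inj_on a {..<Suc m}"
    and ns: "\<And>i j. i < Suc m \<Longrightarrow> j < Suc m \<Longrightarrow> a i + a j \<noteq> 0"
  shows "(\<Prod>j\<in>{..<Suc m} - {p}. (a p + a j) / (a p - a j)) * schur (Suc m) a =
           (-1) ^ p * schur m (\<lambda>i. a (insert_index p i))"
proof -
  let ?h = "\<lambda>i j. (a j - a i) / (a j + a i)"
  have e1: "(\<Prod>j\<in>{..<Suc m} - {p}. (a p + a j) / (a p - a j)) =
        (\<Prod>j<m. (a p + a (insert_index p j)) / (a p - a (insert_index p j)))"
  proof (rule prod.reindex_bij_betw[symmetric])
    show "bij_betw (insert_index p) {..<m} ({..<Suc m} - {p})"
      using insert_index_image[of p m] assms(2) insert_index_inj_on[of p "{..<m}"]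
      by (auto simp: bij_betw_def atLeast0LessThan)
  qed
  have e2: "(\<Prod>j<m. if j < p then ?h j p else ?h p (Suc j)) =
      (\<Prod>j<m. (if j < p then 1 else -1) * ?h (insert_index p j) p)"
    by (intro prod.cong refl) (auto simp: insert_index_def minus_divide_left add.commute)
  have e3: "(\<Prod>j<m. if j < p then 1 else -1 :: complex) = (-1) ^ p"
  proof -
    have "(\<Prod>j<m. if j < p then 1 else -1 :: complex) = (\<Prod>j\<in>{p..<m}. -1)"
      by (rule prod.mono_neutral_cong_right) auto
    also have "\<dots> = (-1) ^ (m - p)" by simp
    also have "\<dots> = (-1) ^ p" using assms(1,2) by (auto simp: minus_one_power_iff)
    finally show ?thesis .
  qed
  have e4: "(\<Prod>j<m. (a p + a (insert_index p j)) / (a p - a (insert_index p j))) *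
      (\<Prod>j<m. ?h (insert_index p j) p) = 1"
    unfolding prod.distrib[symmetric]
  proof (intro prod.neutral ballI)
    fix j assume "j \<in> {..<m}"
    then have l: "insert_index p j < Suc m" "insert_index p j \<noteq> p" by (auto simp: insert_index_def)
    have "a p \<noteq> a (insert_index p j)"
      using inj_on_eq_iff[OF assms(3), of p "insert_index p j"] assms(2) l by (metis lessThan_iff le_imp_less_Suc)
    moreover have "a p + a (insert_index p j) \<noteq> 0" by (rule ns) (use assms(2) l in auto)
    ultimately show "(a p + a (insert_index p j)) / (a p - a (insert_index p j)) * ?h (insert_index p j) p = 1"
      by simp
  qed
  have "schur (Suc m) a = (-1) ^ p * (\<Prod>j<m. ?h (insert_index p j) p) * schur m (\<lambda>i. a (insert_index p i))"
    unfolding schur_def pair_prod_insert_index[OF assms(2)] e2 prod.distrib e3 ..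
  then show ?thesis
    unfolding e1 using e4 by (simp only: mult_ac) (simp only: mult.assoc[symmetric] mult_1_left)
qed

lemma isCont_schur:
  assumes "\<And>i j. i < m \<Longrightarrow> j < m \<Longrightarrow> a i + a j \<noteq> 0"
  shows "isCont (\<lambda>t. schur m (\<lambda>i. a i + t * b i)) 0"
  unfolding schur_def using assms by (intro continuous_intros) auto

lemma eventually_perturbed_sum_nonzero:
  fixes a :: "nat \<Rightarrow> complex"
  assumes "\<And>i j. i < m \<Longrightarrow> j < m \<Longrightarrow> a i + a j \<noteq> 0"
  shows "eventually (\<lambda>t. \<forall>i\<in>{..<m}. \<forall>j\<in>{..<m}. (a i + t * b i) + (a j + t * b j) \<noteq> 0) (at 0)"
  unfolding eventually_ball_finite_distrib[OF finite_lessThan]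
proof (intro ballI)
  fix i j assume "i \<in> {..<m}" "j \<in> {..<m}"
  then have "eventually (\<lambda>t. (a i + a j) + t * (b i + b j) \<noteq> 0) (at 0)"
    using assms by (intro eventually_affine_nonzero) auto
  then show "eventually (\<lambda>t. (a i + t * b i) + (a j + t * b j) \<noteq> 0) (at 0)"
    by (rule eventually_mono) (simp add: algebra_simps)
qed

text \<open>
  By \<open>schur_delete\<close> this says that the Lagrange weights add up to \<open>1\<close>. Those weights
  exist for distinct \<open>a i\<close> only, so coinciding entries are first moved apart.
\<close>
lemma schur_expand_odd:
  assumes "even m"
    and ns: "\<And>i j. i < Suc m \<Longrightarrow> j < Suc m \<Longrightarrow> a i + a j \<noteq> 0"
  shows "schur (Suc m) a = (\<Sum>p<Suc m. (-1) ^ p * schur m (\<lambda>i. a (insert_index p i)))"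
proof -
  have distinct: "schur (Suc m) a = (\<Sum>p<Suc m. (-1) ^ p * schur m (\<lambda>i. a (insert_index p i)))"
    if inj: "inj_on a {..<Suc m}"
    and ns: "\<And>i j. i < Suc m \<Longrightarrow> j < Suc m \<Longrightarrow> a i + a j \<noteq> 0" for a
  proof -
    have "(\<Sum>p<Suc m. (-1) ^ p * schur m (\<lambda>i. a (insert_index p i))) =
      (\<Sum>p<Suc m. (\<Prod>j\<in>{..<Suc m} - {p}. (a p + a j) / (a p - a j)) * schur (Suc m) a)"
      by (intro sum.cong refl schur_delete[symmetric]) (use assms(1) inj ns in auto)
    also have "\<dots> = schur (Suc m) a"
      unfolding sum_distrib_right[symmetric]
      using lagrange_reflection(2)[of "Suc m" a] assms(1) inj ns by simp
    finally show ?thesis by simp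
  qed
  let ?a = "\<lambda>t i. a i + t * of_nat i"
  have "schur (Suc m) (?a 0) = (\<Sum>p<Suc m. (-1) ^ p * schur m (\<lambda>i. ?a 0 (insert_index p i)))"
  proof (rule eq_by_perturbation)
    show "isCont (\<lambda>t. schur (Suc m) (?a t)) 0" by (rule isCont_schur) (use ns in auto)
    show "isCont (\<lambda>t. \<Sum>p<Suc m. (-1) ^ p * schur m (\<lambda>i. ?a t (insert_index p i))) 0"
      by (intro continuous_intros isCont_schur ns) (auto simp: insert_index_def)
    have ev: "eventually (\<lambda>t. \<forall>i\<in>{..<Suc m}. \<forall>j\<in>{..<Suc m}. ?a t i + ?a t j \<noteq> 0) (at 0)"
      by (rule eventually_perturbed_sum_nonzero) (rule ns)
    show "eventually (\<lambda>t. schur (Suc m) (?a t) =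
        (\<Sum>p<Suc m. (-1) ^ p * schur m (\<lambda>i. ?a t (insert_index p i)))) (at 0)"
      using eventually_perturbed_inj[of a "Suc m"] ev
      by eventually_elim (rule distinct, auto)
  qed
  then show ?thesis by simp
qed

text \<open>
  The expansion of the Pfaffian along its last row. It is the identity of
  \<open>lagrange_reflection\<close> at the reciprocal of the last entry, divided by
  \<open>\<Prod>j<Suc m. 1 + u * a j\<close>.
\<close>
lemma schur_expand_even:
  assumes "even m"
    and ns: "\<And>i j. i < Suc (Suc m) \<Longrightarrow> j < Suc (Suc m) \<Longrightarrow> a i + a j \<noteq> 0"
  shows "schur (Suc (Suc m)) a =
    (\<Sum>p<Suc m. (-1) ^ p * ((a (Suc m) - a p) / (a (Suc m) + a p)) * schur m (\<lambda>i. a (insert_index p i)))"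
proof -
  have distinct: "schur (Suc (Suc m)) a =
    (\<Sum>p<Suc m. (-1) ^ p * ((a (Suc m) - a p) / (a (Suc m) + a p)) * schur m (\<lambda>i. a (insert_index p i)))"
    if inj: "inj_on a {..<Suc m}"
    and ns: "\<And>i j. i < Suc (Suc m) \<Longrightarrow> j < Suc (Suc m) \<Longrightarrow> a i + a j \<noteq> 0" for a
  proof -
    define u where "u = 1 / a (Suc m)"
    define W where "W p = (\<Prod>j\<in>{..<Suc m} - {p}. (a p + a j) / (a p - a j))" for p
    have am: "a (Suc m) \<noteq> 0" using ns[of "Suc m" "Suc m"] by auto
    have q: "(a (Suc m) - a i) / (a (Suc m) + a i) = (1 - u * a i) / (1 + u * a i)" for i
      using am by (simp add: u_def divide_simps)
    have un: "1 + u * a i \<noteq> 0" if "i < Suc m" for i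
      using ns[of "Suc m" i] am that by (auto simp: u_def divide_simps)
    have "(\<Sum>p<Suc m. (-1) ^ p * ((a (Suc m) - a p) / (a (Suc m) + a p)) * schur m (\<lambda>i. a (insert_index p i))) =
      (\<Sum>p<Suc m. W p * ((1 - u * a p) / (1 + u * a p)) * schur (Suc m) a)"
    proof (intro sum.cong refl, goal_cases)
      case (1 p)
      then have e: "W p * schur (Suc m) a = (-1) ^ p * schur m (\<lambda>i. a (insert_index p i))"
        unfolding W_def by (intro schur_delete) (use assms(1) inj ns in auto)
      have "(-1) ^ p * ((a (Suc m) - a p) / (a (Suc m) + a p)) * schur m (\<lambda>i. a (insert_index p i)) =
         ((1 - u * a p) / (1 + u * a p)) * (W p * schur (Suc m) a)"
        unfolding e q by (simp only: mult_ac)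
      then show ?case
        by (simp only: mult_ac)
    qed
    also have "\<dots> = (\<Sum>p<Suc m. W p * ((1 - u * a p) / (1 + u * a p))) * schur (Suc m) a"
      by (simp only: sum_distrib_right)
    also have "(\<Sum>p<Suc m. W p * ((1 - u * a p) / (1 + u * a p))) =
       (\<Sum>p<Suc m. W p * (1 - u * a p) * (\<Prod>j\<in>{..<Suc m} - {p}. 1 + u * a j) / (\<Prod>j<Suc m. 1 + u * a j))"
    proof (intro sum.cong refl, goal_cases)
      case p: (1 p)
      have "(\<Prod>j<Suc m. 1 + u * a j) = (1 + u * a p) * (\<Prod>j\<in>{..<Suc m} - {p}. 1 + u * a j)"
        using p by (intro prod.remove) auto
      moreover have "(\<Prod>j\<in>{..<Suc m} - {p}. 1 + u * a j) \<noteq> 0" using un by auto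
      ultimately show ?case
        using un p by (simp add: divide_simps del: prod.lessThan_Suc)
    qed
    also have "\<dots> = (\<Prod>j<Suc m. 1 - u * a j) / (\<Prod>j<Suc m. 1 + u * a j)"
      unfolding sum_divide_distrib[symmetric]
      using lagrange_reflection(1)[of "Suc m" a u] assms(1) inj ns by (simp add: W_def del: prod.lessThan_Suc)
    also have "\<dots> = (\<Prod>j<Suc m. (a (Suc m) - a j) / (a (Suc m) + a j))"
      by (simp only: q prod_dividef)
    also have "\<dots> * schur (Suc m) a = schur (Suc (Suc m)) a"
      unfolding schur_def by (simp add: mult_ac)
    finally show ?thesis by simp
  qed
  let ?a = "\<lambda>t i. a i + t * of_nat i"
  have "schur (Suc (Suc m)) (?a 0) = (\<Sum>p<Suc m. (-1) ^ p *
     ((?a 0 (Suc m) - ?a 0 p) / (?a 0 (Suc m) + ?a 0 p)) * schur m (\<lambda>i. ?a 0 (insert_index p i)))"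
  proof (rule eq_by_perturbation)
    show "isCont (\<lambda>t. schur (Suc (Suc m)) (?a t)) 0" by (rule isCont_schur) (use ns in auto)
    show "isCont (\<lambda>t. \<Sum>p<Suc m. (-1) ^ p * ((?a t (Suc m) - ?a t p) / (?a t (Suc m) + ?a t p)) *
        schur m (\<lambda>i. ?a t (insert_index p i))) 0"
      by (intro continuous_intros isCont_schur ns) (use ns in \<open>auto simp: insert_index_def\<close>)
    have ev: "eventually (\<lambda>t. \<forall>i\<in>{..<Suc (Suc m)}. \<forall>j\<in>{..<Suc (Suc m)}. ?a t i + ?a t j \<noteq> 0) (at 0)"
      by (rule eventually_perturbed_sum_nonzero) (rule ns)
    show "eventually (\<lambda>t. schur (Suc (Suc m)) (?a t) =
        (\<Sum>p<Suc m. (-1) ^ p * ((?a t (Suc m) - ?a t p) / (?a t (Suc m) + ?a t p)) *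
           schur m (\<lambda>i. ?a t (insert_index p i)))) (at 0)"
      using eventually_perturbed_inj[of a "Suc m"] ev
      by eventually_elim (rule distinct, auto)
  qed
  then show ?thesis by simp
qed

section \<open>Rogers polynomials in one and in several variables\<close>

text \<open>
  Separates the summation index at position \<open>p\<close> from the others, as needed after
  expanding the Pfaffian.
\<close>
lemma sum_PiE_insert_index:
  fixes H :: "'a \<Rightarrow> (nat \<Rightarrow> 'a) \<Rightarrow> 'b :: comm_monoid_add"
  assumes "p \<le> m"
  shows "(\<Sum>k\<in>{..<Suc m} \<rightarrow>\<^sub>E A. H (k p) (restrict (\<lambda>i. k (insert_index p i)) {..<m})) =
           (\<Sum>l\<in>A. \<Sum>k\<in>{..<m} \<rightarrow>\<^sub>E A. H l k)"
proof -
  let ?j = "\<lambda>(l, k). \<lambda>i\<in>{..<Suc m}. if i = p then l else k (delete_index p i)"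
  have "(\<Sum>k\<in>{..<Suc m} \<rightarrow>\<^sub>E A. H (k p) (restrict (\<lambda>i. k (insert_index p i)) {..<m})) =
     (\<Sum>(l, k)\<in>A \<times> ({..<m} \<rightarrow>\<^sub>E A). H l k)"
  proof (rule sum.reindex_bij_witness[where j = "\<lambda>k. (k p, restrict (\<lambda>i. k (insert_index p i)) {..<m})" and i = ?j])
    fix k assume k: "k \<in> {..<Suc m} \<rightarrow>\<^sub>E A"
    show "?j (k p, restrict (\<lambda>i. k (insert_index p i)) {..<m}) = k"
    proof (rule ext)
      fix i
      show "?j (k p, restrict (\<lambda>i. k (insert_index p i)) {..<m}) i = k i"
      proof (cases "i < Suc m \<and> i \<noteq> p")
        case True
        then have "delete_index p i < m" "insert_index p (delete_index p i) = i"
          using assms by (auto simp: delete_index_def insert_index_def)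
        then show ?thesis using True by simp
      next
        case False
        then show ?thesis using PiE_arb[OF k, of i] assms by auto
      qed
    qed
    show "(k p, restrict (\<lambda>i. k (insert_index p i)) {..<m}) \<in> A \<times> ({..<m} \<rightarrow>\<^sub>E A)"
      using k assms by (auto simp: insert_index_def PiE_iff)
  next
    fix lk assume "lk \<in> A \<times> ({..<m} \<rightarrow>\<^sub>E A)"
    then obtain l k where lk: "lk = (l, k)" "l \<in> A" "k \<in> {..<m} \<rightarrow>\<^sub>E A" by auto
    have "restrict (\<lambda>i. ?j (l, k) (insert_index p i)) {..<m} = k"
    proof (rule ext)
      fix i
      show "restrict (\<lambda>i. ?j (l, k) (insert_index p i)) {..<m} i = k i"
      proof (cases "i < m")
        case True
        then have "insert_index p i < Suc m" "insert_index p i \<noteq> p" "delete_index p (insert_index p i) = i"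
          by (auto simp: insert_index_def delete_index_def)
        then show ?thesis using True by simp
      next
        case False
        then show ?thesis using PiE_arb[OF lk(3), of i] by auto
      qed
    qed
    then show "(?j lk p, restrict (\<lambda>i. ?j lk (insert_index p i)) {..<m}) = lk"
      using assms lk by simp
    show "?j lk \<in> {..<Suc m} \<rightarrow>\<^sub>E A"
      using lk assms by (auto simp: PiE_iff delete_index_def)
  qed auto
  then show ?thesis by (simp add: sum.cartesian_product)
qed

lemma schur_cong: "(\<And>i. i < m \<Longrightarrow> a i = b i) \<Longrightarrow> schur m a = schur m b"
  unfolding schur_def by (intro prod.cong refl) auto

text \<open>
  For \<open>a = q^k\<close>, \<open>b = q^l\<close> and \<open>Q = q^(n+1)\<close> the four fractions are \<open>c_k\<close>, \<open>c_l\<close>,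
  \<open>c_(n+1-k)\<close> and \<open>c_(n+1-l)\<close>. Over a common denominator both the difference of products
  and the difference of sums contain the factor \<open>a * b - Q\<close>, and their ratio is the
  kernel of the Pfaffian.
\<close>
lemma coth_kernel_identity:
  fixes a b Q :: complex
  assumes "a \<noteq> 1" "b \<noteq> 1" "a \<noteq> Q" "b \<noteq> Q" "a + b \<noteq> 0"
  shows "(b - a) / (b + a) * ((1 + a) / (1 - a) * ((1 + b) / (1 - b)) - (a + Q) / (a - Q) * ((b + Q) / (b - Q))) =
    ((1 + b) / (1 - b) + (b + Q) / (b - Q)) - ((1 + a) / (1 - a) + (a + Q) / (a - Q))"
proof -
  have s: "(1 + a) / (1 - a) + (a + Q) / (a - Q) = 2 * a * (1 - Q) / ((1 - a) * (a - Q))"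
    if "a \<noteq> 1" "a \<noteq> Q" for a
    using that by (simp add: divide_simps) (simp add: algebra_simps)
  have p: "(1 + a) / (1 - a) * ((1 + b) / (1 - b)) - (a + Q) / (a - Q) * ((b + Q) / (b - Q)) =
      2 * (1 - Q) * (a + b) * (a * b - Q) / ((1 - a) * (1 - b) * (a - Q) * (b - Q))"
    using assms by (simp add: divide_simps) (simp add: algebra_simps)
  have e: "2 * b * (1 - Q) / ((1 - b) * (b - Q)) - 2 * a * (1 - Q) / ((1 - a) * (a - Q)) =
     2 * (1 - Q) * (b - a) * (a * b - Q) / ((1 - a) * (1 - b) * (a - Q) * (b - Q))"
    using assms by (simp add: divide_simps) (simp add: algebra_simps)
  have c: "a + b = b + a" "b + a \<noteq> 0" using assms(5) by (auto simp: add.commute)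
  have "u / c * (X * c * Y / D) = X * u * Y / D" if "c \<noteq> 0" for u c X Y D :: complex
    using that by simp
  then show ?thesis
    unfolding p s[OF assms(1,3)] s[OF assms(2,4)] e unfolding c(1) using c(2) by blast
qed

locale generic_q =
  fixes q :: complex
  assumes q_nz: "q \<noteq> 0" and q_not_root: "\<And>k. k > 0 \<Longrightarrow> q ^ k \<noteq> 1"
begin

lemma q_pow_plus_one_nz: "1 + q ^ k \<noteq> 0"
proof
  assume "1 + q ^ k = 0"
  then have e: "q ^ k = - 1" by (simp add: add_eq_0_iff)
  then have "q ^ (2 * k) = 1" by (simp add: power_mult_distrib power_mult power2_eq_square[symmetric] mult.commute[of 2])
  then show False using q_not_root[of "2 * k"] e by (cases "k = 0") auto
qed

lemma q_pow_eq_iff: "q ^ k = q ^ l \<longleftrightarrow> k = l"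
proof
  have *: "k = l" if "q ^ k = q ^ l" "k \<le> l" for k l
  proof -
    have "q ^ l = q ^ k * q ^ (l - k)" using that(2) by (simp add: power_add[symmetric])
    then have "q ^ (l - k) = 1" using q_nz that(1) by simp
    then show ?thesis using q_not_root[of "l - k"] that by (cases "l - k > 0") auto
  qed
  show "k = l" if "q ^ k = q ^ l" using *[of k l] *[of l k] that by (cases "k \<le> l") auto
qed simp

lemma q_pow_sum_nz: "q ^ k + q ^ l \<noteq> 0"
proof (induction k l rule: linorder_wlog)
  case (le k l)
  have "q ^ k + q ^ l = q ^ k * (1 + q ^ (l - k))"
    using le by (simp add: distrib_left power_add[symmetric])
  then show ?case using q_nz q_pow_plus_one_nz by simp
qed (simp add: add.commute)

text \<open>
  A hyperbolic cotangent: \<open>cth k = coth (h k)\<close> for \<open>q = exp (- 2 h)\<close>, with the addition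
  law \<open>cth_add\<close>.
\<close>
definition cth :: "nat \<Rightarrow> complex" where
  "cth k = (1 + q ^ k) / (1 - q ^ k)"

lemma cth_nz: "k > 0 \<Longrightarrow> cth k \<noteq> 0"
  unfolding cth_def using q_not_root[of k] q_pow_plus_one_nz by auto

lemma cth_add:
  assumes "a > 0" "b > 0"
  shows "cth a * cth b + 1 = cth (a + b) * (cth a + cth b)"
proof -
  have *: "(1 + u) / (1 - u) * ((1 + v) / (1 - v)) + 1 =
      (1 + u * v) / (1 - u * v) * ((1 + u) / (1 - u) + (1 + v) / (1 - v))"
    if "u \<noteq> 1" "v \<noteq> 1" "u * v \<noteq> 1" for u v :: complex
    using that by (simp add: divide_simps) (simp add: algebra_simps)
  show ?thesis
    unfolding cth_def power_add
    by (rule *) (use assms q_not_root[of a] q_not_root[of b] q_not_root[of "a + b"] in \<open>auto simp: power_add\<close>)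
qed

definition gco :: "nat \<Rightarrow> complex" where
  "gco k = qpoch (- q) q k / qpoch q q k"

lemma gco_0 [simp]: "gco 0 = 1" by (simp add: gco_def qpoch_def)

lemma gco_Suc: "gco (Suc k) = cth (Suc k) * gco k"
  by (simp add: gco_def qpoch_def cth_def mult_ac)

text \<open>
  The coefficient of \<open>x ^ k\<close> in the one-variable \<open>P_n\<close>; see \<open>Pn_eq_mrogers\<close>.
\<close>
definition rco :: "nat \<Rightarrow> nat \<Rightarrow> complex" where
  "rco n k = (if k \<le> n then (-1) ^ k * gco k * gco (n - k) else 0)"

definition rogers :: "nat \<Rightarrow> complex \<Rightarrow> complex" where
  "rogers n x = (\<Sum>k\<le>n. rco n k * x ^ k)"

text \<open>
  The coefficient of \<open>x ^ k\<close> in \<open>x * rogers n x\<close>.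
\<close>
definition rco' :: "nat \<Rightarrow> nat \<Rightarrow> complex" where
  "rco' n k = (if k = 0 then 0 else rco n (k - 1))"

lemma rogers_extend: "n \<le> N \<Longrightarrow> rogers n x = (\<Sum>k\<le>N. rco n k * x ^ k)"
  unfolding rogers_def by (rule sum.mono_neutral_left) (auto simp: rco_def)

lemma rogers_shift: "n < N \<Longrightarrow> x * rogers n x = (\<Sum>k\<le>N. rco' n k * x ^ k)"
proof (cases N)
  case (Suc N')
  moreover assume "n < N"
  ultimately have "x * rogers n x = (\<Sum>k\<le>N'. rco n k * x ^ Suc k)"
    by (simp add: rogers_extend[of n N'] sum_distrib_left mult_ac)
  then show ?thesis using Suc by (simp add: sum.atMost_Suc_shift rco'_def del: sum.atMost_Suc)
qed simp

text \<open>
  The coefficients that enter the recurrence have a common factor, and only values of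
  \<open>cth\<close> are left.
\<close>
lemma rco_inner:
  assumes "1 \<le> k" "k \<le> n"
  defines "B \<equiv> (-1) ^ k * gco (k - 1) * gco (n - k)"
  shows "rco n k = cth k * B" "rco' n k = - cth (n + 1 - k) * B" "rco' (n - 1) k = - B"
proof -
  obtain k' where k': "k = Suc k'" using assms(1) by (cases k) auto
  have "n - k' = Suc (n - k)" using k' assms by simp
  then show "rco n k = cth k * B" "rco' n k = - cth (n + 1 - k) * B" "rco' (n - 1) k = - B"
    using assms k' by (simp_all add: rco_def rco'_def gco_Suc Suc_diff_le)
qed

lemma rco_rec:
  assumes "n \<ge> 1"
  shows "rco (Suc n) k = cth (Suc n) * (rco n k - rco' n k) + rco' (n - 1) k"
proof -
  consider "k = 0" | "1 \<le> k" "k \<le> n" | "k = Suc n" | "k > Suc n" by linarith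
  then show ?thesis
  proof cases
    case 2
    define B where "B = (-1) ^ k * gco (k - 1) * gco (n - k)"
    have "rco (Suc n) k = cth k * cth (n + 1 - k) * B"
    proof -
      obtain k' where "k = Suc k'" using 2 by (cases k) auto
      moreover from this have "n - k' = Suc (n - k)" using 2 by simp
      ultimately show ?thesis using 2 by (simp add: rco_def B_def gco_Suc Suc_diff_le mult_ac)
    qed
    moreover have "cth k * cth (n + 1 - k) + 1 = cth (Suc n) * (cth k + cth (n + 1 - k))"
      using cth_add[of k "n + 1 - k"] 2 by simp
    moreover have "cth (Suc n) * (cth k * B - - cth (n + 1 - k) * B) + - B =
        (cth (Suc n) * (cth k + cth (n + 1 - k)) - 1) * B"
      by (simp add: algebra_simps)
    ultimately show ?thesis
      unfolding rco_inner[OF 2] B_def[symmetric] by (metis add_diff_cancel_right')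
  qed (use assms in \<open>auto simp: rco_def rco'_def gco_Suc\<close>)
qed

text \<open>
  Coefficientwise, the recurrence is the addition law of \<open>cth\<close> for
  \<open>k + (n + 1 - k) = n + 1\<close>.
\<close>
lemma rogers_rec:
  assumes "n \<ge> 1"
  shows "rogers (Suc n) x = cth (Suc n) * (1 - x) * rogers n x + x * rogers (n - 1) x"
proof -
  have "rogers (Suc n) x = (\<Sum>k\<le>Suc n. (cth (Suc n) * (rco n k - rco' n k) + rco' (n - 1) k) * x ^ k)"
    unfolding rogers_def rco_rec[OF assms] ..
  also have "\<dots> = cth (Suc n) * ((\<Sum>k\<le>Suc n. rco n k * x ^ k) - (\<Sum>k\<le>Suc n. rco' n k * x ^ k)) +
      (\<Sum>k\<le>Suc n. rco' (n - 1) k * x ^ k)"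
    by (simp only: sum_distrib_left sum_subtractf[symmetric] sum.distrib[symmetric])
       (simp only: algebra_simps)
  also have "\<dots> = cth (Suc n) * (rogers n x - x * rogers n x) + x * rogers (n - 1) x"
    using rogers_extend[of n "Suc n" x] rogers_shift[of n "Suc n" x] rogers_shift[of "n - 1" "Suc n" x] by simp
  finally show ?thesis by (simp add: algebra_simps)
qed

lemma rogers_0 [simp]: "rogers 0 x = 1"
  by (simp add: rogers_def rco_def)

lemma rogers_1: "rogers (Suc 0) x = cth 1 * (1 - x)"
  by (simp add: rogers_def rco_def gco_Suc algebra_simps)

text \<open>
  The kernel \<open>(a j - a i) / (a j + a i)\<close> of the Pfaffian for \<open>a i = q ^ k\<close> and
  \<open>a j = q ^ l\<close>.
\<close>
definition rho :: "nat \<Rightarrow> nat \<Rightarrow> complex" where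
  "rho k l = (q ^ l - q ^ k) / (q ^ l + q ^ k)"

definition rogers2 :: "nat \<Rightarrow> complex \<Rightarrow> complex \<Rightarrow> complex" where
  "rogers2 n x y = (\<Sum>k\<le>n. \<Sum>l\<le>n. rho k l * (rco n k * x ^ k) * (rco n l * y ^ l))"

lemma rho_antisym: "rho l k = - rho k l"
  unfolding rho_def by (simp add: minus_divide_left add.commute)

lemma rho_Suc: "rho (Suc k) (Suc l) = rho k l"
proof -
  have "q ^ Suc l - q ^ Suc k = q * (q ^ l - q ^ k)" "q ^ Suc l + q ^ Suc k = q * (q ^ l + q ^ k)"
    by (simp_all add: algebra_simps)
  then show ?thesis unfolding rho_def using q_nz by simp
qed

text \<open>
  The coefficient of \<open>x ^ k * y ^ l\<close> in \<open>rogers2_eq\<close>. In the interior it is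
  \<open>coth_kernel_identity\<close>; on the boundary some coefficients vanish, and the cases
  \<open>rho 0 l * cth l = - 1\<close> and \<open>rho (n + 1) l * cth (n + 1 - l) = 1\<close> remain.
\<close>
lemma rogers2_coeff:
  assumes "n \<ge> 1" "k \<le> Suc n" "l \<le> Suc n"
  shows "rho k l * (rco n k * rco n l - rco' n k * rco' n l) =
    (rco n k - rco' n k) * rco' (n - 1) l - (rco n l - rco' n l) * rco' (n - 1) k"
proof -
  have cth_refl: "cth (n + 1 - k) = (q ^ k + q ^ (n + 1)) / (q ^ k - q ^ (n + 1))" if "k \<le> n" for k
  proof -
    have "q ^ (n + 1) = q ^ k * q ^ (n + 1 - k)" using that by (simp add: power_add[symmetric])
    then have "q ^ k + q ^ (n + 1) = q ^ k * (1 + q ^ (n + 1 - k))"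
      "q ^ k - q ^ (n + 1) = q ^ k * (1 - q ^ (n + 1 - k))"
      by (simp_all add: algebra_simps)
    then show ?thesis unfolding cth_def using q_nz by simp
  qed
  \<comment> \<open>Both sides are antisymmetric under \<open>k \<leftrightarrow> l\<close>, so it suffices to treat
    extremal \<open>k\<close>.\<close>
  have edge: "rho k l * (rco n k * rco n l - rco' n k * rco' n l) =
    (rco n k - rco' n k) * rco' (n - 1) l - (rco n l - rco' n l) * rco' (n - 1) k"
    if kk: "k = 0 \<or> k = Suc n" and ll: "l \<le> Suc n" for k l
  proof -
    consider "l = 0" | "1 \<le> l" "l \<le> n" | "l = Suc n" using ll by linarith
    then show ?thesis
    proof cases
      case 1
      then show ?thesis using kk assms(1) by (auto simp: rco_def rco'_def rho_def)
    next
      case 2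
      have 0: "rho 0 l * cth l = - 1"
        unfolding rho_def cth_def using q_not_root[of l] 2 q_pow_plus_one_nz[of l]
        by (simp add: divide_simps add.commute)
      have S: "rho (Suc n) l * cth (n + 1 - l) = 1"
        unfolding cth_refl[OF 2(2)] rho_def
        using q_pow_sum_nz[of l "Suc n"] q_pow_eq_iff[of l "Suc n"] 2 by (simp add: divide_simps)
      define B where "B = (-1) ^ l * gco (l - 1) * gco (n - l)"
      note R = rco_inner[OF 2, folded B_def]
      show ?thesis
      proof (cases "k = 0")
        case True
        have "rho 0 l * (gco n * (cth l * B)) = (rho 0 l * cth l) * (gco n * B)" by (simp add: mult_ac)
        then show ?thesis unfolding R 0 using True by (simp add: rco_def rco'_def)
      next
        case False
        then have k: "k = Suc n" using kk by simp
        have "rho (Suc n) l * (((-1) ^ n * gco n) * (cth (n + 1 - l) * B)) =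
            (rho (Suc n) l * cth (n + 1 - l)) * ((-1) ^ n * gco n * B)" by (simp only: mult_ac)
        moreover have "\<not> n \<le> n - 1" using assms(1) by simp
        ultimately show ?thesis unfolding R S k using assms(1) by (simp add: rco_def rco'_def)
      qed
    next
      case 3
      then show ?thesis using kk assms(1) by (auto simp: rco_def rco'_def rho_def)
    qed
  qed
  consider "k = 0 \<or> k = Suc n" | "l = 0 \<or> l = Suc n" | "1 \<le> k" "k \<le> n" "1 \<le> l" "l \<le> n"
    using assms by linarith
  then show ?thesis
  proof cases
    case 1
    then show ?thesis using edge assms by blast
  next
    case 2
    then show ?thesis using edge[of l k] assms rho_antisym[of l k] by (simp add: algebra_simps)
  next
    case 3
    define B where "B = (-1) ^ k * gco (k - 1) * gco (n - k)"
    define C where "C = (-1) ^ l * gco (l - 1) * gco (n - l)"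
    note R = rco_inner[OF 3(1,2), folded B_def] rco_inner[OF 3(3,4), folded C_def]
    have K: "rho k l * (cth k * cth l - cth (n + 1 - k) * cth (n + 1 - l)) =
        (cth l + cth (n + 1 - l)) - (cth k + cth (n + 1 - k))"
      unfolding cth_refl[OF 3(2)] cth_refl[OF 3(4)] rho_def cth_def[of k] cth_def[of l]
      by (rule coth_kernel_identity)
         (use q_not_root[of k] q_not_root[of l] q_pow_eq_iff[of k "n + 1"] q_pow_eq_iff[of l "n + 1"]
            q_pow_sum_nz[of k l] 3 in auto)
    have "rho k l * (cth k * B * (cth l * C) - - cth (n + 1 - k) * B * (- cth (n + 1 - l) * C)) =
        rho k l * (cth k * cth l - cth (n + 1 - k) * cth (n + 1 - l)) * (B * C)"
      by (simp add: algebra_simps)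
    then show ?thesis unfolding R K by (simp add: algebra_simps)
  qed
qed

text \<open>
  An analogue of the Christoffel-Darboux formula. Because \<open>rho\<close> is invariant under a
  common shift of its arguments, multiplication by \<open>x * y\<close> just shifts both coefficients
  under the kernel, and the kernel then disappears by \<open>rogers2_coeff\<close>.
\<close>
lemma rogers2_eq:
  assumes "n \<ge> 1"
  shows "(1 - x * y) * rogers2 n x y =
    (rogers (Suc n) x * (y * rogers (n - 1) y) - rogers (Suc n) y * (x * rogers (n - 1) x)) / cth (Suc n)"
proof -
  let ?S = "\<lambda>f. \<Sum>k\<le>Suc n. \<Sum>l\<le>Suc n. f k l * x ^ k * y ^ l"
  have 1: "rogers2 n x y = ?S (\<lambda>k l. rho k l * (rco n k * rco n l))"
    unfolding rogers2_def by (simp add: rco_def mult_ac)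
  have 2: "x * y * rogers2 n x y = ?S (\<lambda>k l. rho k l * (rco' n k * rco' n l))"
    unfolding rogers2_def sum.atMost_Suc_shift
    by (simp add: rco'_def rho_Suc sum_distrib_left mult_ac)
  have prod: "?S (\<lambda>k l. f k * g l) = (\<Sum>k\<le>Suc n. f k * x ^ k) * (\<Sum>l\<le>Suc n. g l * y ^ l)" for f g :: "nat \<Rightarrow> complex"
    by (simp only: sum_product) (simp only: mult_ac)
  have A: "(\<Sum>k\<le>Suc n. (rco n k - rco' n k) * x ^ k) = (1 - x) * rogers n x" for x
    by (simp only: left_diff_distrib sum_subtractf rogers_extend[of n "Suc n", symmetric, OF le_SucI[OF order_refl]]
        rogers_shift[of n "Suc n", symmetric, OF lessI] mult_1_left)
  have B: "(\<Sum>k\<le>Suc n. rco' (n - 1) k * x ^ k) = x * rogers (n - 1) x" for x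
    using rogers_shift[of "n - 1" "Suc n" x] assms by simp
  have "(1 - x * y) * rogers2 n x y = rogers2 n x y - x * y * rogers2 n x y"
    by (simp add: algebra_simps)
  also have "\<dots> = ?S (\<lambda>k l. rho k l * (rco n k * rco n l)) - ?S (\<lambda>k l. rho k l * (rco' n k * rco' n l))"
    by (rule arg_cong2[where f = "(-)", OF 1 2])
  also have "\<dots> = ?S (\<lambda>k l. rho k l * (rco n k * rco n l - rco' n k * rco' n l))"
    by (simp only: sum_subtractf left_diff_distrib right_diff_distrib)
  also have "\<dots> = ?S (\<lambda>k l. (rco n k - rco' n k) * rco' (n - 1) l - rco' (n - 1) k * (rco n l - rco' n l))"
    by (intro sum.cong refl) (use rogers2_coeff[OF assms] in \<open>simp add: mult_ac\<close>)
  also have "\<dots> = ?S (\<lambda>k l. (rco n k - rco' n k) * rco' (n - 1) l) - ?S (\<lambda>k l. rco' (n - 1) k * (rco n l - rco' n l))"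
    by (simp only: sum_subtractf left_diff_distrib)
  also have "\<dots> = (1 - x) * rogers n x * (y * rogers (n - 1) y) - x * rogers (n - 1) x * ((1 - y) * rogers n y)"
    unfolding prod A B ..
  also have "\<dots> = (rogers (Suc n) x * (y * rogers (n - 1) y) - rogers (Suc n) y * (x * rogers (n - 1) x)) / cth (Suc n)"
    unfolding rogers_rec[OF assms] using cth_nz[of "Suc n"] by (simp add: field_simps)
  finally show ?thesis .
qed

text \<open>
  The function \<open>P_n (x_1, ..., x_m)\<close> of the theorem, with the prefactor distributed over
  the coefficients and with indices starting at \<open>0\<close>; for \<open>m = 1\<close> it is \<open>rogers n\<close> and
  for \<open>m = 2\<close> it is \<open>rogers2 n\<close>.
\<close>
definition mrogers :: "nat \<Rightarrow> nat \<Rightarrow> (nat \<Rightarrow> complex) \<Rightarrow> complex" where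
  "mrogers n m x = (\<Sum>k\<in>{..<m} \<rightarrow>\<^sub>E {..n}. schur m (\<lambda>i. q ^ k i) * (\<Prod>i<m. rco n (k i) * x i ^ k i))"

lemma mrogers_0 [simp]: "mrogers n 0 x = 1"
  by (simp add: mrogers_def schur_def)

lemma mrogers_expand_odd:
  assumes "even m"
  shows "mrogers n (Suc m) x = (\<Sum>p<Suc m. (-1) ^ p * rogers n (x p) * mrogers n m (\<lambda>i. x (insert_index p i)))"
proof -
  have "mrogers n (Suc m) x = (\<Sum>k\<in>{..<Suc m} \<rightarrow>\<^sub>E {..n}. \<Sum>p<Suc m.
      (-1) ^ p * schur m (\<lambda>i. q ^ k (insert_index p i)) * (\<Prod>i<Suc m. rco n (k i) * x i ^ k i))"
    unfolding mrogers_def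
    by (simp only: schur_expand_odd[OF assms q_pow_sum_nz] sum_distrib_right)
  also have "\<dots> = (\<Sum>p<Suc m. \<Sum>k\<in>{..<Suc m} \<rightarrow>\<^sub>E {..n}.
      (-1) ^ p * schur m (\<lambda>i. q ^ k (insert_index p i)) * (\<Prod>i<Suc m. rco n (k i) * x i ^ k i))"
    by (rule sum.swap)
  also have "\<dots> = (\<Sum>p<Suc m. (-1) ^ p * rogers n (x p) * mrogers n m (\<lambda>i. x (insert_index p i)))"
  proof (intro sum.cong refl)
    fix p assume p: "p \<in> {..<Suc m}"
    define H where "H l k = (-1) ^ p * schur m (\<lambda>i. q ^ k i) *
       ((rco n l * x p ^ l) * (\<Prod>i<m. rco n (k i) * x (insert_index p i) ^ k i))" for l and k :: "nat \<Rightarrow> nat"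
    have "(\<Sum>k\<in>{..<Suc m} \<rightarrow>\<^sub>E {..n}.
        (-1) ^ p * schur m (\<lambda>i. q ^ k (insert_index p i)) * (\<Prod>i<Suc m. rco n (k i) * x i ^ k i)) =
      (\<Sum>k\<in>{..<Suc m} \<rightarrow>\<^sub>E {..n}. H (k p) (restrict (\<lambda>i. k (insert_index p i)) {..<m}))"
    proof (intro sum.cong refl, goal_cases)
      case (1 k)
      have "schur m (\<lambda>i. q ^ restrict (\<lambda>i. k (insert_index p i)) {..<m} i) = schur m (\<lambda>i. q ^ k (insert_index p i))"
        by (rule schur_cong) simp
      then show ?case
        unfolding H_def using p by (subst prod_insert_index[of p m]) auto
    qed
    also have "\<dots> = (\<Sum>l\<le>n. \<Sum>k\<in>{..<m} \<rightarrow>\<^sub>E {..n}. H l k)"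
      by (rule sum_PiE_insert_index) (use p in simp)
    also have "\<dots> = (-1) ^ p * rogers n (x p) * mrogers n m (\<lambda>i. x (insert_index p i))"
      unfolding H_def rogers_def mrogers_def mult.assoc sum_product
      unfolding sum_distrib_left by (simp only: mult_ac)
    finally show "(\<Sum>k\<in>{..<Suc m} \<rightarrow>\<^sub>E {..n}.
        (-1) ^ p * schur m (\<lambda>i. q ^ k (insert_index p i)) * (\<Prod>i<Suc m. rco n (k i) * x i ^ k i)) =
        (-1) ^ p * rogers n (x p) * mrogers n m (\<lambda>i. x (insert_index p i))" .
  qed
  finally show ?thesis .
qed

lemma mrogers_expand_even:
  assumes "even m"
  shows "mrogers n (Suc (Suc m)) x =
    (\<Sum>p<Suc m. (-1) ^ p * rogers2 n (x p) (x (Suc m)) * mrogers n m (\<lambda>i. x (insert_index p i)))"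
proof -
  let ?T = "\<lambda>p k. (-1) ^ p * rho (k p) (k (Suc m)) * schur m (\<lambda>i. q ^ k (insert_index p i)) *
     (\<Prod>i<Suc (Suc m). rco n (k i) * x i ^ k i)"
  have "mrogers n (Suc (Suc m)) x = (\<Sum>k\<in>{..<Suc (Suc m)} \<rightarrow>\<^sub>E {..n}. \<Sum>p<Suc m. ?T p k)"
    unfolding mrogers_def
    by (simp only: schur_expand_even[OF assms q_pow_sum_nz] sum_distrib_right rho_def)
  also have "\<dots> = (\<Sum>p<Suc m. \<Sum>k\<in>{..<Suc (Suc m)} \<rightarrow>\<^sub>E {..n}. ?T p k)"
    by (rule sum.swap)
  also have "\<dots> = (\<Sum>p<Suc m. (-1) ^ p * rogers2 n (x p) (x (Suc m)) * mrogers n m (\<lambda>i. x (insert_index p i)))"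
  proof (intro sum.cong refl)
    fix p assume "p \<in> {..<Suc m}"
    then have p: "p \<le> m" by simp
    have pS: "insert_index p m = Suc m" using p by simp
    define G where "G l l' k = (-1) ^ p * rho l l' * schur m (\<lambda>i. q ^ k i) *
       ((rco n l * x p ^ l) * ((rco n l' * x (Suc m) ^ l') *
          (\<Prod>i<m. rco n (k i) * x (insert_index p i) ^ k i)))" for l l' and k :: "nat \<Rightarrow> nat"
    define H where "H l k = G l (k m) (restrict (\<lambda>i. k (insert_index m i)) {..<m})" for l and k :: "nat \<Rightarrow> nat"
    have "(\<Sum>k\<in>{..<Suc (Suc m)} \<rightarrow>\<^sub>E {..n}. ?T p k) =
      (\<Sum>k\<in>{..<Suc (Suc m)} \<rightarrow>\<^sub>E {..n}. H (k p) (restrict (\<lambda>i. k (insert_index p i)) {..<Suc m}))"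
    proof (intro sum.cong refl)
      fix k :: "nat \<Rightarrow> nat"
      let ?k = "restrict (\<lambda>i. restrict (\<lambda>i. k (insert_index p i)) {..<Suc m} (insert_index m i)) {..<m}"
      have kk: "?k i = k (insert_index p i)" if "i < m" for i using that by simp
      have s: "schur m (\<lambda>i. q ^ ?k i) = schur m (\<lambda>i. q ^ k (insert_index p i))"
        by (rule schur_cong) (simp only: kk)
      have pr: "(\<Prod>i<m. rco n (?k i) * x (insert_index p i) ^ ?k i) =
          (\<Prod>i<m. rco n (k (insert_index p i)) * x (insert_index p i) ^ k (insert_index p i))"
        by (intro prod.cong refl) (simp only: kk lessThan_iff)
      have "(\<Prod>i<Suc (Suc m). rco n (k i) * x i ^ k i) = rco n (k p) * x p ^ k p *
          (rco n (k (Suc m)) * x (Suc m) ^ k (Suc m) *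
           (\<Prod>i<m. rco n (k (insert_index p i)) * x (insert_index p i) ^ k (insert_index p i)))"
        using p by (subst prod_insert_index[of p "Suc m"]) (simp_all add: pS mult_ac)
      then show "?T p k = H (k p) (restrict (\<lambda>i. k (insert_index p i)) {..<Suc m})"
        unfolding H_def G_def s pr using pS by simp
    qed
    also have "\<dots> = (\<Sum>l\<le>n. \<Sum>k\<in>{..<Suc m} \<rightarrow>\<^sub>E {..n}. H l k)"
      by (rule sum_PiE_insert_index) (use p in simp)
    also have "\<dots> = (\<Sum>l\<le>n. \<Sum>l'\<le>n. \<Sum>k\<in>{..<m} \<rightarrow>\<^sub>E {..n}. G l l' k)"
      unfolding H_def by (intro sum.cong refl sum_PiE_insert_index) simp
    also have "\<dots> = (-1) ^ p * rogers2 n (x p) (x (Suc m)) * mrogers n m (\<lambda>i. x (insert_index p i))"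
      unfolding G_def rogers2_def mrogers_def mult.assoc sum_distrib_right
      unfolding sum_distrib_left by (simp only: mult_ac)
    finally show "(\<Sum>k\<in>{..<Suc (Suc m)} \<rightarrow>\<^sub>E {..n}. ?T p k) =
        (-1) ^ p * rogers2 n (x p) (x (Suc m)) * mrogers n m (\<lambda>i. x (insert_index p i))" .
  qed
  finally show ?thesis .
qed

end

section \<open>A determinant with palindromic entries\<close>

text \<open>
  In terms of \<open>z = x + 1 / x\<close> the entries are \<open>x ^ (r - 1)\<close> times
  \<open>a z^(r-1), ..., a z, a, b, b z, ..., b z^(r-1)\<close>. This form is polynomial in \<open>x\<close>, and
  the exponents of \<open>z\<close> read the same in both directions.
\<close>
definition reciprocal_entry :: "nat \<Rightarrow> complex \<Rightarrow> complex \<Rightarrow> complex \<Rightarrow> nat \<Rightarrow> complex" where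
  "reciprocal_entry r x a b j = (if j < r then a * x ^ j * (1 + x\<^sup>2) ^ (r - 1 - j)
                     else b * x ^ (2 * r - 1 - j) * (1 + x\<^sup>2) ^ (j - r))"

definition reciprocal_det :: "nat \<Rightarrow> (nat \<Rightarrow> complex) \<Rightarrow> (nat \<Rightarrow> complex) \<Rightarrow> (nat \<Rightarrow> complex) \<Rightarrow> complex" where
  "reciprocal_det r x A B = detf (2 * r) (\<lambda>i j. reciprocal_entry r (x i) (A i) (B i) j)"

text \<open>
  Subtracting \<open>t\<close> times the neighbour nearer to the middle multiplies the entry by
  \<open>x (z - t)\<close> and lowers \<open>r\<close>; \<open>reciprocal_entry_step_right\<close> is the mirror image.
\<close>
lemma reciprocal_entry_step_left:
  assumes "j < r"
  shows "reciprocal_entry (Suc r) x a b j - t * reciprocal_entry (Suc r) x a b (Suc j) = (1 + x\<^sup>2 - t * x) * reciprocal_entry r x a b j"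
proof -
  obtain d where d: "r = Suc (j + d)" using assms less_iff_Suc_add by blast
  have "r - j = Suc d" "r - Suc j = d" "r - 1 - j = d" using d by auto
  then show ?thesis using assms by (simp add: reciprocal_entry_def algebra_simps)
qed

lemma reciprocal_entry_step_right:
  assumes "r \<le> j" "j < 2 * r"
  shows "reciprocal_entry (Suc r) x a b (Suc (Suc j)) - t * reciprocal_entry (Suc r) x a b (Suc j) = (1 + x\<^sup>2 - t * x) * reciprocal_entry r x a b j"
proof -
  obtain d where d: "2 * r = Suc (j + d)" using assms less_iff_Suc_add by blast
  have "2 * Suc r - 1 - Suc (Suc j) = d" "2 * Suc r - 1 - Suc j = Suc d" "2 * r - 1 - j = d"
    "Suc (Suc j) - Suc r = Suc (j - r)" "Suc j - Suc r = j - r"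
    using d assms by auto
  then show ?thesis using assms by (simp add: reciprocal_entry_def algebra_simps)
qed

text \<open>
  If the last argument is \<open>1 / x p\<close>, then \<open>x + 1 / x\<close> has the same value \<open>t\<close> in the rows
  \<open>p\<close> and \<open>2 r + 1\<close>. Subtracting \<open>t\<close> times the neighbouring column, from the outside
  towards the middle, leaves in these two rows nothing but the entries in the two middle
  columns. In the other rows the factor \<open>1 + x\<^sup>2 - t x\<close> splits off, which equals
  \<open>(1 - x p * x) * (1 - x / x p)\<close>.
\<close>
lemma reciprocal_det_reciprocal_node:
  assumes "p < Suc (2 * r)" "x p \<noteq> 0" and xl: "x (Suc (2 * r)) = 1 / x p"
  shows "reciprocal_det (Suc r) x A B = (-1) ^ p * (A p * B (Suc (2 * r)) - A (Suc (2 * r)) * B p) *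
     (\<Prod>j<2*r. (1 - x p * x (insert_index p j)) * (1 - x (insert_index p j) * x (Suc (2 * r)))) *
     reciprocal_det r (\<lambda>i. x (insert_index p i)) (\<lambda>i. A (insert_index p i)) (\<lambda>i. B (insert_index p i))"
proof -
  define l where "l = Suc (2 * r)"
  define t where "t = x p + 1 / x p"
  define E where "E i j = reciprocal_entry (Suc r) (x i) (A i) (B i) j" for i j
  \<comment> \<open>The columns \<open>r\<close> and \<open>r + 1\<close> in the middle are left alone; each other one is changed
    by its inner neighbour.\<close>
  define c where "c k j = (if (j < r \<and> k = Suc j) \<or> (Suc r < j \<and> Suc k = j) then - t else 0)" for k j
  define M where "M i j = E i j + (\<Sum>k<2 * Suc r. E i k * c k j)" for i j
  define u where "u i = 1 + (x i)\<^sup>2 - t * x i" for i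
  have M1: "M i j = u i * reciprocal_entry r (x i) (A i) (B i) j" if "j < r" for i j
  proof -
    have "(\<Sum>k<2 * Suc r. E i k * c k j) = (\<Sum>k<2 * Suc r. if k = Suc j then - t * E i (Suc j) else 0)"
      by (intro sum.cong refl) (use that in \<open>auto simp: c_def\<close>)
    also have "\<dots> = - t * E i (Suc j)" using that by (subst sum.delta) auto
    finally show ?thesis
      using reciprocal_entry_step_left[OF that, of "x i" "A i" "B i" t] by (simp add: M_def E_def u_def)
  qed
  have M2: "M i j = E i j" if "j = r \<or> j = Suc r" for i j
    using that by (auto simp: M_def c_def)
  have M3: "M i (Suc (Suc j)) = u i * reciprocal_entry r (x i) (A i) (B i) j" if "r \<le> j" "j < 2 * r" for i j
  proof -
    have "(\<Sum>k<2 * Suc r. E i k * c k (Suc (Suc j))) = (\<Sum>k<2 * Suc r. if k = Suc j then - t * E i (Suc j) else 0)"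
      by (intro sum.cong refl) (use that in \<open>auto simp: c_def\<close>)
    also have "\<dots> = - t * E i (Suc j)" using that by (subst sum.delta) auto
    finally show ?thesis
      using reciprocal_entry_step_right[OF that, of "x i" "A i" "B i" t] by (simp add: M_def E_def u_def)
  qed
  have u0: "u p = 0" "u l = 0"
    using assms(2) xl by (simp_all add: u_def t_def l_def field_simps power2_eq_square)
  have Mz: "M i j = 0" if "i = p \<or> i = l" "j < 2 * Suc r" "j \<noteq> r" "j \<noteq> Suc r" for i j
  proof (cases "j < r")
    case True
    then show ?thesis using M1[of j i] u0 that by auto
  next
    case False
    then have "j = Suc (Suc (j - 2))" using that by linarith
    then obtain j' where "j = Suc (Suc j')" by blast
    then show ?thesis using M3[of j' i] u0 that False by auto
  qed
  have Mr: "M i r = A i * x i ^ r" "M i (Suc r) = B i * x i ^ r" for i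
    using M2[of r i] M2[of "Suc r" i] by (auto simp: E_def reciprocal_entry_def)
  define rest where "rest = detf (2 * r) (\<lambda>i j. M (insert_index p i) (if j < r then j else Suc (Suc j)))"
  have minor: "detf (Suc (2 * r)) (\<lambda>i j. M i (insert_index s j)) = (-1) ^ (p + r) * M p s' * rest"
    if s: "(s = r \<and> s' = Suc r) \<or> (s = Suc r \<and> s' = r)" for s s'
  proof -
    have "detf (Suc (2 * r)) (\<lambda>i j. M i (insert_index s j)) =
       (\<Sum>j<Suc (2 * r). (-1) ^ (p + j) * M p (insert_index s j) *
          detf (2 * r) (\<lambda>i j'. M (insert_index p i) (insert_index s (insert_index j j'))))"
      by (rule detf_expand_row) (use assms in simp)
    also have "\<dots> = (\<Sum>j<Suc (2 * r). if j = r then (-1) ^ (p + r) * M p s' * rest else 0)"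
    proof (intro sum.cong refl, goal_cases)
      case j: (1 j)
      show ?case
      proof (cases "j = r")
        case True
        have "detf (2 * r) (\<lambda>i j'. M (insert_index p i) (insert_index s (insert_index r j'))) = rest"
          unfolding rest_def by (intro detf_cong refl arg_cong2[where f = M]) (use s in \<open>auto simp: insert_index_def\<close>)
        moreover have "insert_index s r = s'" using s by (auto simp: insert_index_def)
        ultimately show ?thesis using True by simp
      next
        case False
        then have "M p (insert_index s j) = 0"
          using s j by (intro Mz) (auto simp: insert_index_def)
        then show ?thesis using False by simp
      qed
    qed
    finally show ?thesis by simp
  qed
  have "reciprocal_det (Suc r) x A B = detf (2 * Suc r) E"
    unfolding reciprocal_det_def E_def ..
  also have "\<dots> = detf (2 * Suc r) M"
    unfolding M_def
    by (rule detf_col_ops[where h = "\<lambda>j. if j \<le> r then r - j else j - Suc r", symmetric])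
       (auto simp: c_def split: if_splits)
  also have "\<dots> = detf (Suc l) M" by (simp add: l_def)
  also have "\<dots> = (\<Sum>j<Suc l. (-1) ^ (l + j) * M l j * detf l (\<lambda>i j'. M (insert_index l i) (insert_index j j')))"
    by (rule detf_expand_row) simp
  also have "\<dots> = (\<Sum>j<Suc l. (-1) ^ (l + j) * M l j * detf l (\<lambda>i j'. M i (insert_index j j')))"
    by (intro sum.cong refl arg_cong2[where f = "(*)"] detf_cong) simp_all
  also have "\<dots> = (\<Sum>j\<in>{r, Suc r}. (-1) ^ (l + j) * M l j * detf l (\<lambda>i j'. M i (insert_index j j')))"
    by (rule sum.mono_neutral_right) (use Mz[of l] in \<open>auto simp: l_def\<close>)
  also have "\<dots> = (-1) ^ p * (A p * B l - A l * B p) * rest"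
  proof -
    have xx: "x l ^ r * x p ^ r = 1"
      using assms(2) xl by (simp add: l_def power_mult_distrib[symmetric])
    have "(\<Sum>j\<in>{r, Suc r}. (-1) ^ (l + j) * M l j * detf l (\<lambda>i j'. M i (insert_index j j'))) =
       (-1) ^ (l + r) * M l r * ((-1) ^ (p + r) * M p (Suc r) * rest) +
       (-1) ^ (l + Suc r) * M l (Suc r) * ((-1) ^ (p + r) * M p r * rest)"
      using minor[of r "Suc r"] minor[of "Suc r" r] by (simp add: l_def)
    also have "\<dots> = (-1) ^ p * (A p * B l - A l * B p) * rest * (x l ^ r * x p ^ r)"
    proof -
      define e :: complex where "e = (-1) ^ r"
      have ee: "e * e = 1" unfolding e_def by (simp add: power_mult_distrib[symmetric])
      have s: "(-1) ^ (l + r) = - e" "(-1) ^ (l + Suc r) = e" "(-1) ^ (p + r) = (-1) ^ p * e"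
        by (simp_all add: l_def e_def power_add power_mult)
      have "- e * (A l * x l ^ r) * ((-1) ^ p * e * (B p * x p ^ r) * rest) +
            e * (B l * x l ^ r) * ((-1) ^ p * e * (A p * x p ^ r) * rest) =
          (e * e) * ((-1) ^ p * (A p * B l - A l * B p) * rest * (x l ^ r * x p ^ r))"
        by (simp add: algebra_simps)
      then show ?thesis unfolding Mr s ee by simp
    qed
    finally show ?thesis unfolding xx by simp
  qed
  also have "rest = (\<Prod>j<2*r. u (insert_index p j)) *
     reciprocal_det r (\<lambda>i. x (insert_index p i)) (\<lambda>i. A (insert_index p i)) (\<lambda>i. B (insert_index p i))"
  proof -
    have "rest = detf (2 * r) (\<lambda>i j. u (insert_index p i) * 1 *
        reciprocal_entry r (x (insert_index p i)) (A (insert_index p i)) (B (insert_index p i)) j)"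
      unfolding rest_def by (intro detf_cong refl) (use M1 M3 in auto)
    then show ?thesis unfolding detf_scale reciprocal_det_def by simp
  qed
  also have "(\<Prod>j<2*r. u (insert_index p j)) =
     (\<Prod>j<2*r. (1 - x p * x (insert_index p j)) * (1 - x (insert_index p j) * x (Suc (2 * r))))"
    unfolding u_def t_def xl
    by (intro prod.cong refl) (use assms(2) in \<open>simp add: field_simps power2_eq_square\<close>)
  finally show ?thesis by (simp add: l_def mult.assoc)
qed

lemma polyfun_reciprocal_entry: "j < 2 * Suc r \<Longrightarrow> polyfun (2 * r) (\<lambda>x. reciprocal_entry (Suc r) x a b j)"
proof -
  assume j: "j < 2 * Suc r"
  have pp: "polyfun (k + 2 * d) (\<lambda>x. c * x ^ k * (1 + x\<^sup>2) ^ d)" for k d c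
  proof -
    have x: "polyfun 1 (\<lambda>x. x)" using polyfun_linear[of 0 1] by simp
    have "polyfun 2 (\<lambda>x. 1 + x\<^sup>2)"
      by (rule polyfun_add[OF polyfun_mono[OF polyfun_const]]) (use polyfun_power[OF x, of 2] in auto)
    from polyfun_mult[OF polyfun_cmult[OF polyfun_power[OF x, of k]] polyfun_power[OF this, of d]]
    show ?thesis by simp
  qed
  show ?thesis
  proof (cases "j < Suc r")
    case True
    then show ?thesis
      using polyfun_mono[OF pp[of j "r - j" a], of "2 * r"] by (simp add: reciprocal_entry_def)
  next
    case False
    then show ?thesis
      using polyfun_mono[OF pp[of "2 * Suc r - 1 - j" "j - Suc r" b], of "2 * r"] j
      by (simp add: reciprocal_entry_def)
  qed
qed

text \<open>
  Both sides are polynomials of degree at most \<open>2 r\<close> in the last argument. They agree at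
  the \<open>2 r + 1\<close> points \<open>1 / x p\<close>, where all but one of the summands vanish. This is the
  counterpart of the row expansions of the Pfaffian.
\<close>
lemma reciprocal_det_expand:
  assumes inj: "inj_on x {..<Suc (2 * r)}" and nz: "\<And>i. i < Suc (2 * r) \<Longrightarrow> x i \<noteq> 0"
  shows "reciprocal_det (Suc r) x A B = (\<Sum>p<Suc (2 * r). (-1) ^ p *
     (A p * B (Suc (2 * r)) - A (Suc (2 * r)) * B p) *
     (\<Prod>j<2*r. (1 - x p * x (insert_index p j)) * (1 - x (insert_index p j) * x (Suc (2 * r)))) *
     reciprocal_det r (\<lambda>i. x (insert_index p i)) (\<lambda>i. A (insert_index p i)) (\<lambda>i. B (insert_index p i)))"
proof -
  define l where "l = Suc (2 * r)"
  define f where "f y = reciprocal_det (Suc r) (x(l := y)) A B" for y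
  define K where "K p = reciprocal_det r (\<lambda>i. x (insert_index p i)) (\<lambda>i. A (insert_index p i)) (\<lambda>i. B (insert_index p i))" for p
  define g where "g y = (\<Sum>p<Suc (2 * r). (-1) ^ p * (A p * B l - A l * B p) *
     (\<Prod>j<2*r. (1 - x p * x (insert_index p j)) * (1 - x (insert_index p j) * y)) * K p)" for y
  have pf: "polyfun (2 * r) f"
  proof -
    have "f y = (\<Sum>j<Suc l. (-1) ^ (l + j) * reciprocal_entry (Suc r) y (A l) (B l) j *
        detf l (\<lambda>i j'. reciprocal_entry (Suc r) (x i) (A i) (B i) (insert_index j j')))" for y
    proof -
      have "f y = detf (Suc l) (\<lambda>i j. reciprocal_entry (Suc r) ((x(l := y)) i) (A i) (B i) j)"
        unfolding f_def reciprocal_det_def l_def by simp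
      also have "\<dots> = (\<Sum>j<Suc l. (-1) ^ (l + j) * reciprocal_entry (Suc r) y (A l) (B l) j *
          detf l (\<lambda>i j'. reciprocal_entry (Suc r) ((x(l := y)) (insert_index l i)) (A (insert_index l i))
             (B (insert_index l i)) (insert_index j j')))"
        by (subst detf_expand_row[of l l]) auto
      also have "\<dots> = (\<Sum>j<Suc l. (-1) ^ (l + j) * reciprocal_entry (Suc r) y (A l) (B l) j *
        detf l (\<lambda>i j'. reciprocal_entry (Suc r) (x i) (A i) (B i) (insert_index j j')))"
        by (intro sum.cong refl arg_cong2[where f = "(*)"] detf_cong) simp_all
      finally show ?thesis .
    qed
    then have eq: "f = (\<lambda>y. \<Sum>j<Suc l. ((-1) ^ (l + j) *
        detf l (\<lambda>i j'. reciprocal_entry (Suc r) (x i) (A i) (B i) (insert_index j j'))) * reciprocal_entry (Suc r) y (A l) (B l) j)"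
      by (intro ext) (simp only: mult_ac)
    show ?thesis
      unfolding eq by (intro polyfun_sum polyfun_cmult polyfun_reciprocal_entry) (simp add: l_def)
  qed
  have pg: "polyfun (2 * r) g"
  proof -
    have "polyfun (card {..<2*r}) (\<lambda>y. \<Prod>j<2*r. (1 - x p * x (insert_index p j)) * (1 - x (insert_index p j) * y))" for p
    proof (rule polyfun_prod)
      fix j
      show "polyfun 1 (\<lambda>y. (1 - x p * x (insert_index p j)) * (1 - x (insert_index p j) * y))"
        using polyfun_cmult[OF polyfun_linear[of 1 "- x (insert_index p j)"]] by simp
    qed simp
    then have "polyfun (2 * r) (\<lambda>y. \<Sum>p<Suc (2 * r). ((-1) ^ p * (A p * B l - A l * B p) * K p) *
     (\<Prod>j<2*r. (1 - x p * x (insert_index p j)) * (1 - x (insert_index p j) * y)))"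
      by (intro polyfun_sum polyfun_cmult) simp
    then show ?thesis unfolding g_def by (simp only: mult_ac)
  qed
  have xx: "(x(l := y)) (insert_index p i) = x (insert_index p i)" if "i < 2 * r" for i p y
    using that by (auto simp: l_def insert_index_def)
  have "f = g"
  proof (rule polyfun_eqI[OF pf pg, of "(\<lambda>p. 1 / x p) ` {..<Suc (2 * r)}"])
    have "inj_on (\<lambda>p. 1 / x p) {..<Suc (2 * r)}"
      using inj nz by (auto simp: inj_on_def)
    then show "2 * r < card ((\<lambda>p. 1 / x p) ` {..<Suc (2 * r)})" by (simp add: card_image)
    fix y assume "y \<in> (\<lambda>p. 1 / x p) ` {..<Suc (2 * r)}"
    then obtain p where p: "p < Suc (2 * r)" "y = 1 / x p" by auto
    have pl: "p \<noteq> l" using p by (simp add: l_def)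
    have "f y = (-1) ^ p * (A p * B l - A l * B p) *
     (\<Prod>j<2*r. (1 - x p * x (insert_index p j)) * (1 - x (insert_index p j) * y)) * K p"
    proof -
      have "(\<Prod>j<2*r. (1 - (x(l := y)) p * (x(l := y)) (insert_index p j)) *
            (1 - (x(l := y)) (insert_index p j) * (x(l := y)) (Suc (2 * r)))) =
         (\<Prod>j<2*r. (1 - x p * x (insert_index p j)) * (1 - x (insert_index p j) * y))"
        by (intro prod.cong refl) (simp only: xx lessThan_iff, use pl in \<open>simp add: l_def\<close>)
      moreover have "reciprocal_det r (\<lambda>i. (x(l := y)) (insert_index p i)) (\<lambda>i. A (insert_index p i)) (\<lambda>i. B (insert_index p i)) = K p"
        unfolding K_def reciprocal_det_def by (intro detf_cong refl) (simp only: xx)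
      ultimately show ?thesis
        using reciprocal_det_reciprocal_node[of p r "x(l := y)" A B] p nz pl unfolding f_def l_def by simp
    qed
    also have "\<dots> = g y"
    proof -
      \<comment> \<open>A summand \<open>s \<noteq> p\<close> vanishes because its product contains \<open>1 - x p * y\<close>.\<close>
      have "g y = (\<Sum>s<Suc (2 * r). if s = p then (-1) ^ p * (A p * B l - A l * B p) *
         (\<Prod>j<2*r. (1 - x p * x (insert_index p j)) * (1 - x (insert_index p j) * y)) * K p else 0)"
        unfolding g_def
      proof (intro sum.cong refl, goal_cases)
        case s: (1 s)
        have "(\<Prod>j<2*r. (1 - x s * x (insert_index s j)) * (1 - x (insert_index s j) * y)) = 0" if "s \<noteq> p"
        proof -
          have "p \<in> insert_index s ` {..<2*r}"
            using insert_index_image[of s "2 * r"] s p that by (auto simp: atLeast0LessThan)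
          then obtain j where "j < 2 * r" "insert_index s j = p" by auto
          then show ?thesis using p nz[of p] by (intro prod_zero) auto
        qed
        then show ?case
          by auto
      qed
      then show ?thesis using p by simp
    qed
    finally show "f y = g y" .
  qed simp
  from fun_cong[OF this, of "x l"] show ?thesis
    unfolding f_def g_def K_def l_def by simp
qed

lemma prod_lessThan_add:
  fixes f :: "nat \<Rightarrow> 'a :: comm_monoid_mult"
  shows "(\<Prod>j<a + b. f j) = (\<Prod>j<a. f j) * (\<Prod>j<b. f (a + j))"
  by (induction b) (simp_all add: mult_ac)

lemma pair_prod_symmetric:
  assumes "p \<le> m" "\<And>i j. h i j = h j i"
  shows "(\<Prod>j<Suc m. \<Prod>i<j. h i j) = (\<Prod>j<m. h p (insert_index p j)) *
     (\<Prod>j<m. \<Prod>i<j. h (insert_index p i) (insert_index p j) :: 'a :: comm_monoid_mult)"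
proof -
  have "(\<Prod>j<m. if j < p then h j p else h p (Suc j)) = (\<Prod>j<m. h p (insert_index p j))"
    by (intro prod.cong refl) (use assms(2) in \<open>auto simp: insert_index_def\<close>)
  then show ?thesis using pair_prod_insert_index[OF assms(1), of h] by simp
qed

text \<open>
  A solution of a three-term recurrence with coefficients linear in \<open>z\<close> is a combination
  of its first two values, with coefficients polynomial in \<open>z\<close>. Degrees and the leading
  coefficient are recorded because they make a transformation matrix triangular later.
\<close>
lemma three_term_polynomials:
  fixes \<alpha> \<beta> \<gamma> :: "nat \<Rightarrow> complex"
  shows "\<exists>u v. (\<forall>k>d. coeff u k = 0) \<and> coeff u d = (\<Prod>e<d. \<alpha> e) \<and> (\<forall>k\<ge>d. coeff v k = 0) \<and>
    (\<forall>T z. (\<forall>e<d. T (e + 2) = (\<alpha> e * z + \<beta> e) * T (e + 1) + \<gamma> e * T e) \<longrightarrow>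
       T (d + 1) = poly u z * T 1 + poly v z * T 0)"
  (is "\<exists>u v. ?P d u v")
proof (induction d rule: induct_nat_012)
  case 0
  have "?P 0 1 0" by auto
  then show ?case by (intro exI)
next
  case 1
  have "?P 1 [:\<beta> 0, \<alpha> 0:] [:\<gamma> 0:]"
    by (auto simp: coeff_pCons numeral_2_eq_2 algebra_simps split: nat.splits)
  then show ?case unfolding One_nat_def by (intro exI)
next
  case (ge2 d)
  then obtain u0 v0 u1 v1 where 0: "?P d u0 v0" and 1: "?P (Suc d) u1 v1" by blast
  let ?L = "[:\<beta> (Suc d), \<alpha> (Suc d):]"
  have L: "coeff (?L * p + smult c r) k =
      \<beta> (Suc d) * coeff p k + (case k of 0 \<Rightarrow> 0 | Suc i \<Rightarrow> \<alpha> (Suc d) * coeff p i) + c * coeff r k" for p r c k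
    by (cases k) simp_all
  have "?P (Suc (Suc d)) (?L * u1 + smult (\<gamma> (Suc d)) u0) (?L * v1 + smult (\<gamma> (Suc d)) v0)"
  proof (intro conjI allI impI)
    show "coeff (?L * u1 + smult (\<gamma> (Suc d)) u0) k = 0" if "k > Suc (Suc d)" for k
      using that 0 1 unfolding L by (cases k) auto
    show "coeff (?L * v1 + smult (\<gamma> (Suc d)) v0) k = 0" if "k \<ge> Suc (Suc d)" for k
      using that 0 1 unfolding L by (cases k) auto
    show "coeff (?L * u1 + smult (\<gamma> (Suc d)) u0) (Suc (Suc d)) = (\<Prod>e<Suc (Suc d). \<alpha> e)"
      using 0 1 unfolding L by simp
    fix T z
    assume T: "\<forall>e<Suc (Suc d). T (e + 2) = (\<alpha> e * z + \<beta> e) * T (e + 1) + \<gamma> e * T e"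
    have "T (Suc (Suc d) + 1) = (\<alpha> (Suc d) * z + \<beta> (Suc d)) * T (Suc d + 1) + \<gamma> (Suc d) * T (d + 1)"
      using T[rule_format, of "Suc d"] by simp
    moreover have "T (d + 1) = poly u0 z * T 1 + poly v0 z * T 0"
      "T (Suc d + 1) = poly u1 z * T 1 + poly v1 z * T 0"
      using T 0 1 by auto
    ultimately show "T (Suc (Suc d) + 1) = poly (?L * u1 + smult (\<gamma> (Suc d)) u0) z * T 1 +
        poly (?L * v1 + smult (\<gamma> (Suc d)) v0) z * T 0"
      by (simp add: algebra_simps)
  qed
  then show ?case by (intro exI)
qed

text \<open>
  Combinations of two functions with coefficients polynomial in \<open>x + 1 / x\<close> are
  combinations of the columns of the palindromic determinant.
\<close>
lemma reciprocal_entry_lincomb: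
  fixes u v :: "complex poly"
  assumes "x \<noteq> 0" "r > 0" "\<And>k. k \<ge> r \<Longrightarrow> coeff u k = 0" "\<And>k. k \<ge> r \<Longrightarrow> coeff v k = 0"
  shows "x ^ (r - 1) * (poly u (x + 1 / x) * a + poly v (x + 1 / x) * b) =
    (\<Sum>i<2*r. reciprocal_entry r x a b i * (if i < r then coeff u (r - 1 - i) else coeff v (i - r)))"
proof -
  have P: "x ^ (r - 1) * poly u (x + 1 / x) = (\<Sum>k<r. coeff u k * (x ^ (r - 1 - k) * (1 + x\<^sup>2) ^ k))"
    if "\<And>k. k \<ge> r \<Longrightarrow> coeff u k = 0" for u :: "complex poly"
  proof -
    have "degree u \<le> r - 1" using that assms(2) by (intro degree_le) auto
    then have "poly u (x + 1 / x) = (\<Sum>k<r. coeff u k * (x + 1 / x) ^ k)"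
      unfolding poly_altdef using that assms(2)
      by (intro sum.mono_neutral_left) (auto simp: coeff_eq_0)
    moreover have "x ^ (r - 1) * (x + 1 / x) ^ k = x ^ (r - 1 - k) * (1 + x\<^sup>2) ^ k" if "k < r" for k
    proof -
      have "x ^ (r - 1) = x ^ (r - 1 - k) * x ^ k" using that by (simp add: power_add[symmetric])
      moreover have "x * (x + 1 / x) = 1 + x\<^sup>2" using assms(1) by (simp add: field_simps power2_eq_square)
      ultimately show ?thesis by (metis (no_types) mult.assoc power_mult_distrib)
    qed
    ultimately show ?thesis by (simp add: sum_distrib_left mult.left_commute)
  qed
  have Pu: "x ^ (r - 1) * poly u (x + 1 / x) = (\<Sum>k<r. coeff u k * (x ^ (r - 1 - k) * (1 + x\<^sup>2) ^ k))"
    by (rule P) (rule assms(3))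
  have Pv: "x ^ (r - 1) * poly v (x + 1 / x) = (\<Sum>k<r. coeff v k * (x ^ (r - 1 - k) * (1 + x\<^sup>2) ^ k))"
    by (rule P) (rule assms(4))
  have "(\<Sum>i<2*r. reciprocal_entry r x a b i * (if i < r then coeff u (r - 1 - i) else coeff v (i - r))) =
     (\<Sum>i<r. reciprocal_entry r x a b i * coeff u (r - 1 - i)) + (\<Sum>i<r. reciprocal_entry r x a b (r + i) * coeff v i)"
  proof -
    have "{..<2*r} = {..<r} \<union> {r..<2*r}" by auto
    then have "(\<Sum>i<2*r. reciprocal_entry r x a b i * (if i < r then coeff u (r - 1 - i) else coeff v (i - r))) =
       (\<Sum>i<r. reciprocal_entry r x a b i * (if i < r then coeff u (r - 1 - i) else coeff v (i - r))) +
       (\<Sum>i\<in>{r..<2*r}. reciprocal_entry r x a b i * (if i < r then coeff u (r - 1 - i) else coeff v (i - r)))"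
      by (simp add: sum.union_disjoint ivl_disj_int)
    also have "(\<Sum>i\<in>{r..<2*r}. reciprocal_entry r x a b i * (if i < r then coeff u (r - 1 - i) else coeff v (i - r))) =
       (\<Sum>i<r. reciprocal_entry r x a b (r + i) * coeff v i)"
      by (rule sum.reindex_bij_witness[of _ "\<lambda>i. r + i" "\<lambda>i. i - r"]) auto
    finally show ?thesis by simp
  qed
  also have "(\<Sum>i<r. reciprocal_entry r x a b i * coeff u (r - 1 - i)) = (\<Sum>i<r. reciprocal_entry r x a b (r - Suc i) * coeff u i)"
    by (subst sum.nat_diff_reindex[symmetric], intro sum.cong refl) auto
  also have "\<dots> = a * (x ^ (r - 1) * poly u (x + 1 / x))"
    unfolding Pu sum_distrib_left
    by (intro sum.cong refl) (auto simp: reciprocal_entry_def)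
  also have "(\<Sum>i<r. reciprocal_entry r x a b (r + i) * coeff v i) = b * (x ^ (r - 1) * poly v (x + 1 / x))"
    unfolding Pv sum_distrib_left
  proof (intro sum.cong refl)
    fix i assume "i \<in> {..<r}"
    then have "2 * r - 1 - (r + i) = r - 1 - i" by simp
    then show "reciprocal_entry r x a b (r + i) * coeff v i = b * (coeff v i * (x ^ (r - 1 - i) * (1 + x\<^sup>2) ^ i))"
      by (simp add: reciprocal_entry_def)
  qed
  finally show ?thesis by (simp add: algebra_simps)
qed

section \<open>The determinant formula in terms of Rogers polynomials\<close>

context generic_q
begin

text \<open>
  This is \<open>P_(n-1)\<close>, with \<open>P_(-1) = 0\<close>, so that the recurrence can be started at index
  \<open>0\<close>.
\<close>
definition rogers_pred :: "nat \<Rightarrow> complex \<Rightarrow> complex" where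
  "rogers_pred n x = (case n of 0 \<Rightarrow> 0 | Suc k \<Rightarrow> rogers k x)"

definition rogers_rec_sol :: "complex \<Rightarrow> (nat \<Rightarrow> complex) \<Rightarrow> bool" where
  "rogers_rec_sol x S \<longleftrightarrow> (\<forall>k. S (k + 2) = cth (k + 1) * (1 - x) * S (k + 1) + x * S k)"

lemma rogers_rec_sol_rogers: "rogers_rec_sol x (\<lambda>k. rogers_pred k x)"
  unfolding rogers_rec_sol_def
proof
  fix k
  show "rogers_pred (k + 2) x = cth (k + 1) * (1 - x) * rogers_pred (k + 1) x + x * rogers_pred k x"
    using rogers_rec[of k x] by (cases k) (simp_all add: rogers_pred_def rogers_1)
qed

text \<open>
  At \<open>x = 1\<close> the recurrence has a constant solution. It fills the dummy row that is
  adjoined for odd \<open>m\<close>.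
\<close>
lemma rogers_rec_sol_one: "rogers_rec_sol 1 (\<lambda>k. 1)"
  by (simp add: rogers_rec_sol_def)

text \<open>
  Eliminating the odd steps leaves a recurrence for every second term. Up to powers of
  \<open>x\<close> it depends on \<open>x\<close> only through \<open>x + 1 / x\<close>, because
  \<open>(1 - x)\<^sup>2 = x * (x + 1 / x - 2)\<close>.
\<close>
lemma rogers_rec_sol_step2:
  assumes "rogers_rec_sol x S"
  shows "S (k + 4) = (cth (k + 3) * cth (k + 2) * (1 - x)\<^sup>2 + (1 + cth (k + 3) / cth (k + 1)) * x) * S (k + 2)
     - cth (k + 3) / cth (k + 1) * x\<^sup>2 * S k"
proof -
  have r: "S (k + 2) = cth (k + 1) * (1 - x) * S (k + 1) + x * S k"
    "S (k + 3) = cth (k + 2) * (1 - x) * S (k + 2) + x * S (k + 1)"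
    "S (k + 4) = cth (k + 3) * (1 - x) * S (k + 3) + x * S (k + 2)"
    using assms[unfolded rogers_rec_sol_def, rule_format, of k]
      assms[unfolded rogers_rec_sol_def, rule_format, of "k + 1"]
      assms[unfolded rogers_rec_sol_def, rule_format, of "k + 2"] by (simp_all add: numeral_eq_Suc)
  have e: "(1 - x) * S (k + 1) = (S (k + 2) - x * S k) / cth (k + 1)"
    using r(1) cth_nz[of "k + 1"] by (simp add: field_simps)
  have "S (k + 4) = cth (k + 3) * cth (k + 2) * (1 - x)\<^sup>2 * S (k + 2) +
       cth (k + 3) * x * ((1 - x) * S (k + 1)) + x * S (k + 2)"
    unfolding r(3) r(2) by (simp add: algebra_simps power2_eq_square)
  then show ?thesis unfolding e
    by (simp add: algebra_simps power2_eq_square diff_divide_distrib)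
qed

text \<open>
  \<open>lead_up\<close> and \<open>lead_down\<close> are the leading coefficients of the polynomials in
  \<open>x + 1 / x\<close> that express the terms \<open>d\<close> double steps above index \<open>n + 2\<close> and below
  index \<open>n\<close>.
\<close>
definition lead_up :: "nat \<Rightarrow> nat \<Rightarrow> complex" where
  "lead_up n d = (\<Prod>e<d. cth (n + 2 * e + 2) * cth (n + 2 * e + 3))"

definition lead_down :: "nat \<Rightarrow> nat \<Rightarrow> complex" where
  "lead_down n d = (\<Prod>e<d. cth (n - 2 * e) * cth (n - 1 - 2 * e))"

lemma rogers_upward:
  "\<exists>u v. (\<forall>k>d. coeff u k = 0) \<and> coeff u d = lead_up n d \<and> (\<forall>k\<ge>d. coeff v k = 0) \<and>
    (\<forall>x S. x \<noteq> 0 \<longrightarrow> rogers_rec_sol x S \<longrightarrow>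
       S (n + 2 + 2 * d) = x ^ d * (poly u (x + 1 / x) * S (n + 2) + poly v (x + 1 / x) * (x * S n)))"
proof -
  define \<alpha> where "\<alpha> e = cth (n + 2 * e + 2) * cth (n + 2 * e + 3)" for e
  define \<gamma> where "\<gamma> e = cth (n + 2 * e + 3) / cth (n + 2 * e + 1)" for e
  obtain u v where uv: "\<forall>k>d. coeff u k = 0" "coeff u d = (\<Prod>e<d. \<alpha> e)" "\<forall>k\<ge>d. coeff v k = 0"
    "\<And>T z. (\<And>e. e < d \<Longrightarrow> T (e + 2) = (\<alpha> e * z + (1 + \<gamma> e - 2 * \<alpha> e)) * T (e + 1) + - \<gamma> e * T e) \<Longrightarrow>
       T (d + 1) = poly u z * T 1 + poly v z * T 0"
    using three_term_polynomials[of d \<alpha> "\<lambda>e. 1 + \<gamma> e - 2 * \<alpha> e" "\<lambda>e. - \<gamma> e"] by blast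
  have "S (n + 2 + 2 * d) = x ^ d * (poly u (x + 1 / x) * S (n + 2) + poly v (x + 1 / x) * (x * S n))"
    if x: "x \<noteq> 0" and S: "rogers_rec_sol x S" for x S
  proof -
    \<comment> \<open>In this scaling the two-step recurrence has coefficients that are linear in
      \<open>x + 1 / x\<close>.\<close>
    define T where "T e = S (n + 2 * e) * x / x ^ e" for e
    have "T (d + 1) = poly u (x + 1 / x) * T 1 + poly v (x + 1 / x) * T 0"
    proof (rule uv(4))
      fix e
      define z where "z = x + 1 / x"
      have xz: "(1 - x)\<^sup>2 = x * (z - 2)" using x by (simp add: z_def field_simps power2_eq_square)
      have i: "n + 2 * (e + 2) = n + 2 * e + 4" "n + 2 * (e + 1) = n + 2 * e + 2" by simp_all
      have E: "S (n + 2 * e + 4) = (\<alpha> e * (x * (z - 2)) + (1 + \<gamma> e) * x) * S (n + 2 * e + 2) - \<gamma> e * x\<^sup>2 * S (n + 2 * e)"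
        using rogers_rec_sol_step2[OF S, of "n + 2 * e"] unfolding xz \<alpha>_def \<gamma>_def by (simp only: mult.commute[of "cth (n + 2 * e + 3)"])
      show "T (e + 2) = (\<alpha> e * (x + 1 / x) + (1 + \<gamma> e - 2 * \<alpha> e)) * T (e + 1) + - \<gamma> e * T e"
        unfolding T_def i z_def[symmetric] E using x by (simp add: field_simps power2_eq_square)
    qed
    then show ?thesis using x by (simp add: T_def field_simps)
  qed
  then show ?thesis using uv(1-3) unfolding lead_up_def \<alpha>_def by blast
qed

lemma rogers_downward:
  assumes "2 * d \<le> n"
  shows "\<exists>u v. (\<forall>k\<ge>d. coeff u k = 0) \<and> (\<forall>k>d. coeff v k = 0) \<and> coeff v d = lead_down n d \<and>
    (\<forall>x S. x \<noteq> 0 \<longrightarrow> rogers_rec_sol x S \<longrightarrow>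
       x ^ d * (x * S (n - 2 * d)) = poly u (x + 1 / x) * S (n + 2) + poly v (x + 1 / x) * (x * S n))"
proof -
  define \<alpha> where "\<alpha> e = cth (n - 2 * e) * cth (n - 1 - 2 * e)" for e
  define \<gamma> where "\<gamma> e = cth (n - 1 - 2 * e) / cth (n + 1 - 2 * e)" for e
  obtain u v where uv: "\<forall>k>d. coeff u k = 0" "coeff u d = (\<Prod>e<d. \<alpha> e)" "\<forall>k\<ge>d. coeff v k = 0"
    "\<And>T z. (\<And>e. e < d \<Longrightarrow> T (e + 2) = (\<alpha> e * z + (1 + \<gamma> e - 2 * \<alpha> e)) * T (e + 1) + - \<gamma> e * T e) \<Longrightarrow>
       T (d + 1) = poly u z * T 1 + poly v z * T 0"
    using three_term_polynomials[of d \<alpha> "\<lambda>e. 1 + \<gamma> e - 2 * \<alpha> e" "\<lambda>e. - \<gamma> e"] by blast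
  have "x ^ d * (x * S (n - 2 * d)) = poly v (x + 1 / x) * S (n + 2) + poly u (x + 1 / x) * (x * S n)"
    if x: "x \<noteq> 0" and S: "rogers_rec_sol x S" for x S
  proof -
    define T where "T e = x ^ e * S (n + 2 - 2 * e)" for e
    have "T (d + 1) = poly u (x + 1 / x) * T 1 + poly v (x + 1 / x) * T 0"
    proof (rule uv(4))
      fix e assume "e < d"
      define k where "k = n - 2 - 2 * e"
      have i: "n + 2 - 2 * (e + 2) = k" "n + 2 - 2 * (e + 1) = k + 2" "n + 2 - 2 * e = k + 4"
        "n - 2 * e = k + 2" "n - 1 - 2 * e = k + 1" "n + 1 - 2 * e = k + 3"
        using assms \<open>e < d\<close> by (simp_all add: k_def)
      define z where "z = x + 1 / x"
      have xz: "(1 - x)\<^sup>2 = x * (z - 2)" using x by (simp add: z_def field_simps power2_eq_square)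
      have "cth (k + 3) \<noteq> 0" "cth (k + 1) \<noteq> 0" by (auto intro!: cth_nz)
      then have "\<gamma> e * S (k + 4) = (\<alpha> e * (x * (z - 2)) + (1 + \<gamma> e) * x) * S (k + 2) - x\<^sup>2 * S k"
        unfolding rogers_rec_sol_step2[OF S, of k] xz \<alpha>_def \<gamma>_def i by (simp add: field_simps power2_eq_square)
      then have E: "x\<^sup>2 * S k = (\<alpha> e * (x * (z - 2)) + (1 + \<gamma> e) * x) * S (k + 2) - \<gamma> e * S (k + 4)"
        by (simp add: algebra_simps)
      have "x ^ e * (x\<^sup>2 * S k) = x ^ e * ((\<alpha> e * (x * (z - 2)) + (1 + \<gamma> e) * x) * S (k + 2) - \<gamma> e * S (k + 4))"
        unfolding E ..
      then show "T (e + 2) = (\<alpha> e * (x + 1 / x) + (1 + \<gamma> e - 2 * \<alpha> e)) * T (e + 1) + - \<gamma> e * T e"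
        unfolding T_def i z_def[symmetric] by (simp add: power_add power2_eq_square algebra_simps)
    qed
    then show ?thesis by (simp add: T_def algebra_simps)
  qed
  then show ?thesis using uv(1-3) unfolding lead_down_def \<alpha>_def by blast
qed

text \<open>
  By \<open>rogers_upward\<close> and \<open>rogers_downward\<close> each column on the left is a combination of
  columns of the palindromic determinant, with coefficients of degree at most the
  distance \<open>dep j\<close> of the column from the middle. With the columns ranked by that
  distance the transformation matrix is triangular.
\<close>
lemma reciprocal_det_to_rogers_det:
  assumes "2 * r \<le> n + 2" and x: "\<And>i. i < 2 * r \<Longrightarrow> x i \<noteq> 0"
    and S: "\<And>i. i < 2 * r \<Longrightarrow> rogers_rec_sol (x i) (S i)"
  shows "detf (2 * r) (\<lambda>i j. x i ^ j * S i (n + 2 * r - 2 * j)) =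
    (\<Prod>d<r. lead_up n d * lead_down n d) * reciprocal_det r x (\<lambda>i. S i (n + 2)) (\<lambda>i. x i * S i n)"
proof -
  \<comment> \<open>The two middle columns \<open>r - 1\<close> and \<open>r\<close> belong to the indices \<open>n + 2\<close> and \<open>n\<close>; they
    have distance \<open>0\<close>.\<close>
  define dep where "dep j = (if j < r then r - 1 - j else j - r)" for j
  define P where "P j u v \<longleftrightarrow> (\<forall>k>dep j. coeff u k = 0 \<and> coeff v k = 0) \<and>
     (if j < r then coeff u (dep j) = lead_up n (dep j) \<and> coeff v (dep j) = 0
      else coeff v (dep j) = lead_down n (dep j) \<and> coeff u (dep j) = 0) \<and>
     (\<forall>x S. x \<noteq> 0 \<longrightarrow> rogers_rec_sol x S \<longrightarrow>
       x ^ j * S (n + 2 * r - 2 * j) = x ^ (r - 1) * (poly u (x + 1 / x) * S (n + 2) + poly v (x + 1 / x) * (x * S n)))" for j u v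
  have ex: "\<exists>u v. P j u v" if j: "j < 2 * r" for j
  proof (cases "j < r")
    case True
    define d where "d = r - 1 - j"
    have dj: "n + 2 * r - 2 * j = n + 2 + 2 * d" "r - 1 = j + d" using True by (simp_all add: d_def)
    obtain u v where uv: "\<forall>k>d. coeff u k = 0" "coeff u d = lead_up n d" "\<forall>k\<ge>d. coeff v k = 0"
      "\<forall>x S. x \<noteq> 0 \<longrightarrow> rogers_rec_sol x S \<longrightarrow>
         S (n + 2 + 2 * d) = x ^ d * (poly u (x + 1 / x) * S (n + 2) + poly v (x + 1 / x) * (x * S n))"
      using rogers_upward[of d n] by blast
    have dep: "dep j = d" using True by (simp add: dep_def d_def)
    have eq: "x ^ j * S (n + 2 * r - 2 * j) = x ^ (r - 1) * (poly u (x + 1 / x) * S (n + 2) + poly v (x + 1 / x) * (x * S n))"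
      if "x \<noteq> 0" "rogers_rec_sol x S" for x S
      unfolding dj power_add using uv(4) that by (simp only: mult.assoc simp_thms)
    show ?thesis
      by (rule exI[of _ u], rule exI[of _ v], unfold P_def dep)
         (use True uv(1-3) eq in auto)
  next
    case False
    define d where "d = j - r"
    have dj: "n + 2 * r - 2 * j = n - 2 * d" "j = r + d" "2 * d \<le> n" "r = Suc (r - 1)"
      using False j assms(1) by (simp_all add: d_def)
    obtain u v where uv: "\<forall>k\<ge>d. coeff u k = 0" "\<forall>k>d. coeff v k = 0" "coeff v d = lead_down n d"
      "\<forall>x S. x \<noteq> 0 \<longrightarrow> rogers_rec_sol x S \<longrightarrow>
       x ^ d * (x * S (n - 2 * d)) = poly u (x + 1 / x) * S (n + 2) + poly v (x + 1 / x) * (x * S n)"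
      using rogers_downward[OF dj(3)] by blast
    have eq: "x ^ j * S (n + 2 * r - 2 * j) = x ^ (r - 1) * (poly u (x + 1 / x) * S (n + 2) + poly v (x + 1 / x) * (x * S n))"
      if "x \<noteq> 0" "rogers_rec_sol x S" for x S
    proof -
      have "x ^ j = x ^ (r - 1) * (x ^ d * x)"
        unfolding dj(2) by (subst dj(4)) (simp add: power_add)
      then have "x ^ j * S (n + 2 * r - 2 * j) = x ^ (r - 1) * (x ^ d * (x * S (n - 2 * d)))"
        unfolding dj(1) by (simp only: mult.assoc)
      then show ?thesis using uv(4) that by simp
    qed
    show ?thesis
      by (rule exI[of _ u], rule exI[of _ v], unfold P_def)
         (use False uv(1-3) eq in \<open>auto simp: dep_def d_def[symmetric]\<close>)
  qed
  then obtain u v where "\<And>j. j < 2 * r \<Longrightarrow> P j (u j) (v j)" by metis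
  then have uv: "\<And>j k. j < 2 * r \<Longrightarrow> k > dep j \<Longrightarrow> coeff (u j) k = 0 \<and> coeff (v j) k = 0"
    "\<And>j. j < 2 * r \<Longrightarrow> (if j < r then coeff (u j) (dep j) = lead_up n (dep j) \<and> coeff (v j) (dep j) = 0
      else coeff (v j) (dep j) = lead_down n (dep j) \<and> coeff (u j) (dep j) = 0)"
    "\<And>j x S. j < 2 * r \<Longrightarrow> x \<noteq> 0 \<Longrightarrow> rogers_rec_sol x S \<Longrightarrow>
       x ^ j * S (n + 2 * r - 2 * j) = x ^ (r - 1) * (poly (u j) (x + 1 / x) * S (n + 2) + poly (v j) (x + 1 / x) * (x * S n))"
    unfolding P_def by blast+
  define U where "U i j = (if i < r then coeff (u j) (r - 1 - i) else coeff (v j) (i - r))" for i j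
  have "detf (2 * r) (\<lambda>i j. x i ^ j * S i (n + 2 * r - 2 * j)) =
     detf (2 * r) (\<lambda>i j. \<Sum>k<2*r. reciprocal_entry r (x i) (S i (n + 2)) (x i * S i n) k * U k j)"
  proof (intro detf_cong refl)
    fix i j assume ij: "i < 2 * r" "j < 2 * r"
    have "dep j < r" using ij by (auto simp: dep_def)
    then have uz: "coeff (u j) k = 0" "coeff (v j) k = 0" if "k \<ge> r" for k
      using uv(1)[OF ij(2), of k] that by auto
    show "x i ^ j * S i (n + 2 * r - 2 * j) = (\<Sum>k<2*r. reciprocal_entry r (x i) (S i (n + 2)) (x i * S i n) k * U k j)"
      unfolding uv(3)[OF ij(2) x[OF ij(1)] S[OF ij(1)]] U_def
      by (rule reciprocal_entry_lincomb) (use x ij uz in auto)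
  qed
  also have "\<dots> = reciprocal_det r x (\<lambda>i. S i (n + 2)) (\<lambda>i. x i * S i n) * detf (2 * r) U"
    unfolding reciprocal_det_def by (rule detf_mult)
  also have "detf (2 * r) U = (\<Prod>j<2*r. U j j)"
  proof (rule detf_ranked_triangular[where h = dep])
    fix i j assume ij: "i < 2 * r" "j < 2 * r" "i \<noteq> j" "U i j \<noteq> 0"
    have Ui: "U i j = (if i < r then coeff (u j) (dep i) else coeff (v j) (dep i))"
      by (simp add: U_def dep_def)
    then have "dep i \<le> dep j" using uv(1)[OF ij(2), of "dep i"] ij(4) by (auto split: if_splits intro: leI)
    \<comment> \<open>Two different columns at equal distance lie on opposite sides of the middle, where
      the coefficient of top degree is zero.\<close>
    moreover have "dep i \<noteq> dep j"
    proof
      assume e: "dep i = dep j"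
      then have "i < r \<longleftrightarrow> \<not> j < r" using ij by (auto simp: dep_def split: if_splits)
      then show False using Ui uv(2)[OF ij(2)] ij(4) e by (auto split: if_splits)
    qed
    ultimately show "dep i < dep j" by simp
  qed
  also have "\<dots> = (\<Prod>j<r. U j j) * (\<Prod>j<r. U (r + j) (r + j))"
    using prod_lessThan_add[of "\<lambda>j. U j j" r r] by (simp add: mult_2)
  also have "(\<Prod>j<r. U j j) = (\<Prod>j<r. lead_up n (r - Suc j))"
  proof (intro prod.cong refl)
    fix j assume "j \<in> {..<r}"
    then show "U j j = lead_up n (r - Suc j)" using uv(2)[of j] by (simp add: U_def dep_def)
  qed
  also have "\<dots> = (\<Prod>d<r. lead_up n d)" by (rule prod.nat_diff_reindex)
  also have "(\<Prod>j<r. U (r + j) (r + j)) = (\<Prod>d<r. lead_down n d)"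
  proof (intro prod.cong refl)
    fix j assume "j \<in> {..<r}"
    then show "U (r + j) (r + j) = lead_down n j" using uv(2)[of "r + j"] by (simp add: U_def dep_def)
  qed
  finally show ?thesis by (simp add: prod.distrib mult_ac)
qed

definition rogers_det :: "nat \<Rightarrow> nat \<Rightarrow> (nat \<Rightarrow> complex) \<Rightarrow> complex" where
  "rogers_det n m x = detf m (\<lambda>i j. x i ^ j * rogers (n + m - 1 - 2 * j) (x i))"

text \<open>
  The ratio between \<open>rogers_det n m x\<close> and \<open>P_n (x_1, ..., x_m)\<close> times the product of
  the \<open>1 - x_i x_j\<close>.
\<close>
definition cth_pairs :: "nat \<Rightarrow> nat \<Rightarrow> complex" where
  "cth_pairs n m = (\<Prod>j<m. \<Prod>i<j. cth (n + 2 - m + i + j))"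

lemma cth_pairs_Suc:
  assumes "m \<le> n + 1"
  shows "cth_pairs n (Suc m) = cth_pairs n m * (\<Prod>j<m. cth (n + 2 - m + 2 * j))"
proof -
  have "cth_pairs n (Suc m) = (\<Prod>j<m. \<Prod>i<Suc j. cth (n + 2 - Suc m + i + Suc j))"
    unfolding cth_pairs_def by (subst prod.lessThan_Suc_shift) simp
  also have "\<dots> = (\<Prod>j<m. (\<Prod>i<j. cth (n + 2 - m + i + j)) * cth (n + 2 - m + 2 * j))"
  proof (intro prod.cong refl, goal_cases)
    case (1 j)
    have "n + 2 - Suc m + i + Suc j = n + 2 - m + i + j" for i using assms by simp
    then show ?case
      by (simp only: prod.lessThan_Suc mult_2 add.assoc)
  qed
  finally show ?thesis by (simp add: prod.distrib cth_pairs_def)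
qed

text \<open>
  The factor \<open>cth (n + 1) ^ r\<close> comes from \<open>rogers2_eq\<close>, the others from
  \<open>reciprocal_det_to_rogers_det\<close>.
\<close>
lemma cth_pairs_even:
  "2 * r \<le> n + 2 \<Longrightarrow> cth_pairs n (2 * r) = (\<Prod>d<r. lead_up n d * lead_down n d) * cth (n + 1) ^ r"
proof (induction r)
  case 0
  then show ?case by (simp add: cth_pairs_def)
next
  case (Suc r)
  have le: "2 * r \<le> n" using Suc.prems by simp
  have "cth_pairs n (2 * Suc r) = cth_pairs n (2 * r) * (\<Prod>j<r+r. cth (n + 2 - 2 * r + 2 * j)) *
      (\<Prod>j<r+Suc r. cth (n + 2 - Suc (2 * r) + 2 * j))"
    using cth_pairs_Suc[of "2 * r" n] cth_pairs_Suc[of "Suc (2 * r)" n] le by (simp add: mult_2)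
  also have "(\<Prod>j<r+r. cth (n + 2 - 2 * r + 2 * j)) =
      (\<Prod>e<r. cth (n - 2 * e)) * (\<Prod>e<r. cth (n + 2 * e + 2))"
  proof -
    have "(\<Prod>j<r. cth (n + 2 - 2 * r + 2 * j)) = (\<Prod>j<r. cth (n - 2 * (r - Suc j)))"
      by (intro prod.cong refl arg_cong[where f = cth]) (use le in auto)
    also have "\<dots> = (\<Prod>e<r. cth (n - 2 * e))" by (rule prod.nat_diff_reindex)
    moreover have "(\<Prod>e<r. cth (n + 2 - 2 * r + 2 * (r + e))) = (\<Prod>e<r. cth (n + 2 * e + 2))"
      by (intro prod.cong refl arg_cong[where f = cth]) (use le in auto)
    ultimately show ?thesis unfolding prod_lessThan_add by simp
  qed
  also have "(\<Prod>j<r+Suc r. cth (n + 2 - Suc (2 * r) + 2 * j)) =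
      (\<Prod>e<r. cth (n - 1 - 2 * e)) * (cth (n + 1) * (\<Prod>e<r. cth (n + 2 * e + 3)))"
  proof -
    have "(\<Prod>j<r. cth (n + 2 - Suc (2 * r) + 2 * j)) = (\<Prod>j<r. cth (n - 1 - 2 * (r - Suc j)))"
      by (intro prod.cong refl arg_cong[where f = cth]) (use le in auto)
    also have "\<dots> = (\<Prod>e<r. cth (n - 1 - 2 * e))" by (rule prod.nat_diff_reindex)
    moreover have "(\<Prod>e<Suc r. cth (n + 2 - Suc (2 * r) + 2 * (r + e))) = cth (n + 1) * (\<Prod>e<r. cth (n + 2 * e + 3))"
      unfolding prod.lessThan_Suc_shift
      by (intro arg_cong2[where f = "(*)"] prod.cong refl arg_cong[where f = cth]) (use le in auto)
    ultimately show ?thesis unfolding prod_lessThan_add by simp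
  qed
  finally have "cth_pairs n (2 * Suc r) = cth_pairs n (2 * r) * (lead_up n r * lead_down n r * cth (n + 1))"
    unfolding lead_up_def lead_down_def prod.distrib by (simp only: mult_ac)
  then show ?case using Suc.IH Suc.prems by simp
qed

text \<open>
  The induction step shared by even and odd order: a function with the row expansion of
  the Pfaffian, but with a kernel proportional to
  \<open>(A p * B l - A l * B p) / (1 - x p * x l)\<close>, is, up to a constant and after
  multiplication by the \<open>1 - x i * x j\<close>, the palindromic determinant.
\<close>
lemma reciprocal_det_step:
  fixes x A B R G :: "nat \<Rightarrow> complex" and r :: nat
  defines "l \<equiv> Suc (2 * r)"
  assumes inj: "inj_on x {..<l}" and nz: "\<And>i. i < l \<Longrightarrow> x i \<noteq> 0"
    and kernel: "\<And>p. p < l \<Longrightarrow> c * ((1 - x p * x l) * R p) = A p * B l - A l * B p"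
    and smaller: "\<And>p. p < l \<Longrightarrow>
       c ^ r * ((\<Prod>j<2*r. \<Prod>i<j. 1 - x (insert_index p i) * x (insert_index p j)) * G p) =
       reciprocal_det r (\<lambda>i. x (insert_index p i)) (\<lambda>i. A (insert_index p i)) (\<lambda>i. B (insert_index p i))"
  shows "c ^ Suc r * ((\<Prod>j<l. \<Prod>i<j. 1 - x i * x j) * (\<Prod>i<l. 1 - x i * x l) *
     (\<Sum>p<l. (-1) ^ p * R p * G p)) = reciprocal_det (Suc r) x A B"
proof -
  define D where "D p = (\<Prod>j<2*r. \<Prod>i<j. 1 - x (insert_index p i) * x (insert_index p j))" for p
  define Q where "Q p = (\<Prod>j<2*r. (1 - x p * x (insert_index p j)) * (1 - x (insert_index p j) * x l))" for p
  have split: "(\<Prod>j<l. \<Prod>i<j. 1 - x i * x j) * (\<Prod>i<l. 1 - x i * x l) = (1 - x p * x l) * Q p * D p" if "p < l" for p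
  proof -
    have "(\<Prod>j<l. \<Prod>i<j. 1 - x i * x j) = (\<Prod>j<2*r. 1 - x p * x (insert_index p j)) * D p"
      unfolding D_def l_def by (rule pair_prod_symmetric) (use that in \<open>auto simp: l_def mult.commute\<close>)
    moreover have "(\<Prod>i<l. 1 - x i * x l) = (1 - x p * x l) * (\<Prod>j<2*r. 1 - x (insert_index p j) * x l)"
      unfolding l_def by (rule prod_insert_index) (use that in \<open>simp add: l_def\<close>)
    ultimately show ?thesis unfolding Q_def prod.distrib by (simp only: mult_ac)
  qed
  have "c ^ Suc r * ((\<Prod>j<l. \<Prod>i<j. 1 - x i * x j) * (\<Prod>i<l. 1 - x i * x l) * (\<Sum>p<l. (-1) ^ p * R p * G p)) =
     (\<Sum>p<l. (-1) ^ p * (A p * B l - A l * B p) * Q p *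
        reciprocal_det r (\<lambda>i. x (insert_index p i)) (\<lambda>i. A (insert_index p i)) (\<lambda>i. B (insert_index p i)))"
    unfolding sum_distrib_left
  proof (intro sum.cong refl, goal_cases)
    case (1 p)
    then have p: "p < l" by simp
    show ?case
      unfolding split[OF p] smaller[OF p, symmetric] kernel[OF p, symmetric] D_def[symmetric] power_Suc
      by (simp only: mult_ac)
  qed
  also have "\<dots> = reciprocal_det (Suc r) x A B"
    unfolding Q_def l_def
    by (rule reciprocal_det_expand[symmetric]) (use inj nz in \<open>auto simp: l_def\<close>)
  finally show ?thesis .
qed

lemma inj_on_insert_index:
  assumes "inj_on x {..<Suc m}"
  shows "inj_on (\<lambda>i. x (insert_index p i)) {..<m}"
proof (rule inj_onI)
  fix i j assume ij: "i \<in> {..<m}" "j \<in> {..<m}" "x (insert_index p i) = x (insert_index p j)"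
  have "insert_index p i < Suc m" "insert_index p j < Suc m" using ij by (auto simp: insert_index_def)
  then have "insert_index p i = insert_index p j" using inj_onD[OF assms ij(3)] by simp
  then show "i = j" by (auto simp: insert_index_def split: if_splits)
qed

lemma mrogers_reciprocal_det_even:
  assumes "2 * r \<le> n + 1" "inj_on x {..<2*r}" "\<And>i. i < 2 * r \<Longrightarrow> x i \<noteq> 0"
  shows "cth (n + 1) ^ r * ((\<Prod>j<2*r. \<Prod>i<j. 1 - x i * x j) * mrogers n (2 * r) x) =
     reciprocal_det r x (\<lambda>i. rogers (n + 1) (x i)) (\<lambda>i. x i * rogers_pred n (x i))"
  using assms
proof (induction r arbitrary: x)
  case 0
  then show ?case by (simp add: reciprocal_det_def)
next
  case (Suc r)
  have n1: "n \<ge> 1" using Suc.prems(1) by simp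
  have inj: "inj_on x {..<Suc (2 * r)}" using Suc.prems(2) by (rule inj_on_subset) auto
  have "cth (n + 1) ^ Suc r * ((\<Prod>j<Suc (2*r). \<Prod>i<j. 1 - x i * x j) * (\<Prod>i<Suc (2*r). 1 - x i * x (Suc (2 * r))) *
     (\<Sum>p<Suc (2*r). (-1) ^ p * rogers2 n (x p) (x (Suc (2 * r))) * mrogers n (2 * r) (\<lambda>i. x (insert_index p i)))) =
     reciprocal_det (Suc r) x (\<lambda>i. rogers (n + 1) (x i)) (\<lambda>i. x i * rogers_pred n (x i))"
  proof (rule reciprocal_det_step[OF inj])
    fix p
    show "cth (n + 1) * ((1 - x p * x (Suc (2 * r))) * rogers2 n (x p) (x (Suc (2 * r)))) =
       rogers (n + 1) (x p) * (x (Suc (2 * r)) * rogers_pred n (x (Suc (2 * r)))) -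
       rogers (n + 1) (x (Suc (2 * r))) * (x p * rogers_pred n (x p))"
      using rogers2_eq[OF n1, of "x p" "x (Suc (2 * r))"] n1 cth_nz[of "Suc n"]
      by (cases n) (simp_all add: rogers_pred_def)
  next
    fix p
    show "cth (n + 1) ^ r * ((\<Prod>j<2*r. \<Prod>i<j. 1 - x (insert_index p i) * x (insert_index p j)) *
          mrogers n (2 * r) (\<lambda>i. x (insert_index p i))) =
        reciprocal_det r (\<lambda>i. x (insert_index p i)) (\<lambda>i. rogers (n + 1) (x (insert_index p i)))
          (\<lambda>i. x (insert_index p i) * rogers_pred n (x (insert_index p i)))"
      by (rule Suc.IH) (use Suc.prems(1,3) inj_on_insert_index[OF inj] in \<open>auto simp: insert_index_def\<close>)
  qed (use Suc.prems(3) in auto)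
  then show ?case
    using mrogers_expand_even[of "2 * r" n x] by (simp add: mult.assoc)
qed

text \<open>
  For odd order a dummy argument \<open>1\<close> with \<open>A = B = 1\<close> is adjoined. Its kernel with \<open>x p\<close>
  is \<open>P_(n+1) (x p) - x p * P_(n-1) (x p) = cth (n + 1) * (1 - x p) * P_n (x p)\<close>, as the
  odd expansion of the Pfaffian requires.
\<close>
lemma mrogers_reciprocal_det_odd:
  assumes "2 * r \<le> n" "inj_on x {..<Suc (2*r)}" "\<And>i. i < Suc (2 * r) \<Longrightarrow> x i \<noteq> 0"
  defines "l \<equiv> Suc (2 * r)"
  shows "cth (n + 1) ^ Suc r * (\<Prod>j<l. 1 - x j) * ((\<Prod>j<l. \<Prod>i<j. 1 - x i * x j) * mrogers n l x) =
     reciprocal_det (Suc r) (x(l := 1)) ((\<lambda>i. rogers (n + 1) (x i))(l := 1)) ((\<lambda>i. x i * rogers_pred n (x i))(l := 1))"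
proof -
  let ?x = "x(l := 1)" and ?A = "(\<lambda>i. rogers (n + 1) (x i))(l := 1)" and ?B = "(\<lambda>i. x i * rogers_pred n (x i))(l := 1)"
  have inj: "inj_on ?x {..<Suc (2 * r)}" using assms(2) by (auto simp: inj_on_def l_def)
  have x: "?x i = x i" if "i < l" for i using that by simp
  have il: "insert_index p i < l" if "i < 2 * r" for p i using that by (auto simp: insert_index_def l_def)
  have D: "cth (n + 1) ^ Suc r * ((\<Prod>j<Suc (2*r). \<Prod>i<j. 1 - ?x i * ?x j) * (\<Prod>i<Suc (2*r). 1 - ?x i * ?x (Suc (2 * r))) *
     (\<Sum>p<Suc (2*r). (-1) ^ p * rogers n (x p) * mrogers n (2 * r) (\<lambda>i. x (insert_index p i)))) =
     reciprocal_det (Suc r) ?x ?A ?B"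
  proof (rule reciprocal_det_step[OF inj])
    fix p assume "p < Suc (2 * r)"
    then show "cth (n + 1) * ((1 - ?x p * ?x (Suc (2 * r))) * rogers n (x p)) = ?A p * ?B (Suc (2 * r)) - ?A (Suc (2 * r)) * ?B p"
      using rogers_rec_sol_rogers[of "x p", unfolded rogers_rec_sol_def, rule_format, of n]
      by (simp add: l_def rogers_pred_def)
  next
    fix p
    have "cth (n + 1) ^ r * ((\<Prod>j<2*r. \<Prod>i<j. 1 - x (insert_index p i) * x (insert_index p j)) *
          mrogers n (2 * r) (\<lambda>i. x (insert_index p i))) =
        reciprocal_det r (\<lambda>i. x (insert_index p i)) (\<lambda>i. rogers (n + 1) (x (insert_index p i)))
          (\<lambda>i. x (insert_index p i) * rogers_pred n (x (insert_index p i)))"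
      by (rule mrogers_reciprocal_det_even)
         (use assms(1,3) il[unfolded l_def] inj_on_insert_index[OF assms(2)] in auto)
    moreover have "(\<Prod>j<2*r. \<Prod>i<j. 1 - ?x (insert_index p i) * ?x (insert_index p j)) =
        (\<Prod>j<2*r. \<Prod>i<j. 1 - x (insert_index p i) * x (insert_index p j))"
      by (intro prod.cong refl arg_cong2[where f = "\<lambda>a b. 1 - a * b"] x il) auto
    moreover have "reciprocal_det r (\<lambda>i. ?x (insert_index p i)) (\<lambda>i. ?A (insert_index p i)) (\<lambda>i. ?B (insert_index p i)) =
        reciprocal_det r (\<lambda>i. x (insert_index p i)) (\<lambda>i. rogers (n + 1) (x (insert_index p i)))
          (\<lambda>i. x (insert_index p i) * rogers_pred n (x (insert_index p i)))"
      unfolding reciprocal_det_def by (intro detf_cong refl) (use il[of _ p] in \<open>auto dest: less_imp_neq\<close>)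
    ultimately show "cth (n + 1) ^ r * ((\<Prod>j<2*r. \<Prod>i<j. 1 - ?x (insert_index p i) * ?x (insert_index p j)) *
          mrogers n (2 * r) (\<lambda>i. x (insert_index p i))) =
        reciprocal_det r (\<lambda>i. ?x (insert_index p i)) (\<lambda>i. ?A (insert_index p i)) (\<lambda>i. ?B (insert_index p i))"
      by simp
  qed (use assms(3) in \<open>auto simp: l_def\<close>)
  have P1: "(\<Prod>j<l. \<Prod>i<j. 1 - ?x i * ?x j) = (\<Prod>j<l. \<Prod>i<j. 1 - x i * x j)"
    by (intro prod.cong refl arg_cong2[where f = "\<lambda>a b. 1 - a * b"] x) auto
  have P2: "(\<Prod>i<l. 1 - ?x i * ?x l) = (\<Prod>i<l. 1 - x i)"
    by (intro prod.cong refl) auto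
  have E: "mrogers n l x =
      (\<Sum>p<l. (-1) ^ p * rogers n (x p) * mrogers n (2 * r) (\<lambda>i. x (insert_index p i)))"
    unfolding l_def by (rule mrogers_expand_odd) simp
  show ?thesis
    unfolding D[folded l_def, unfolded P1 P2, symmetric] E by (simp only: mult_ac)
qed

text \<open>
  The differences of adjacent columns are, by the recurrence, \<open>1 - x i\<close> times a constant
  times the columns of \<open>rogers_det\<close>, while the dummy row becomes \<open>(0, ..., 0, 1)\<close>.
\<close>
lemma rogers_det_dummy_row:
  assumes "m \<le> n + 1"
  shows "detf (Suc m) (\<lambda>i j. (x(m := 1)) i ^ j * (if i = m then 1 else rogers_pred (n + Suc m - 2 * j) (x i))) =
     (\<Prod>i<m. 1 - x i) * (\<Prod>j<m. cth (n + 2 - m + 2 * j)) * rogers_det n m x"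
proof -
  define M where "M i j = (x(m := 1)) i ^ j * (if i = m then 1 else rogers_pred (n + Suc m - 2 * j) (x i))" for i j
  define c where "c k j = (if j < m \<and> k = Suc j then - 1 else 0 :: complex)" for k j
  define M' where "M' i j = M i j + (\<Sum>k<Suc m. M i k * c k j)" for i j
  have M1: "M' i j = M i j - M i (Suc j)" if "j < m" for i j
  proof -
    have "(\<Sum>k<Suc m. M i k * c k j) = (\<Sum>k<Suc m. if k = Suc j then - M i (Suc j) else 0)"
      by (intro sum.cong refl) (use that in \<open>auto simp: c_def\<close>)
    also have "\<dots> = - M i (Suc j)" using that by (subst sum.delta) auto
    finally show ?thesis by (simp add: M'_def)
  qed
  have Mm: "M' m m = 1" by (simp add: M'_def c_def M_def)
  have Mz: "M' m j = 0" if "j < m" for j using M1[OF that, of m] by (simp add: M_def)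
  have Me: "M' i j = (1 - x i) * cth (n + m - 2 * j) * (x i ^ j * rogers (n + m - 1 - 2 * j) (x i))"
    if "i < m" "j < m" for i j
  proof -
    define k where "k = n + m - 1 - 2 * j"
    have k: "n + Suc m - 2 * j = k + 2" "n + Suc m - 2 * Suc j = k" "n + m - 2 * j = k + 1"
      using that assms by (simp_all add: k_def)
    have e: "rogers_pred (k + 2) (x i) = cth (k + 1) * (1 - x i) * rogers k (x i) + x i * rogers_pred k (x i)"
      using rogers_rec_sol_rogers[of "x i", unfolded rogers_rec_sol_def, rule_format, of k]
      by (simp add: rogers_pred_def)
    have "M i j = x i ^ j * rogers_pred (k + 2) (x i)" "M i (Suc j) = x i ^ Suc j * rogers_pred k (x i)"
      using that unfolding M_def k by simp_all
    then show ?thesis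
      unfolding M1[OF that(2)] e k(3) k_def[symmetric] by (simp add: algebra_simps)
  qed
  have "detf (Suc m) M = detf (Suc m) M'"
    unfolding M'_def
    by (rule detf_col_ops[where h = "\<lambda>j. m - j", symmetric]) (auto simp: c_def split: if_splits)
  also have "\<dots> = (\<Sum>j<Suc m. (-1) ^ (m + j) * M' m j * detf m (\<lambda>i j'. M' (insert_index m i) (insert_index j j')))"
    by (rule detf_expand_row) simp
  also have "\<dots> = detf m (\<lambda>i j'. M' (insert_index m i) (insert_index m j'))"
    by (simp add: Mz Mm)
  also have "\<dots> = detf m (\<lambda>i j. (1 - x i) * cth (n + m - 2 * j) * (x i ^ j * rogers (n + m - 1 - 2 * j) (x i)))"
    by (intro detf_cong refl) (simp add: Me)
  also have "\<dots> = (\<Prod>i<m. 1 - x i) * (\<Prod>j<m. cth (n + m - 2 * j)) * rogers_det n m x"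
    unfolding rogers_det_def by (rule detf_scale)
  also have "(\<Prod>j<m. cth (n + m - 2 * j)) = (\<Prod>j<m. cth (n + 2 - m + 2 * (m - Suc j)))"
    by (intro prod.cong refl arg_cong[where f = cth]) (use assms in auto)
  also have "\<dots> = (\<Prod>j<m. cth (n + 2 - m + 2 * j))" by (rule prod.nat_diff_reindex)
  finally show ?thesis unfolding M_def .
qed

lemma mrogers_rogers_det_generic:
  assumes "m \<le> n + 1" "inj_on x {..<m}" "\<And>i. i < m \<Longrightarrow> x i \<noteq> 0" "\<And>i. i < m \<Longrightarrow> x i \<noteq> 1"
  shows "cth_pairs n m * ((\<Prod>j<m. \<Prod>i<j. 1 - x i * x j) * mrogers n m x) = rogers_det n m x"
proof (cases "even m")
  case True
  then obtain r where m: "m = 2 * r" by blast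
  have "rogers_det n m x = detf (2 * r) (\<lambda>i j. x i ^ j * rogers_pred (n + 2 * r - 2 * j) (x i))"
    unfolding rogers_det_def m
  proof (intro detf_cong refl)
    fix i j assume "j < 2 * r"
    then have "n + 2 * r - 2 * j = Suc (n + 2 * r - 1 - 2 * j)" using assms(1) m by simp
    then show "x i ^ j * rogers (n + 2 * r - 1 - 2 * j) (x i) = x i ^ j * rogers_pred (n + 2 * r - 2 * j) (x i)"
      by (simp add: rogers_pred_def)
  qed
  also have "\<dots> = (\<Prod>d<r. lead_up n d * lead_down n d) * reciprocal_det r x (\<lambda>i. rogers_pred (n + 2) (x i)) (\<lambda>i. x i * rogers_pred n (x i))"
    by (rule reciprocal_det_to_rogers_det) (use assms m rogers_rec_sol_rogers in auto)
  also have "(\<lambda>i. rogers_pred (n + 2) (x i)) = (\<lambda>i. rogers (n + 1) (x i))"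
    by (simp add: rogers_pred_def)
  also have "reciprocal_det r x (\<lambda>i. rogers (n + 1) (x i)) (\<lambda>i. x i * rogers_pred n (x i)) =
     cth (n + 1) ^ r * ((\<Prod>j<2*r. \<Prod>i<j. 1 - x i * x j) * mrogers n (2 * r) x)"
    by (rule mrogers_reciprocal_det_even[symmetric]) (use assms m in auto)
  finally show ?thesis using cth_pairs_even[of r n] assms(1) by (simp add: m mult_ac)
next
  case False
  then obtain r where m: "m = Suc (2 * r)" by (metis oddE Suc_eq_plus1)
  define S where "S i = (if i = m then (\<lambda>k. 1) else (\<lambda>k. rogers_pred k (x i)))" for i
  have "(\<Prod>i<m. 1 - x i) * (\<Prod>j<m. cth (n + 2 - m + 2 * j)) * rogers_det n m x =
     detf (2 * Suc r) (\<lambda>i j. (x(m := 1)) i ^ j * S i (n + 2 * Suc r - 2 * j))"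
    unfolding rogers_det_dummy_row[OF assms(1), symmetric]
    by (intro detf_cong) (auto simp: m S_def)
  also have "\<dots> = (\<Prod>d<Suc r. lead_up n d * lead_down n d) *
      reciprocal_det (Suc r) (x(m := 1)) (\<lambda>i. S i (n + 2)) (\<lambda>i. (x(m := 1)) i * S i n)"
    by (rule reciprocal_det_to_rogers_det)
       (use assms m rogers_rec_sol_rogers rogers_rec_sol_one in \<open>auto simp: S_def\<close>)
  also have "(\<lambda>i. S i (n + 2)) = ((\<lambda>i. rogers (n + 1) (x i))(m := 1))"
    by (rule ext) (simp add: S_def rogers_pred_def)
  also have "(\<lambda>i. (x(m := 1)) i * S i n) = ((\<lambda>i. x i * rogers_pred n (x i))(m := 1))"
    by (rule ext) (simp add: S_def)
  also have "reciprocal_det (Suc r) (x(m := 1)) ((\<lambda>i. rogers (n + 1) (x i))(m := 1)) ((\<lambda>i. x i * rogers_pred n (x i))(m := 1)) =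
     cth (n + 1) ^ Suc r * (\<Prod>j<m. 1 - x j) * ((\<Prod>j<m. \<Prod>i<j. 1 - x i * x j) * mrogers n m x)"
    unfolding m by (rule mrogers_reciprocal_det_odd[symmetric]) (use assms m in auto)
  also have "(\<Prod>d<Suc r. lead_up n d * lead_down n d) * (cth (n + 1) ^ Suc r * (\<Prod>j<m. 1 - x j) * ((\<Prod>j<m. \<Prod>i<j. 1 - x i * x j) * mrogers n m x)) =
    ((\<Prod>d<Suc r. lead_up n d * lead_down n d) * cth (n + 1) ^ Suc r) * (\<Prod>j<m. 1 - x j) * ((\<Prod>j<m. \<Prod>i<j. 1 - x i * x j) * mrogers n m x)"
    by (simp only: mult.assoc)
  also have "(\<Prod>d<Suc r. lead_up n d * lead_down n d) * cth (n + 1) ^ Suc r = cth_pairs n (Suc m)"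
    using cth_pairs_even[of "Suc r" n] assms(1) m by simp
  also have "\<dots> = cth_pairs n m * (\<Prod>j<m. cth (n + 2 - m + 2 * j))"
    by (rule cth_pairs_Suc[OF assms(1)])
  finally have "((\<Prod>i<m. 1 - x i) * (\<Prod>j<m. cth (n + 2 - m + 2 * j))) * rogers_det n m x =
     ((\<Prod>i<m. 1 - x i) * (\<Prod>j<m. cth (n + 2 - m + 2 * j))) * (cth_pairs n m * ((\<Prod>j<m. \<Prod>i<j. 1 - x i * x j) * mrogers n m x))"
    by (simp only: mult_ac)
  moreover have "(\<Prod>i<m. 1 - x i) * (\<Prod>j<m. cth (n + 2 - m + 2 * j)) \<noteq> 0"
    using assms(1,4) cth_nz by auto
  ultimately show ?thesis by simp
qed

text \<open>
  The determinant formula. The interpolation behind it needs distinct arguments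
  different from \<open>0\<close>, and the removal of the dummy row needs arguments different from
  \<open>1\<close>; the general case follows by perturbation. The bound \<open>m \<le> n + 1\<close> keeps the
  indices \<open>n + m - 1 - 2 * j\<close> nonnegative.
\<close>
theorem mrogers_rogers_det:
  assumes "m \<le> n + 1"
  shows "cth_pairs n m * ((\<Prod>j<m. \<Prod>i<j. 1 - x i * x j) * mrogers n m x) = rogers_det n m x"
proof -
  \<comment> \<open>The slopes \<open>i + 1\<close> are distinct and nonzero, so all exceptional values are left at
    once.\<close>
  let ?x = "\<lambda>t i. x i + t * of_nat (Suc i)"
  define f where "f t = cth_pairs n m * ((\<Prod>j<m. \<Prod>i<j. 1 - ?x t i * ?x t j) * mrogers n m (?x t))" for t
  define g where "g t = rogers_det n m (?x t)" for t
  have "f 0 = g 0"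
  proof (rule eq_by_perturbation)
    show "isCont f 0" unfolding f_def mrogers_def by (intro continuous_intros)
    show "isCont g 0" unfolding g_def rogers_det_def detf_leibniz rogers_def by (intro continuous_intros)
    have nz: "eventually (\<lambda>t. \<forall>i\<in>{..<m}. ?x t i \<noteq> 0) (at 0)"
      unfolding eventually_ball_finite_distrib[OF finite_lessThan]
      by (intro ballI eventually_affine_nonzero disjI2) (simp del: of_nat_Suc)
    have "eventually (\<lambda>t. \<forall>i\<in>{..<m}. (x i - 1) + t * of_nat (Suc i) \<noteq> 0) (at 0)"
      unfolding eventually_ball_finite_distrib[OF finite_lessThan]
      by (intro ballI eventually_affine_nonzero disjI2) (simp del: of_nat_Suc)
    then have n1: "eventually (\<lambda>t. \<forall>i\<in>{..<m}. ?x t i \<noteq> 1) (at 0)"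
      by (rule eventually_mono) (auto simp: algebra_simps simp del: of_nat_Suc)
    have inj: "eventually (\<lambda>t. inj_on (?x t) {..<m}) (at 0)"
      using eventually_perturbed_inj[of x m]
      by (rule eventually_mono) (auto simp: inj_on_def algebra_simps)
    show "eventually (\<lambda>t. f t = g t) (at 0)"
      using nz n1 inj
      by eventually_elim (unfold f_def g_def, rule mrogers_rogers_det_generic, use assms in auto)
  qed
  then show ?thesis by (simp add: f_def g_def)
qed

end

section \<open>Rogers polynomials as basic hypergeometric sums\<close>

lemma qpoch_0 [simp]: "qpoch a b 0 = 1"
  by (simp add: qpoch_def)

lemma qpoch_Suc: "qpoch a b (Suc k) = qpoch a b k * (1 - a * b ^ k)"
  by (simp add: qpoch_def)

lemma qpoch_add: "qpoch a b (j + k) = qpoch a b j * qpoch (a * b ^ j) b k"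
  unfolding qpoch_def prod_lessThan_add by (simp add: power_add mult.assoc)

lemma qpoch_Suc_shift: "qpoch a b (Suc k) = (1 - a) * qpoch (a * b) b k"
  using qpoch_add[of a b 1 k] by (simp add: qpoch_Suc)

lemma qpochs_Cons: "qpochs (a # as) b k = qpoch a b k * qpochs as b k"
  by (simp add: qpochs_def)

lemma qpochs_Nil [simp]: "qpochs [] b k = 1"
  by (simp add: qpochs_def)

lemma qpoch_neg_power_eq_0: "N < k \<Longrightarrow> b \<noteq> 0 \<Longrightarrow> qpoch (1 / b ^ N) b k = 0"
  unfolding qpoch_def by (rule prod_zero) auto

lemma qpoch_nonzero: "(\<And>j. j < k \<Longrightarrow> a * b ^ j \<noteq> 1) \<Longrightarrow> qpoch a b k \<noteq> 0"
  unfolding qpoch_def by auto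

text \<open>
  A terminating 4-phi-3 series with parameters \<open>b^(-N), \<beta>, a x, a / x\<close>. The list
  \<open>den\<close> contains \<open>b\<close> itself besides the three lower parameters.
\<close>
definition phi43 :: "complex \<Rightarrow> complex \<Rightarrow> complex list \<Rightarrow> nat \<Rightarrow> complex \<Rightarrow> complex \<Rightarrow> complex" where
  "phi43 b a den N \<beta> x = (\<Sum>k\<le>N. qpochs [1 / b ^ N, \<beta>, a * x, a / x] b k / qpochs den b k * b ^ k)"

lemma phi43_extend:
  assumes "N \<le> N'" "b \<noteq> 0"
  shows "phi43 b a den N \<beta> x = (\<Sum>k\<le>N'. qpochs [1 / b ^ N, \<beta>, a * x, a / x] b k / qpochs den b k * b ^ k)"
  unfolding phi43_def
  by (rule sum.mono_neutral_left) (use assms qpoch_neg_power_eq_0 in \<open>auto simp: qpochs_Cons\<close>)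

text \<open>
  All three terms are the same product times a polynomial of degree at most \<open>1\<close> in
  \<open>b ^ k\<close>; \<open>c0\<close> and \<open>c1\<close> are the comparison of the coefficients.
\<close>
lemma odd_term_identity:
  fixes b a e B c ko ko' ke' :: complex
  assumes nz: "b \<noteq> 0" "a \<noteq> 1" "B \<noteq> 0" "B \<noteq> 1" "e * b * B \<noteq> 1" "qpoch a b k \<noteq> 0" "qpoch (a * b) b k \<noteq> 0"
    and c0: "ko' / (1 - e * b * B) = c * ke' / (1 - a) - ko * B / (1 - B)"
    and c1: "ko' * e * b * B / (1 - e * b * B) = c * ke' * a / (1 - a) - ko / (1 - B)"
  shows "ko' * (qpoch (1 / B) b k * qpoch (e * b\<^sup>2 * B) b k / qpoch (a * b) b k) =
     c * ke' * (qpoch (1 / B) b k * qpoch (e * b * B) b k / qpoch a b k) +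
     ko * (qpoch (b / B) b k * qpoch (e * b * B) b k / qpoch (a * b) b k)"
proof -
  define X where "X = qpoch (1 / B) b k * qpoch (e * b * B) b k / qpoch (a * b) b k"
  have 1: "qpoch (1 / B) b k * qpoch (e * b\<^sup>2 * B) b k / qpoch (a * b) b k = X * ((1 - e * b * B * b ^ k) / (1 - e * b * B))"
  proof -
    have "(1 - e * b * B) * qpoch (e * b\<^sup>2 * B) b k = qpoch (e * b * B) b k * (1 - e * b * B * b ^ k)"
      using qpoch_Suc_shift[of "e * b * B" b k] by (simp add: qpoch_Suc power2_eq_square mult_ac)
    then have "qpoch (e * b\<^sup>2 * B) b k = qpoch (e * b * B) b k * ((1 - e * b * B * b ^ k) / (1 - e * b * B))"
      using nz(5) by (simp add: divide_simps mult_ac)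
    then show ?thesis by (simp add: X_def mult_ac)
  qed
  have 2: "qpoch (1 / B) b k * qpoch (e * b * B) b k / qpoch a b k = X * ((1 - a * b ^ k) / (1 - a))"
  proof -
    have "(1 - a) * qpoch (a * b) b k = qpoch a b k * (1 - a * b ^ k)"
      using qpoch_Suc_shift[of a b k] by (simp add: qpoch_Suc)
    moreover from this have "1 - a * b ^ k \<noteq> 0" using nz by auto
    ultimately have "1 / qpoch a b k = (1 / qpoch (a * b) b k) * ((1 - a * b ^ k) / (1 - a))"
      using nz by (simp add: divide_simps mult_ac)
    then show ?thesis unfolding X_def by (metis (no_types) divide_inverse inverse_eq_divide mult.assoc)
  qed
  have 3: "qpoch (b / B) b k * qpoch (e * b * B) b k / qpoch (a * b) b k = X * ((b ^ k - B) / (1 - B))"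
  proof -
    have "(1 - 1 / B) * qpoch (b / B) b k = qpoch (1 / B) b k * (1 - b ^ k / B)"
      using qpoch_Suc_shift[of "1 / B" b k] by (simp add: qpoch_Suc)
    then have "(B - 1) * qpoch (b / B) b k = qpoch (1 / B) b k * (B - b ^ k)"
      using nz(3) by (simp add: field_simps)
    then have "qpoch (b / B) b k = qpoch (1 / B) b k * ((B - b ^ k) / (B - 1))"
      using nz(4) by (simp add: divide_simps mult_ac)
    also have "(B - b ^ k) / (B - 1) = (b ^ k - B) / (1 - B)"
      by (metis minus_diff_eq minus_divide_divide)
    finally show ?thesis by (simp add: X_def mult_ac)
  qed
  have "ko' * ((1 - e * b * B * b ^ k) / (1 - e * b * B)) =
     ko' / (1 - e * b * B) - ko' * e * b * B / (1 - e * b * B) * b ^ k"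
    by (simp add: diff_divide_distrib algebra_simps)
  also have "\<dots> = c * ke' * ((1 - a * b ^ k) / (1 - a)) + ko * ((b ^ k - B) / (1 - B))"
    unfolding c0 c1 by (simp add: diff_divide_distrib algebra_simps)
  finally have "X * (ko' * ((1 - e * b * B * b ^ k) / (1 - e * b * B))) =
     X * (c * ke' * ((1 - a * b ^ k) / (1 - a)) + ko * ((b ^ k - B) / (1 - B)))" by simp
  then show ?thesis unfolding 1 2 3 by (simp only: distrib_left mult_ac)
qed

text \<open>
  Here \<open>y\<close> stands for \<open>b ^ k\<close>. The cubic difference on the right is divisible by \<open>y\<close>,
  and \<open>dd\<close> removes its cubic term; so again both sides are linear in \<open>y\<close>, and \<open>y0\<close> and
  \<open>y1\<close> compare coefficients.
\<close>
lemma even_term_identity: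
  fixes b a e d1 d2 B y c ko ke ke' :: complex
  assumes nz: "b \<noteq> 0" "a \<noteq> 0" "a \<noteq> 1" "B \<noteq> 0" "y \<noteq> 0"
    and dd: "d1 * d2 = a * e * b\<^sup>2"
    and y0: "- ke' * (1 - B) / (B * (1 - a)) = ke * (1 - e * B) / (1 - a) + c * ko / a * (1 + (d1 + d2) / b - 1 / B - e * B - a)"
    and y1: "ke' * (1 - B) * e / (1 - a) = - ke * (1 - e * B) / (B * (1 - a)) + c * ko / a * (e + a / B + a * e * B - (d1 + d2) / b - a * e)"
  shows "ke' * ((1 - 1 / B) * (1 - e * B * y) / (1 - a)) = ke * ((1 - y / B) * (1 - e * B) / (1 - a)) +
     c * ko * (((1 - y / B) * (1 - e * B * y) * (1 - a * y) - (1 - y) * (1 - d1 * y / b) * (1 - d2 * y / b)) / (a * y))"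
proof -
  define D where "D = (d1 + d2) / b"
  have d: "(1 - d1 * y / b) * (1 - d2 * y / b) = 1 - D * y + a * e * y\<^sup>2"
  proof -
    have "(1 - d1 * y / b) * (1 - d2 * y / b) = 1 - D * y + (d1 * d2) / b\<^sup>2 * y\<^sup>2"
      unfolding D_def by (simp add: algebra_simps power2_eq_square add_divide_distrib diff_divide_distrib)
    then show ?thesis using dd nz(1) by simp
  qed
  have "(1 - y / B) * (1 - e * B * y) * (1 - a * y) - (1 - y) * (1 - d1 * y / b) * (1 - d2 * y / b) =
     y * ((1 + D - 1 / B - e * B - a) + (e + a / B + a * e * B - D - a * e) * y)"
    unfolding mult.assoc[of "1 - y"] d using nz(4)
    by (simp add: field_simps power2_eq_square)
  then have E: "c * ko * (((1 - y / B) * (1 - e * B * y) * (1 - a * y) - (1 - y) * (1 - d1 * y / b) * (1 - d2 * y / b)) / (a * y)) =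
     c * ko / a * (1 + D - 1 / B - e * B - a) +
     c * ko / a * (e + a / B + a * e * B - D - a * e) * y"
    using nz by (simp add: divide_simps) (simp add: algebra_simps)
  have L: "ke' * ((1 - 1 / B) * (1 - e * B * y) / (1 - a)) =
     - ke' * (1 - B) / (B * (1 - a)) + (ke' * (1 - B) * e / (1 - a)) * y"
    using nz by (simp add: divide_simps) (simp add: algebra_simps)
  have R: "ke * ((1 - y / B) * (1 - e * B) / (1 - a)) = ke * (1 - e * B) / (1 - a) + (- ke * (1 - e * B) / (B * (1 - a))) * y"
    using nz by (simp add: divide_simps) (simp add: algebra_simps)
  show ?thesis unfolding L R E y0[folded D_def] y1[folded D_def] by (simp only: algebra_simps)
qed

text \<open>
  The relations between the constants \<open>ke\<close>, \<open>ko\<close> in front of the series for \<open>P_(2K)\<close> and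
  \<open>P_(2K+1)\<close>, and \<open>ke'\<close>, \<open>ko'\<close> for \<open>K + 1\<close>, that make the Rogers recurrence hold; here
  \<open>B = b^(K+1)\<close>. The first two are the coefficients of \<open>1\<close> and \<open>b^k\<close> in the step to
  \<open>P_(2K+3)\<close>. In the step to \<open>P_(2K+2)\<close>, the third one is the term \<open>k = 0\<close>, and the last
  two are the coefficients of \<open>1\<close> and \<open>b^k\<close> in the terms \<open>k > 0\<close>.
\<close>
definition contiguous ::
  "complex \<Rightarrow> complex \<Rightarrow> complex \<Rightarrow> complex \<Rightarrow> complex \<Rightarrow> complex \<Rightarrow> complex \<Rightarrow> complex \<Rightarrow>
   complex \<Rightarrow> complex \<Rightarrow> complex \<Rightarrow> complex \<Rightarrow> bool" where
  "contiguous b a e d1 d2 c c' B ke ko ke' ko' \<longleftrightarrow>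
     ko' / (1 - e * b * B) = c' * ke' / (1 - a) - ko * B / (1 - B) \<and>
     ko' * e * b * B / (1 - e * b * B) = c' * ke' * a / (1 - a) - ko / (1 - B) \<and>
     ke' = ke + c * ko * (1 - a)\<^sup>2 / a \<and>
     - ke' * (1 - B) / (B * (1 - a)) =
       ke * (1 - e * B) / (1 - a) + c * ko / a * (1 + (d1 + d2) / b - 1 / B - e * B - a) \<and>
     ke' * (1 - B) * e / (1 - a) =
       - ke * (1 - e * B) / (B * (1 - a)) + c * ko / a * (e + a / B + a * e * B - (d1 + d2) / b - a * e)"

text \<open>
  In each of the four families the relations are rational identities in \<open>Q = q^(K+1)\<close>.
  The names give the base and the parameter \<open>a\<close>.
\<close>
lemma contiguous_q_a_q:
  fixes q Q s :: complex
  assumes "q \<noteq> 0" "q \<noteq> 1" "1 \<noteq> q" "q\<^sup>2 \<noteq> 1" "1 \<noteq> q\<^sup>2" "Q \<noteq> 0" "Q \<noteq> 1" "1 \<noteq> Q" "1 + Q \<noteq> 0"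
    "Q\<^sup>2 \<noteq> 1" "1 \<noteq> Q\<^sup>2" "q * Q\<^sup>2 \<noteq> 1" "1 \<noteq> q * Q\<^sup>2" "1 + q * Q \<noteq> 0"
    "q\<^sup>2 * Q\<^sup>2 \<noteq> 1" "1 \<noteq> q\<^sup>2 * Q\<^sup>2"
  shows "contiguous q q (- 1) (s ^ 3) (- (s ^ 3)) ((1 + Q\<^sup>2) / (1 - Q\<^sup>2)) ((1 + q * Q\<^sup>2) / (1 - q * Q\<^sup>2)) Q
      (q * (1 - Q\<^sup>2 / q) / ((1 - q) * Q))
      (q * (1 - Q\<^sup>2) / ((1 - q)\<^sup>2 * Q))
      ((1 - q * Q\<^sup>2) / ((1 - q) * Q))
      ((1 - q\<^sup>2 * Q\<^sup>2) / ((1 - q)\<^sup>2 * Q))"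
  unfolding contiguous_def using assms
  by (intro conjI;
      (simp add: divide_simps; simp add: algebra_simps power2_eq_square power3_eq_cube power4_eq_xxxx))

lemma contiguous_q2_a_q:
  fixes q Q :: complex
  assumes "q \<noteq> 0" "q \<noteq> 1" "1 \<noteq> q" "q\<^sup>2 \<noteq> 1" "1 \<noteq> q\<^sup>2" "Q \<noteq> 0" "Q \<noteq> 1" "1 \<noteq> Q" "1 + Q \<noteq> 0"
    "Q\<^sup>2 \<noteq> 1" "1 \<noteq> Q\<^sup>2" "q * Q\<^sup>2 \<noteq> 1" "1 \<noteq> q * Q\<^sup>2" "1 + q * Q \<noteq> 0"
    "q\<^sup>2 * Q\<^sup>2 \<noteq> 1" "1 \<noteq> q\<^sup>2 * Q\<^sup>2"
  shows "contiguous (q\<^sup>2) q 1 (q\<^sup>2) (q ^ 3) ((1 + Q\<^sup>2) / (1 - Q\<^sup>2)) ((1 + q * Q\<^sup>2) / (1 - q * Q\<^sup>2)) (Q\<^sup>2)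
      (q * (1 - Q\<^sup>2 / q) / ((1 - q) * Q))
      (q * (1 - Q\<^sup>2) / ((1 - q)\<^sup>2 * Q))
      ((1 - q * Q\<^sup>2) / ((1 - q) * Q))
      ((1 - q\<^sup>2 * Q\<^sup>2) / ((1 - q)\<^sup>2 * Q))"
  unfolding contiguous_def using assms
  by (intro conjI;
      (simp add: divide_simps; simp add: algebra_simps power2_eq_square power3_eq_cube power4_eq_xxxx))

lemma contiguous_q2_a_q2:
  fixes q Q :: complex
  assumes "q \<noteq> 0" "q \<noteq> 1" "1 \<noteq> q" "q\<^sup>2 \<noteq> 1" "1 \<noteq> q\<^sup>2" "Q \<noteq> 0" "Q \<noteq> 1" "1 \<noteq> Q" "1 + Q \<noteq> 0"
    "Q\<^sup>2 \<noteq> 1" "1 \<noteq> Q\<^sup>2" "q * Q\<^sup>2 \<noteq> 1" "1 \<noteq> q * Q\<^sup>2" "1 + q * Q \<noteq> 0"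
    "q\<^sup>2 * Q\<^sup>2 \<noteq> 1" "1 \<noteq> q\<^sup>2 * Q\<^sup>2"
  shows "contiguous (q\<^sup>2) (q\<^sup>2) 1 (q ^ 3) (q ^ 3) ((1 + Q\<^sup>2) / (1 - Q\<^sup>2)) ((1 + q * Q\<^sup>2) / (1 - q * Q\<^sup>2)) (Q\<^sup>2)
      (q\<^sup>2 * (1 - Q\<^sup>2 / q)\<^sup>2 / ((1 - q)\<^sup>2 * Q\<^sup>2))
      (q\<^sup>2 * (1 - Q\<^sup>2)\<^sup>2 / ((1 - q)\<^sup>2 * (1 - q\<^sup>2) * Q\<^sup>2))
      ((1 - q * Q\<^sup>2)\<^sup>2 / ((1 - q)\<^sup>2 * Q\<^sup>2))
      ((1 - q\<^sup>2 * Q\<^sup>2)\<^sup>2 / ((1 - q)\<^sup>2 * (1 - q\<^sup>2) * Q\<^sup>2))"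
  unfolding contiguous_def using assms
  by (intro conjI;
      (simp add: divide_simps; simp add: algebra_simps power2_eq_square power3_eq_cube power4_eq_xxxx))

text \<open>
  The constants of this family are not rational in \<open>Q\<close>, but their ratios to
  \<open>E = kap_even_s K\<close> are.
\<close>
lemma contiguous_q_a_s:
  fixes Q s E :: complex
  assumes "s \<noteq> 0" "s \<noteq> 1" "1 \<noteq> s" "s\<^sup>2 \<noteq> 1" "1 \<noteq> s\<^sup>2" "1 + s \<noteq> 0" "Q \<noteq> 0" "Q \<noteq> 1" "1 \<noteq> Q"
    "1 + Q \<noteq> 0" "Q\<^sup>2 \<noteq> 1" "1 \<noteq> Q\<^sup>2" "s\<^sup>2 * Q\<^sup>2 \<noteq> 1" "1 \<noteq> s\<^sup>2 * Q\<^sup>2" "1 + s\<^sup>2 * Q \<noteq> 0"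
    "s + Q \<noteq> 0" "1 + s * Q \<noteq> 0"
  shows "contiguous (s\<^sup>2) s (- 1) (s ^ 3) (- (s\<^sup>2)) ((1 + Q\<^sup>2) / (1 - Q\<^sup>2)) ((1 + s\<^sup>2 * Q\<^sup>2) / (1 - s\<^sup>2 * Q\<^sup>2)) Q
      E
      (E * ((1 + Q) * (1 + s) / ((1 - s\<^sup>2) * (1 + Q / s))))
      (E * ((1 + Q) * (1 - s * Q) / (s * (1 - Q) * (1 + Q / s))))
      (E * ((1 + Q) * (1 - s * Q) / (s * (1 - Q) * (1 + Q / s))) *
       ((1 + s\<^sup>2 * Q) * (1 + s) / ((1 - s\<^sup>2) * (1 + s * Q))))"
  unfolding contiguous_def using assms
  by (intro conjI;
      (simp add: divide_simps; simp add: algebra_simps power2_eq_square power3_eq_cube power4_eq_xxxx))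

context generic_q
begin

text \<open>
  Put \<open>\<phi>_k = (a x, a / x; b)_k\<close>. After division by \<open>(1 - x) x^(K+1)\<close> and \<open>x^(K+1)\<close>,
  the recurrences for \<open>P_(2K+3)\<close> and \<open>P_(2K+2)\<close> are two relations between the series,
  and they hold if the coefficients of each \<open>\<phi>_k\<close> agree. The first one, for
  \<open>P_(2K+3)\<close>, has constant coefficients. In the second one, for \<open>P_(2K+2)\<close>, there is a
  factor \<open>(1 - x)\<^sup>2 / x\<close>, which maps \<open>\<phi>_k\<close> to a combination of \<open>\<phi>_k\<close> and
  \<open>\<phi>_(k+1)\<close>. The condition on \<open>d1 * d2\<close> says that the series are balanced.
\<close>
lemma rogers_as_phi43:
  fixes b a e d1 d2 :: complex and ke ko :: "nat \<Rightarrow> complex"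
  defines "De \<equiv> [b, a, d1, d2]" and "Do \<equiv> [b, a * b, d1, d2]"
  assumes b: "b \<noteq> 0" "\<And>k. k > 0 \<Longrightarrow> b ^ k \<noteq> 1" and a0: "a \<noteq> 0"
    and ab: "\<And>k. a * b ^ k \<noteq> 1" and d1: "\<And>k. d1 * b ^ k \<noteq> 1" and d2: "\<And>k. d2 * b ^ k \<noteq> 1"
    and e: "\<And>k. k > 0 \<Longrightarrow> e * b ^ k \<noteq> 1" and dd: "d1 * d2 = a * e * b\<^sup>2"
    and base: "ke 0 = 1" "ko 0 = cth 1"
    and rel: "\<And>K. contiguous b a e d1 d2 (cth (2 * K + 2)) (cth (2 * K + 3)) (b ^ Suc K)
                (ke K) (ko K) (ke (Suc K)) (ko (Suc K))"
    and x0: "x \<noteq> 0"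
  shows "rogers (2 * K) x = ke K * x ^ K * phi43 b a De K (e * b ^ (K + 1)) x \<and>
         rogers (2 * K + 1) x = ko K * ((1 - x) * x ^ K) * phi43 b a Do K (e * b ^ (K + 2)) x"
proof -
  have a1: "a \<noteq> 1" using ab[of 0] by simp
  have nz: "qpoch b b k \<noteq> 0" "qpoch a b k \<noteq> 0" "qpoch (a * b) b k \<noteq> 0" "qpoch d1 b k \<noteq> 0" "qpoch d2 b k \<noteq> 0" for k
    using b(2)[of "Suc _"] ab d1 d2 ab[of "Suc _"] by (auto intro!: qpoch_nonzero simp: mult.assoc)
  define \<phi> where "\<phi> k = qpoch (a * x) b k * qpoch (a / x) b k" for k
  define V where "V k = b ^ k / (qpoch b b k * qpoch d1 b k * qpoch d2 b k)" for k
  define te where "te K k = qpoch (1 / b ^ K) b k * qpoch (e * b ^ (K + 1)) b k / qpoch a b k" for K k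
  define to where "to K k = qpoch (1 / b ^ K) b k * qpoch (e * b ^ (K + 2)) b k / qpoch (a * b) b k" for K k
  have hE: "phi43 b a De K (e * b ^ (K + 1)) x = (\<Sum>k\<le>N. te K k * V k * \<phi> k)" if "K \<le> N" for K N
    unfolding phi43_extend[OF that b(1)] De_def qpochs_Cons qpochs_Nil te_def V_def \<phi>_def
    by (intro sum.cong refl) (simp add: divide_simps)
  have hO: "phi43 b a Do K (e * b ^ (K + 2)) x = (\<Sum>k\<le>N. to K k * V k * \<phi> k)" if "K \<le> N" for K N
    unfolding phi43_extend[OF that b(1)] Do_def qpochs_Cons qpochs_Nil to_def V_def \<phi>_def
    by (intro sum.cong refl) (simp add: divide_simps)
  have odd_step: "ko (Suc K) * phi43 b a Do (Suc K) (e * b ^ (Suc K + 2)) x =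
      cth (2 * K + 3) * ke (Suc K) * phi43 b a De (Suc K) (e * b ^ (Suc K + 1)) x + ko K * phi43 b a Do K (e * b ^ (K + 2)) x" for K
  proof -
    define B where "B = b ^ Suc K"
    note c0 = rel[of K, unfolded contiguous_def, THEN conjunct1, folded B_def]
      and c1 = rel[of K, unfolded contiguous_def, THEN conjunct2, THEN conjunct1, folded B_def]
    have B: "B \<noteq> 0" "B \<noteq> 1" "e * b * B \<noteq> 1"
      using b(1) b(2)[of "Suc K"] e[of "Suc (Suc K)"] by (simp_all add: B_def mult_ac)
    have pw: "e * b ^ (Suc K + 2) = e * b\<^sup>2 * B" "e * b ^ (Suc K + 1) = e * b * B" "e * b ^ (K + 2) = e * b * B"
      "1 / b ^ K = b / B"
      using b(1) by (simp_all add: B_def power2_eq_square mult_ac)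
    have t: "ko (Suc K) * to (Suc K) k = cth (2 * K + 3) * ke (Suc K) * te (Suc K) k + ko K * to K k" for k
      unfolding to_def te_def pw unfolding B_def[symmetric]
      by (rule odd_term_identity[OF b(1) a1 B nz(2,3) c0 c1])
    have "ko (Suc K) * phi43 b a Do (Suc K) (e * b ^ (Suc K + 2)) x = (\<Sum>k\<le>Suc K. (ko (Suc K) * to (Suc K) k) * V k * \<phi> k)"
      unfolding hO[OF order_refl] sum_distrib_left by (simp only: mult.assoc)
    also have "\<dots> = cth (2 * K + 3) * ke (Suc K) * phi43 b a De (Suc K) (e * b ^ (Suc K + 1)) x + ko K * phi43 b a Do K (e * b ^ (K + 2)) x"
      unfolding hE[OF order_refl] hO[OF le_SucI[OF order_refl]] sum_distrib_left sum.distrib[symmetric] t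
      by (simp only: distrib_right mult.assoc)
    finally show ?thesis .
  qed
  have even_step: "ke (Suc K) * phi43 b a De (Suc K) (e * b ^ (Suc K + 1)) x =
      ke K * phi43 b a De K (e * b ^ (K + 1)) x +
      cth (2 * K + 2) * ko K * ((1 - x)\<^sup>2 / x * phi43 b a Do K (e * b ^ (K + 2)) x)" for K
  proof -
    define B where "B = b ^ Suc K"
    define c where "c = cth (2 * K + 2)"
    note rel' = rel[of K, unfolded contiguous_def, THEN conjunct2, THEN conjunct2, folded B_def c_def]
    note k0 = rel'[THEN conjunct1] and y0 = rel'[THEN conjunct2, THEN conjunct1]
      and y1 = rel'[THEN conjunct2, THEN conjunct2]
    have B: "B \<noteq> 0" using b(1) by (simp add: B_def)
    have pw: "e * b ^ (Suc K + 1) = e * B * b" "e * b ^ (K + 2) = e * B * b" "e * b ^ (K + 1) = e * B"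
      "1 / b ^ K = b / B"
      using b(1) by (simp_all add: B_def mult_ac)
    \<comment> \<open>\<open>(1 - a x y) (1 - a y / x) = (1 - a y)\<^sup>2 - a y (1 - x)\<^sup>2 / x\<close> for
      \<open>y = b^k\<close>.\<close>
    have phi: "(1 - x)\<^sup>2 / x * \<phi> k = ((1 - a * b ^ k)\<^sup>2 * \<phi> k - \<phi> (Suc k)) / (a * b ^ k)" for k
    proof -
      have "\<phi> (Suc k) = \<phi> k * ((1 - a * x * b ^ k) * (1 - a / x * b ^ k))"
        by (simp add: \<phi>_def qpoch_Suc mult_ac)
      also have "(1 - a * x * b ^ k) * (1 - a / x * b ^ k) = (1 - a * b ^ k)\<^sup>2 - a * b ^ k * ((1 - x)\<^sup>2 / x)"
        using x0 by (simp add: field_simps power2_eq_square)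
      finally show ?thesis using a0 b(1) by (simp add: field_simps)
    qed
    define F where "F k = to K k * V k * ((1 - a * b ^ k)\<^sup>2 / (a * b ^ k))" for k
    define G where "G k = to K k * V k / (a * b ^ k)" for k
    have toz: "to K k = 0" if "k > K" for k
      using that b(1) by (simp add: to_def qpoch_neg_power_eq_0)
    have "(1 - x)\<^sup>2 / x * phi43 b a Do K (e * b ^ (K + 2)) x = (\<Sum>k\<le>K. to K k * V k * ((1 - x)\<^sup>2 / x * \<phi> k))"
      unfolding hO[OF order_refl] sum_distrib_left by (simp only: mult_ac)
    also have "\<dots> = (\<Sum>k\<le>K. F k * \<phi> k) - (\<Sum>k\<le>K. G k * \<phi> (Suc k))"
      unfolding phi sum_subtractf[symmetric] F_def G_def
      by (intro sum.cong refl) (simp add: diff_divide_distrib right_diff_distrib mult_ac)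
    also have "(\<Sum>k\<le>K. F k * \<phi> k) = (\<Sum>k\<le>Suc K. F k * \<phi> k)"
      by (simp add: F_def toz)
    also have "\<dots> = F 0 * \<phi> 0 + (\<Sum>k\<le>K. F (Suc k) * \<phi> (Suc k))"
      by (rule sum.atMost_Suc_shift)
    finally have O: "(1 - x)\<^sup>2 / x * phi43 b a Do K (e * b ^ (K + 2)) x =
       F 0 * \<phi> 0 + (\<Sum>k\<le>K. (F (Suc k) - G k) * \<phi> (Suc k))"
      by (simp add: sum_subtractf left_diff_distrib)
    have z: "te L 0 * V 0 = 1" "F 0 = (1 - a)\<^sup>2 / a" for L
      by (simp_all add: te_def V_def F_def to_def)
    have t: "ke (Suc K) * (te (Suc K) (Suc k) * V (Suc k)) = ke K * (te K (Suc k) * V (Suc k)) + c * ko K * (F (Suc k) - G k)" for k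
    proof -
      define y where "y = b ^ Suc k"
      have y: "y \<noteq> 0" "y \<noteq> 1" "a * y \<noteq> 1" "d1 * y / b \<noteq> 1" "d2 * y / b \<noteq> 1"
        using b(1) b(2)[of "Suc k"] ab[of "Suc k"] d1[of k] d2[of k] by (simp_all add: y_def)
      \<comment> \<open>\<open>R\<close> is the common factor of all terms with index \<open>k + 1\<close>; what remains is
        \<open>even_term_identity\<close>.\<close>
      define Z where "Z = qpoch (b / B) b k * qpoch (e * B * b) b k * V k / qpoch (a * b) b k"
      define R where "R = Z * b / ((1 - y) * (1 - d1 * y / b) * (1 - d2 * y / b))"
      have bk: "b * b ^ k = y" "b ^ k = y / b" using b(1) by (simp_all add: y_def)
      have V: "V (Suc k) = V k * b / ((1 - y) * (1 - d1 * y / b) * (1 - d2 * y / b))"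
        unfolding V_def qpoch_Suc by (simp add: bk mult_ac)
      have t1: "te (Suc K) (Suc k) * V (Suc k) = R * ((1 - 1 / B) * (1 - e * B * y) / (1 - a))"
        unfolding te_def pw V R_def Z_def B_def[symmetric]
          qpoch_Suc_shift[of "1 / B"] qpoch_Suc_shift[of a] qpoch_Suc[of "e * B * b"]
        by (simp add: y_def mult_ac)
      have t2: "te K (Suc k) * V (Suc k) = R * ((1 - y / B) * (1 - e * B) / (1 - a))"
        unfolding te_def pw V R_def Z_def
          qpoch_Suc_shift[of "e * B"] qpoch_Suc_shift[of a] qpoch_Suc[of "b / B"]
        by (simp add: y_def mult_ac)
      have t3: "F (Suc k) = R * ((1 - y / B) * (1 - e * B * y) * (1 - a * y) / (a * y))"
      proof -
        have "to K (Suc k) * V (Suc k) = R * ((1 - y / B) * (1 - e * B * y) / (1 - a * y))"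
          unfolding to_def pw V R_def Z_def
            qpoch_Suc[of "e * B * b"] qpoch_Suc[of "a * b"] qpoch_Suc[of "b / B"]
          by (simp add: y_def mult_ac)
        then show ?thesis unfolding F_def y_def[symmetric] using y(3) by (simp add: power2_eq_square)
      qed
      have t4: "G k = R * ((1 - y) * (1 - d1 * y / b) * (1 - d2 * y / b) / (a * y))"
      proof -
        have "G k = Z / (a * (y / b))"
          unfolding G_def to_def pw Z_def bk(2) by (simp add: mult_ac)
        then show ?thesis using y b(1) unfolding R_def by simp
      qed
      have "R * (ke (Suc K) * ((1 - 1 / B) * (1 - e * B * y) / (1 - a))) =
        R * (ke K * ((1 - y / B) * (1 - e * B) / (1 - a)) +
           c * ko K * (((1 - y / B) * (1 - e * B * y) * (1 - a * y) - (1 - y) * (1 - d1 * y / b) * (1 - d2 * y / b)) / (a * y)))"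
        by (rule arg_cong[where f = "\<lambda>t. R * t"],
            rule even_term_identity[OF b(1) a0 a1 B y(1) dd y0 y1])
      then show ?thesis
        unfolding t1 t2 t3 t4 diff_divide_distrib by (simp only: distrib_left right_diff_distrib mult_ac)
    qed
    have "ke (Suc K) * phi43 b a De (Suc K) (e * b ^ (Suc K + 1)) x =
       ke (Suc K) * \<phi> 0 + (\<Sum>k\<le>K. (ke (Suc K) * (te (Suc K) (Suc k) * V (Suc k))) * \<phi> (Suc k))"
      unfolding hE[OF order_refl] sum.atMost_Suc_shift z distrib_left sum_distrib_left by (simp add: mult.assoc)
    also have "\<dots> = (ke K * \<phi> 0 + (\<Sum>k\<le>K. (ke K * (te K (Suc k) * V (Suc k))) * \<phi> (Suc k))) +
       c * ko K * (F 0 * \<phi> 0 + (\<Sum>k\<le>K. (F (Suc k) - G k) * \<phi> (Suc k)))"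
      unfolding t z unfolding k0
      by (simp add: distrib_left distrib_right sum.distrib sum_distrib_left mult.assoc)
    also have "ke K * \<phi> 0 + (\<Sum>k\<le>K. (ke K * (te K (Suc k) * V (Suc k))) * \<phi> (Suc k)) =
       ke K * phi43 b a De K (e * b ^ (K + 1)) x"
      unfolding hE[OF le_SucI[OF order_refl]] sum.atMost_Suc_shift z distrib_left sum_distrib_left by (simp add: mult.assoc)
    finally show ?thesis unfolding O c_def .
  qed
  show ?thesis
  proof (induction K)
    case 0
    show ?case using base by (simp add: phi43_def De_def Do_def qpochs_Cons rogers_1)
  next
    case (Suc K)
    have 1: "rogers (2 * Suc K) x = ke (Suc K) * x ^ Suc K * phi43 b a De (Suc K) (e * b ^ (Suc K + 1)) x"
    proof -
      have "rogers (2 * Suc K) x = cth (2 * K + 2) * (1 - x) * rogers (2 * K + 1) x + x * rogers (2 * K) x"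
        using rogers_rec[of "2 * K + 1" x] by simp
      also have "\<dots> = x ^ Suc K * (ke K * phi43 b a De K (e * b ^ (K + 1)) x +
         cth (2 * K + 2) * ko K * ((1 - x)\<^sup>2 / x * phi43 b a Do K (e * b ^ (K + 2)) x))"
        unfolding Suc.IH[THEN conjunct1] Suc.IH[THEN conjunct2]
        using x0 by (simp add: field_simps power2_eq_square)
      finally show ?thesis unfolding even_step[symmetric] by (simp only: mult_ac)
    qed
    have "rogers (2 * Suc K + 1) x = cth (2 * K + 3) * (1 - x) * rogers (2 * Suc K) x + x * rogers (2 * K + 1) x"
      using rogers_rec[of "2 * K + 2" x] by (simp add: numeral_eq_Suc)
    also have "\<dots> = ((1 - x) * x ^ Suc K) * (cth (2 * K + 3) * ke (Suc K) * phi43 b a De (Suc K) (e * b ^ (Suc K + 1)) x +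
        ko K * phi43 b a Do K (e * b ^ (K + 2)) x)"
      unfolding 1 Suc.IH[THEN conjunct2] by (simp add: algebra_simps)
    finally have 2: "rogers (2 * Suc K + 1) x = ko (Suc K) * ((1 - x) * x ^ Suc K) * phi43 b a Do (Suc K) (e * b ^ (Suc K + 2)) x"
      unfolding odd_step[symmetric] by (simp only: mult_ac)
    show ?case using 1 2 by blast
  qed
qed

text \<open>
  \<open>kap_even\<close> and \<open>kap_odd\<close> are the constants in front of \<open>P_(2K)\<close> and \<open>P_(2K+1)\<close> in the
  two families with \<open>a = q\<close>; \<open>kap_even2\<close> and \<open>kap_odd2\<close> belong to base \<open>q\<^sup>2\<close> and
  \<open>a = q\<^sup>2\<close>.
\<close>
definition kap_even :: "nat \<Rightarrow> complex" where "kap_even K = (1 - q ^ (2 * K + 1)) / ((1 - q) * q ^ K)"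
definition kap_odd :: "nat \<Rightarrow> complex" where "kap_odd K = (1 - q ^ (2 * K + 2)) / ((1 - q)\<^sup>2 * q ^ K)"
definition kap_even2 :: "nat \<Rightarrow> complex" where "kap_even2 K = (1 - q ^ (2 * K + 1))\<^sup>2 / ((1 - q)\<^sup>2 * q ^ (2 * K))"
definition kap_odd2 :: "nat \<Rightarrow> complex" where "kap_odd2 K = (1 - q ^ (2 * K + 2))\<^sup>2 / ((1 - q)\<^sup>2 * (1 - q\<^sup>2) * q ^ (2 * K))"

text \<open>
  In terms of \<open>Q = q^(K+1)\<close> the conditions of \<open>contiguous\<close> become rational identities.
\<close>
lemma cth_forms:
  fixes K defines "Q \<equiv> q ^ Suc K"
  shows "cth (2 * K + 2) = (1 + Q\<^sup>2) / (1 - Q\<^sup>2)" "cth (2 * K + 3) = (1 + q * Q\<^sup>2) / (1 - q * Q\<^sup>2)"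
    "kap_even K = q * (1 - Q\<^sup>2 / q) / ((1 - q) * Q)" "kap_odd K = q * (1 - Q\<^sup>2) / ((1 - q)\<^sup>2 * Q)"
    "kap_even (Suc K) = (1 - q * Q\<^sup>2) / ((1 - q) * Q)" "kap_odd (Suc K) = (1 - q\<^sup>2 * Q\<^sup>2) / ((1 - q)\<^sup>2 * Q)"
    "kap_even2 K = q\<^sup>2 * (1 - Q\<^sup>2 / q)\<^sup>2 / ((1 - q)\<^sup>2 * Q\<^sup>2)"
    "kap_odd2 K = q\<^sup>2 * (1 - Q\<^sup>2)\<^sup>2 / ((1 - q)\<^sup>2 * (1 - q\<^sup>2) * Q\<^sup>2)"
    "kap_even2 (Suc K) = (1 - q * Q\<^sup>2)\<^sup>2 / ((1 - q)\<^sup>2 * Q\<^sup>2)"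
    "kap_odd2 (Suc K) = (1 - q\<^sup>2 * Q\<^sup>2)\<^sup>2 / ((1 - q)\<^sup>2 * (1 - q\<^sup>2) * Q\<^sup>2)"
proof -
  have Q0: "Q \<noteq> 0" using q_nz by (simp add: Q_def)
  have p: "q ^ (2 * K + 2) = Q\<^sup>2" "q ^ (2 * K + 3) = q * Q\<^sup>2" "q ^ (2 * K + 1) = Q\<^sup>2 / q" "q ^ K = Q / q"
    "q ^ (2 * Suc K + 1) = q * Q\<^sup>2" "q ^ (2 * Suc K + 2) = q\<^sup>2 * Q\<^sup>2" "q ^ Suc K = Q" "q ^ (2 * K) = Q\<^sup>2 / q\<^sup>2"
    "q ^ (2 * Suc K) = Q\<^sup>2"
    using q_nz by (simp_all add: Q_def power_mult power2_eq_square power_add power3_eq_cube mult_ac power_mult_distrib)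
  show "cth (2 * K + 2) = (1 + Q\<^sup>2) / (1 - Q\<^sup>2)" "cth (2 * K + 3) = (1 + q * Q\<^sup>2) / (1 - q * Q\<^sup>2)"
    by (simp_all only: cth_def p)
  show "kap_even K = q * (1 - Q\<^sup>2 / q) / ((1 - q) * Q)" "kap_odd K = q * (1 - Q\<^sup>2) / ((1 - q)\<^sup>2 * Q)"
    "kap_even2 K = q\<^sup>2 * (1 - Q\<^sup>2 / q)\<^sup>2 / ((1 - q)\<^sup>2 * Q\<^sup>2)"
    "kap_odd2 K = q\<^sup>2 * (1 - Q\<^sup>2)\<^sup>2 / ((1 - q)\<^sup>2 * (1 - q\<^sup>2) * Q\<^sup>2)"
    unfolding kap_even_def kap_odd_def kap_even2_def kap_odd2_def p using q_nz Q0 by simp_all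
  show "kap_even (Suc K) = (1 - q * Q\<^sup>2) / ((1 - q) * Q)" "kap_odd (Suc K) = (1 - q\<^sup>2 * Q\<^sup>2) / ((1 - q)\<^sup>2 * Q)"
    "kap_even2 (Suc K) = (1 - q * Q\<^sup>2)\<^sup>2 / ((1 - q)\<^sup>2 * Q\<^sup>2)"
    "kap_odd2 (Suc K) = (1 - q\<^sup>2 * Q\<^sup>2)\<^sup>2 / ((1 - q)\<^sup>2 * (1 - q\<^sup>2) * Q\<^sup>2)"
    unfolding kap_even_def kap_odd_def kap_even2_def kap_odd2_def p by simp_all
qed

lemma q_side_conditions: "q \<noteq> 0" "q \<noteq> 1" "1 \<noteq> q" "q\<^sup>2 \<noteq> 1" "1 \<noteq> q\<^sup>2"
  using q_nz q_not_root[of 1] q_not_root[of 2] by auto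

lemma q_power_side_conditions:
  fixes K defines "Q \<equiv> q ^ Suc K"
  shows "Q \<noteq> 0" "Q \<noteq> 1" "1 \<noteq> Q" "1 + Q \<noteq> 0" "Q\<^sup>2 \<noteq> 1" "1 \<noteq> Q\<^sup>2" "q * Q\<^sup>2 \<noteq> 1"
    "1 \<noteq> q * Q\<^sup>2" "1 + q * Q \<noteq> 0" "q\<^sup>2 * Q\<^sup>2 \<noteq> 1" "1 \<noteq> q\<^sup>2 * Q\<^sup>2"
proof -
  have "q ^ Suc K \<noteq> 1" "q ^ (2 * Suc K) \<noteq> 1" "q ^ (1 + 2 * Suc K) \<noteq> 1" "q ^ (2 + 2 * Suc K) \<noteq> 1"
    by (rule q_not_root; simp)+
  then have a: "Q \<noteq> 1" "Q\<^sup>2 \<noteq> 1" "q * Q\<^sup>2 \<noteq> 1" "q\<^sup>2 * Q\<^sup>2 \<noteq> 1"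
    by (simp_all only: Q_def power_add power_mult[symmetric] mult.commute[of "Suc K"] power_one_right not_False_eq_True)
  have "1 + q ^ Suc K \<noteq> 0" "1 + q ^ Suc (Suc K) \<noteq> 0" by (rule q_pow_plus_one_nz)+
  then have b: "1 + Q \<noteq> 0" "1 + q * Q \<noteq> 0" by (simp_all add: Q_def)
  show "Q \<noteq> 0" using q_nz by (simp add: Q_def)
  show "Q \<noteq> 1" "1 \<noteq> Q" "1 + Q \<noteq> 0" "Q\<^sup>2 \<noteq> 1" "1 \<noteq> Q\<^sup>2" "q * Q\<^sup>2 \<noteq> 1"
    "1 \<noteq> q * Q\<^sup>2" "1 + q * Q \<noteq> 0" "q\<^sup>2 * Q\<^sup>2 \<noteq> 1" "1 \<noteq> q\<^sup>2 * Q\<^sup>2"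
    using a b by metis+
qed

lemma kap_base: "kap_even 0 = 1" "kap_odd 0 = cth 1" "kap_even2 0 = 1" "kap_odd2 0 = cth 1"
proof -
  have "1 - q\<^sup>2 = (1 - q) * (1 + q)" by (simp add: algebra_simps power2_eq_square)
  then show "kap_even 0 = 1" "kap_odd 0 = cth 1" "kap_even2 0 = 1" "kap_odd2 0 = cth 1"
    using q_side_conditions
    by (simp_all add: kap_even_def kap_odd_def kap_even2_def kap_odd2_def cth_def power2_eq_square)
qed

lemma rogers_phi43_q2_a_q:
  assumes "x \<noteq> 0"
  shows "rogers (2 * K) x = kap_even K * x ^ K * phi43 (q\<^sup>2) q [q\<^sup>2, q, q\<^sup>2, q ^ 3] K (1 * (q\<^sup>2) ^ (K + 1)) x \<and>
     rogers (2 * K + 1) x = kap_odd K * ((1 - x) * x ^ K) * phi43 (q\<^sup>2) q [q\<^sup>2, q * q\<^sup>2, q\<^sup>2, q ^ 3] K (1 * (q\<^sup>2) ^ (K + 2)) x"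
proof (rule rogers_as_phi43)
  have b: "(q\<^sup>2) ^ k \<noteq> 1" if "k > 0" for k
    using q_not_root[of "2 * k"] that by (simp add: power_mult)
  show "q\<^sup>2 \<noteq> 0" "q \<noteq> 0" "x \<noteq> 0" using q_nz assms by simp_all
  show "(q\<^sup>2) ^ k \<noteq> 1" "1 * (q\<^sup>2) ^ k \<noteq> 1" if "k > 0" for k using b[OF that] by simp_all
  show "q * (q\<^sup>2) ^ k \<noteq> 1" "q ^ 3 * (q\<^sup>2) ^ k \<noteq> 1" "q\<^sup>2 * (q\<^sup>2) ^ k \<noteq> 1" for k
    using q_not_root[of "1 + 2 * k"] q_not_root[of "3 + 2 * k"] q_not_root[of "2 + 2 * k"]
    by (simp_all only: power_add power_mult power_one_right) auto
  show "q\<^sup>2 * q ^ 3 = q * 1 * (q\<^sup>2)\<^sup>2" by (simp add: power2_eq_square power3_eq_cube)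
  show "kap_even 0 = 1" "kap_odd 0 = cth 1" by (rule kap_base)+
  fix K
  note c = cth_forms(1-6)[of K] and g = q_side_conditions q_power_side_conditions[of K]
  have B: "(q\<^sup>2) ^ Suc K = (q ^ Suc K)\<^sup>2" by (simp only: power_mult[symmetric] mult.commute)
  show "contiguous (q\<^sup>2) q 1 (q\<^sup>2) (q ^ 3) (cth (2 * K + 2)) (cth (2 * K + 3)) ((q\<^sup>2) ^ Suc K)
      (kap_even K) (kap_odd K) (kap_even (Suc K)) (kap_odd (Suc K))"
    unfolding c B by (rule contiguous_q2_a_q) (fact g)+
qed

lemma rogers_phi43_q2_a_q2:
  assumes "x \<noteq> 0"
  shows "rogers (2 * K) x = kap_even2 K * x ^ K * phi43 (q\<^sup>2) (q\<^sup>2) [q\<^sup>2, q\<^sup>2, q ^ 3, q ^ 3] K (1 * (q\<^sup>2) ^ (K + 1)) x \<and>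
     rogers (2 * K + 1) x = kap_odd2 K * ((1 - x) * x ^ K) * phi43 (q\<^sup>2) (q\<^sup>2) [q\<^sup>2, q\<^sup>2 * q\<^sup>2, q ^ 3, q ^ 3] K (1 * (q\<^sup>2) ^ (K + 2)) x"
proof (rule rogers_as_phi43)
  have b: "(q\<^sup>2) ^ k \<noteq> 1" if "k > 0" for k
    using q_not_root[of "2 * k"] that by (simp add: power_mult)
  show "q\<^sup>2 \<noteq> 0" "q\<^sup>2 \<noteq> 0" "x \<noteq> 0" using q_nz assms by simp_all
  show "(q\<^sup>2) ^ k \<noteq> 1" "1 * (q\<^sup>2) ^ k \<noteq> 1" if "k > 0" for k using b[OF that] by simp_all
  show "q\<^sup>2 * (q\<^sup>2) ^ k \<noteq> 1" "q ^ 3 * (q\<^sup>2) ^ k \<noteq> 1" "q ^ 3 * (q\<^sup>2) ^ k \<noteq> 1" for k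
    using q_not_root[of "3 + 2 * k"] q_not_root[of "2 + 2 * k"]
    by (simp_all only: power_add power_mult power_one_right) auto
  show "q ^ 3 * q ^ 3 = q\<^sup>2 * 1 * (q\<^sup>2)\<^sup>2" by (simp add: power2_eq_square power3_eq_cube)
  show "kap_even2 0 = 1" "kap_odd2 0 = cth 1" by (rule kap_base)+
  fix K
  note c = cth_forms(1,2,7-10)[of K] and g = q_side_conditions q_power_side_conditions[of K]
  have B: "(q\<^sup>2) ^ Suc K = (q ^ Suc K)\<^sup>2" by (simp only: power_mult[symmetric] mult.commute)
  show "contiguous (q\<^sup>2) (q\<^sup>2) 1 (q ^ 3) (q ^ 3) (cth (2 * K + 2)) (cth (2 * K + 3)) ((q\<^sup>2) ^ Suc K)
      (kap_even2 K) (kap_odd2 K) (kap_even2 (Suc K)) (kap_odd2 (Suc K))"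
    unfolding c B by (rule contiguous_q2_a_q2) (fact g)+
qed

end

text \<open>
  Here \<open>s\<close> is the square root \<open>q^(1/2)\<close>.
\<close>
locale generic_sqrt_q = generic_q +
  fixes s :: complex
  assumes s2: "s\<^sup>2 = q"
begin

lemma s_nz: "s \<noteq> 0" using s2 q_nz by auto

lemma s_pow: "k > 0 \<Longrightarrow> s ^ k \<noteq> 1" "k > 0 \<Longrightarrow> - (s ^ k) \<noteq> 1" "k > 0 \<Longrightarrow> 1 + s ^ k \<noteq> 0"
proof -
  assume k: "k > 0"
  have e: "(s ^ k)\<^sup>2 = q ^ k" unfolding s2[symmetric] by (simp only: power_mult[symmetric] mult.commute)
  then show "s ^ k \<noteq> 1" "- (s ^ k) \<noteq> 1" using q_not_root[OF k]
    by (metis power2_minus power_one)+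
  then show "1 + s ^ k \<noteq> 0" by (metis add_eq_0_iff minus_minus)
qed

lemma q_pow_s: "q ^ k = s ^ (2 * k)" by (simp add: power_mult s2)

lemma rogers_phi43_q_a_q:
  assumes "x \<noteq> 0"
  shows "rogers (2 * K) x = kap_even K * x ^ K * phi43 q q [q, q, s ^ 3, - (s ^ 3)] K (- 1 * q ^ (K + 1)) x \<and>
     rogers (2 * K + 1) x = kap_odd K * ((1 - x) * x ^ K) * phi43 q q [q, q * q, s ^ 3, - (s ^ 3)] K (- 1 * q ^ (K + 2)) x"
proof (rule rogers_as_phi43)
  show "q \<noteq> 0" "q \<noteq> 0" "x \<noteq> 0" using q_nz assms by simp_all
  show "q ^ k \<noteq> 1" "- 1 * q ^ k \<noteq> 1" if "k > 0" for k
    using q_not_root[OF that] q_pow_plus_one_nz[of k] by (auto simp: minus_equation_iff[of _ 1] add_eq_0_iff)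
  show "q * q ^ k \<noteq> 1" for k using q_not_root[of "Suc k"] by simp
  show "s ^ 3 * q ^ k \<noteq> 1" "- (s ^ 3) * q ^ k \<noteq> 1" for k
    using s_pow[of "3 + 2 * k"] by (simp_all add: q_pow_s power_add)
  have "s ^ 3 * s ^ 3 = (s\<^sup>2) ^ 3" by (simp add: power_add[symmetric] power_mult[symmetric])
  then have "s ^ 3 * s ^ 3 = q ^ 3" by (simp only: s2)
  then show "s ^ 3 * - (s ^ 3) = q * - 1 * q\<^sup>2" by (simp add: power3_eq_cube[of q] power2_eq_square[of q])
  show "kap_even 0 = 1" "kap_odd 0 = cth 1" by (rule kap_base)+
  fix K
  note c = cth_forms(1-6)[of K] and g = q_side_conditions q_power_side_conditions[of K]
  show "contiguous q q (- 1) (s ^ 3) (- (s ^ 3)) (cth (2 * K + 2)) (cth (2 * K + 3)) (q ^ Suc K)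
      (kap_even K) (kap_odd K) (kap_even (Suc K)) (kap_odd (Suc K))"
    unfolding c by (rule contiguous_q_a_q) (fact g)+
qed

text \<open>
  The constants for base \<open>q\<close> and \<open>a = s\<close>.
\<close>
definition kap_even_s :: "nat \<Rightarrow> complex" where
  "kap_even_s K = qpoch (- q) q K * qpoch (s ^ 3) q K / (s ^ K * qpoch q q K * qpoch (- s) q K)"
definition kap_odd_s :: "nat \<Rightarrow> complex" where
  "kap_odd_s K = qpoch (- q) q (Suc K) * qpoch (s ^ 3) q K / (s ^ K * (1 - q) * qpoch q q K * qpoch (- (s ^ 3)) q K)"

lemma kap_s_forms:
  fixes K defines "Q \<equiv> q ^ Suc K"
  shows "kap_odd_s K = kap_even_s K * ((1 + Q) * (1 + s) / ((1 - q) * (1 + Q / s)))"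
    "kap_even_s (Suc K) = kap_even_s K * ((1 + Q) * (1 - s * Q) / (s * (1 - Q) * (1 + Q / s)))"
    "kap_odd_s (Suc K) = kap_even_s K * ((1 + Q) * (1 - s * Q) / (s * (1 - Q) * (1 + Q / s))) *
        ((1 + q * Q) * (1 + s) / ((1 - q) * (1 + s * Q)))"
proof -
  have odd: "kap_odd_s K = kap_even_s K * ((1 + q ^ Suc K) * (1 + s) / ((1 - q) * (1 + s * q ^ K)))" for K
  proof -
    have nz: "qpoch (- s) q K \<noteq> 0" "qpoch (- (s ^ 3)) q K \<noteq> 0" "1 + s * q ^ K \<noteq> 0" "1 + s \<noteq> 0"
    proof -
      show "qpoch (- s) q K \<noteq> 0"
        using s_pow(2)[of "1 + 2 * _"] by (intro qpoch_nonzero) (auto simp: q_pow_s)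
      show "qpoch (- (s ^ 3)) q K \<noteq> 0"
        using s_pow(2)[of "3 + 2 * _"] by (intro qpoch_nonzero) (auto simp: q_pow_s power_add)
      show "1 + s * q ^ K \<noteq> 0" "1 + s \<noteq> 0" using s_pow(3)[of "1 + 2 * K"] s_pow(3)[of 1] by (simp_all add: q_pow_s)
    qed
    have "- s * q = - (s ^ 3)" by (simp add: s2[symmetric] power2_eq_square power3_eq_cube)
    then have "qpoch (- s) q K * (1 + s * q ^ K) = (1 + s) * qpoch (- (s ^ 3)) q K"
      using qpoch_Suc[of "- s" q K] qpoch_Suc_shift[of "- s" q K] by simp
    then have "1 / qpoch (- (s ^ 3)) q K = 1 / qpoch (- s) q K * ((1 + s) / (1 + s * q ^ K))"
      using nz by (simp add: divide_simps mult_ac)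
    moreover have "kap_odd_s K = qpoch (- q) q K * (1 + q ^ Suc K) * qpoch (s ^ 3) q K / (s ^ K * (1 - q) * qpoch q q K) * (1 / qpoch (- (s ^ 3)) q K)"
      by (simp add: kap_odd_s_def qpoch_Suc)
    ultimately have "kap_odd_s K = qpoch (- q) q K * (1 + q ^ Suc K) * qpoch (s ^ 3) q K / (s ^ K * (1 - q) * qpoch q q K) *
       (1 / qpoch (- s) q K * ((1 + s) / (1 + s * q ^ K)))" by simp
    then show ?thesis by (simp add: kap_even_s_def mult_ac)
  qed
  have sQ: "s * q ^ K = Q / s" "s ^ 3 * q ^ K = s * Q"
    using s_nz by (simp_all add: Q_def s2[symmetric] power2_eq_square power3_eq_cube)
  show 1: "kap_odd_s K = kap_even_s K * ((1 + Q) * (1 + s) / ((1 - q) * (1 + Q / s)))"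
    using odd[of K] unfolding sQ Q_def[symmetric] .
  show 2: "kap_even_s (Suc K) = kap_even_s K * ((1 + Q) * (1 - s * Q) / (s * (1 - Q) * (1 + Q / s)))"
  proof -
    have "1 - - q * q ^ K = 1 + Q" "1 - q * q ^ K = 1 - Q" "1 - - s * q ^ K = 1 + Q / s" "1 - s ^ 3 * q ^ K = 1 - s * Q"
      using sQ by (simp_all add: Q_def)
    then show ?thesis unfolding kap_even_s_def qpoch_Suc by (simp add: mult_ac)
  qed
  have e: "q ^ Suc (Suc K) = q * Q" "s * q ^ Suc K = s * Q" by (simp_all add: Q_def)
  show "kap_odd_s (Suc K) = kap_even_s K * ((1 + Q) * (1 - s * Q) / (s * (1 - Q) * (1 + Q / s))) *
        ((1 + q * Q) * (1 + s) / ((1 - q) * (1 + s * Q)))"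
    using odd[of "Suc K"] unfolding 2 e .
qed

lemma s_side_conditions: "s \<noteq> 0" "s \<noteq> 1" "1 \<noteq> s" "s\<^sup>2 \<noteq> 1" "1 \<noteq> s\<^sup>2" "1 + s \<noteq> 0"
  using s_nz s_pow[of 1] s_pow[of 2] by auto

lemma s_power_side_conditions:
  fixes K defines "Q \<equiv> q ^ Suc K"
  shows "Q \<noteq> 0" "Q \<noteq> 1" "1 \<noteq> Q" "1 + Q \<noteq> 0" "Q\<^sup>2 \<noteq> 1"
    "1 \<noteq> Q\<^sup>2" "s\<^sup>2 * Q\<^sup>2 \<noteq> 1" "1 \<noteq> s\<^sup>2 * Q\<^sup>2" "1 + s\<^sup>2 * Q \<noteq> 0" "s + Q \<noteq> 0" "1 + s * Q \<noteq> 0"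
proof -
  note g = q_power_side_conditions[of K, folded Q_def]
  have "1 + s ^ (1 + 2 * K) \<noteq> 0" "1 + s ^ (1 + 2 * Suc K) \<noteq> 0" by (rule s_pow; simp)+
  then have a: "1 + s * q ^ K \<noteq> 0" "1 + s * Q \<noteq> 0" by (simp_all only: power_add q_pow_s Q_def power_one_right not_False_eq_True)
  have "s + Q = s * (1 + s * q ^ K)" by (simp add: Q_def s2[symmetric] power2_eq_square algebra_simps)
  then have b: "s + Q \<noteq> 0" using a s_nz by simp
  show "Q \<noteq> 0" "Q \<noteq> 1" "1 \<noteq> Q" "1 + Q \<noteq> 0" "Q\<^sup>2 \<noteq> 1"
    "1 \<noteq> Q\<^sup>2" "s\<^sup>2 * Q\<^sup>2 \<noteq> 1" "1 \<noteq> s\<^sup>2 * Q\<^sup>2" "1 + s\<^sup>2 * Q \<noteq> 0" "s + Q \<noteq> 0" "1 + s * Q \<noteq> 0"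
    unfolding s2 by (fact g a b)+
qed

lemma rogers_phi43_q_a_s:
  assumes "x \<noteq> 0"
  shows "rogers (2 * K) x = kap_even_s K * x ^ K * phi43 q s [q, s, s ^ 3, - q] K (- 1 * q ^ (K + 1)) x \<and>
     rogers (2 * K + 1) x = kap_odd_s K * ((1 - x) * x ^ K) * phi43 q s [q, s * q, s ^ 3, - q] K (- 1 * q ^ (K + 2)) x"
proof (rule rogers_as_phi43)
  show "q \<noteq> 0" "s \<noteq> 0" "x \<noteq> 0" using q_nz s_nz assms by simp_all
  show "q ^ k \<noteq> 1" "- 1 * q ^ k \<noteq> 1" if "k > 0" for k
    using q_not_root[OF that] q_pow_plus_one_nz[of k] by (auto simp: minus_equation_iff[of _ 1] add_eq_0_iff)
  show "s * q ^ k \<noteq> 1" "s ^ 3 * q ^ k \<noteq> 1" "- q * q ^ k \<noteq> 1" for k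
    using s_pow[of "3 + 2 * k"] s_pow[of "1 + 2 * k"] q_pow_plus_one_nz[of "Suc k"]
    by (simp_all add: q_pow_s power_add s2 minus_equation_iff[of _ 1] add_eq_0_iff)
  show "s ^ 3 * - q = s * - 1 * q\<^sup>2" by (simp add: s2[symmetric] power2_eq_square power3_eq_cube)
  show "kap_even_s 0 = 1" by (simp add: kap_even_s_def)
  show "kap_odd_s 0 = cth 1" by (simp add: kap_odd_s_def cth_def qpoch_Suc)
  fix K
  note c = cth_forms(1,2)[of K] kap_s_forms[of K] and g = s_side_conditions s_power_side_conditions[of K]
  show "contiguous q s (- 1) (s ^ 3) (- q) (cth (2 * K + 2)) (cth (2 * K + 3)) (q ^ Suc K)
      (kap_even_s K) (kap_odd_s K) (kap_even_s (Suc K)) (kap_odd_s (Suc K))"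
    unfolding c unfolding s2[symmetric] by (rule contiguous_q_a_s) (fact g[unfolded s2[symmetric]])+
qed

end

section \<open>From the determinant to a multiple sum\<close>

lemma degree_prod_linear:
  "degree (\<Prod>i<n. [:1, f i :: complex:]) \<le> n"
proof (induction n)
  case (Suc n)
  have "degree ((\<Prod>i<n. [:1, f i:]) * [:1, f n:]) \<le> degree (\<Prod>i<n. [:1, f i:]) + degree [:1, f n:]"
    by (rule degree_mult_le)
  also have "\<dots> \<le> n + 1" using Suc by (intro add_mono) auto
  finally show ?case by simp
qed simp

text \<open>
  Column \<open>j\<close> is a polynomial of degree at most \<open>m - 1\<close> in \<open>y i\<close>, so the determinant is a
  constant times the Vandermonde product. The constant is found by letting the last
  point be \<open>b^m / c\<close>, a zero of every column but the first; deleting that row and column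
  leaves a determinant of the same kind.
\<close>
lemma qpoch_det:
  assumes "b \<noteq> 0" "c \<noteq> 0"
  shows "detf m (\<lambda>i j. qpoch (c / b ^ m * y i) b j * qpoch (\<beta> * y i) b (m - 1 - j)) =
     (\<Prod>l<m. (-1) ^ l * (c / b ^ Suc l) ^ l * qpoch (\<beta> * (b ^ Suc l / c)) b l) * (\<Prod>j<m. \<Prod>i<j. y j - y i)"
proof (induction m arbitrary: y)
  case 0
  then show ?case by simp
next
  case (Suc m)
  define w where "w = b ^ Suc m / c"
  have w: "w \<noteq> 0" "c / b ^ Suc m = 1 / w" using assms by (simp_all add: w_def)
  define p where "p j = (\<Prod>i<j. [:1, - (1 / w * b ^ i):]) * (\<Prod>i<m - j. [:1, - (\<beta> * b ^ i):])" for j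
  have poly_p: "poly (p j) y = qpoch (1 / w * y) b j * qpoch (\<beta> * y) b (m - j)" for j y
    by (simp add: p_def qpoch_def poly_prod mult_ac)
  have deg: "degree (p j) < Suc m" if "j < Suc m" for j
  proof -
    have "degree (p j) \<le> j + (m - j)"
      unfolding p_def by (intro order.trans[OF degree_mult_le] add_mono degree_prod_linear)
    then show ?thesis using that by simp
  qed
  define K where "K = detf (Suc m) (\<lambda>k j. coeff (p j) k)"
  have D: "detf (Suc m) (\<lambda>i j. qpoch (c / b ^ Suc m * y i) b j * qpoch (\<beta> * y i) b (Suc m - 1 - j)) =
      K * (\<Prod>j<Suc m. \<Prod>i<j. y j - y i)" for y
    using polynomial_det[of "Suc m" p y] deg unfolding K_def w(2) by (simp add: poly_p)
  define C where "C m = (\<Prod>l<m. (-1) ^ l * (c / b ^ Suc l) ^ l * qpoch (\<beta> * (b ^ Suc l / c)) b l)" for m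
  \<comment> \<open>The other points only have to be distinct and different from \<open>w\<close>.\<close>
  define y0 where "y0 i = (if i < m then w + of_nat (Suc i) else w)" for i
  define M where "M i j = qpoch (1 / w * y0 i) b j * qpoch (\<beta> * y0 i) b (m - j)" for i j
  have y0m: "y0 m = w" by (simp add: y0_def)
  have "K * (\<Prod>j<Suc m. \<Prod>i<j. y0 j - y0 i) = detf (Suc m) M"
    unfolding D[symmetric] w(2) M_def by simp
  also have "\<dots> = (\<Sum>j<Suc m. (-1) ^ (m + j) * M m j * detf m (\<lambda>i j'. M (insert_index m i) (insert_index j j')))"
    by (rule detf_expand_row) simp
  also have "\<dots> = (\<Sum>j\<in>{0}. (-1) ^ (m + j) * M m j * detf m (\<lambda>i j'. M (insert_index m i) (insert_index j j')))"
  proof (rule sum.mono_neutral_right)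
    show "\<forall>j\<in>{..<Suc m} - {0}. (-1) ^ (m + j) * M m j * detf m (\<lambda>i j'. M (insert_index m i) (insert_index j j')) = 0"
    proof
      fix j assume "j \<in> {..<Suc m} - {0}"
      then have "qpoch 1 b j = 0" unfolding qpoch_def by (intro prod_zero bexI[of _ 0]) auto
      then show "(-1) ^ (m + j) * M m j * detf m (\<lambda>i j'. M (insert_index m i) (insert_index j j')) = 0"
        using w by (simp add: M_def y0m)
    qed
  qed auto
  also have "\<dots> = (-1) ^ m * qpoch (\<beta> * w) b m * detf m (\<lambda>i j. M (insert_index m i) (insert_index 0 j))"
    using w by (simp add: M_def y0m)
  also have "detf m (\<lambda>i j. M (insert_index m i) (insert_index 0 j)) =
     detf m (\<lambda>i j. (1 - 1 / w * y0 i) * 1 * (qpoch (c / b ^ m * y0 i) b j * qpoch (\<beta> * y0 i) b (m - 1 - j)))"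
  proof (intro detf_cong refl, goal_cases)
    case ij: (1 i j)
    have "1 / w * y0 i * b = c / b ^ m * y0 i" using assms by (simp add: w_def)
    then show ?case
      using ij by (simp add: M_def qpoch_Suc_shift)
  qed
  also have "\<dots> = (\<Prod>i<m. 1 - 1 / w * y0 i) * (C m * (\<Prod>j<m. \<Prod>i<j. y0 j - y0 i))"
    unfolding detf_scale Suc.IH C_def by simp
  also have "(\<Prod>i<m. 1 - 1 / w * y0 i) = (c / b ^ Suc m) ^ m * (\<Prod>i<m. y0 m - y0 i)"
  proof -
    have "(\<Prod>i<m. 1 - 1 / w * y0 i) = (\<Prod>i<m. 1 / w * (y0 m - y0 i))"
      using w by (intro prod.cong refl) (simp add: y0m right_diff_distrib)
    then show ?thesis unfolding w(2) prod.distrib by simp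
  qed
  finally have "K * (\<Prod>j<Suc m. \<Prod>i<j. y0 j - y0 i) = C (Suc m) * (\<Prod>j<Suc m. \<Prod>i<j. y0 j - y0 i)"
    unfolding C_def w_def by (simp add: mult_ac)
  moreover have "(\<Prod>j<Suc m. \<Prod>i<j. y0 j - y0 i) \<noteq> 0"
    by (auto simp: y0_def of_nat_eq_iff simp del: of_nat_Suc)
  ultimately have "K = C (Suc m)" by simp
  then show ?case unfolding D C_def by simp
qed

lemma prod_qpoch_neg_power:
  assumes "b \<noteq> 0"
  shows "(\<Prod>j<m. qpoch (1 / b ^ (M + m - 1)) b j) = (\<Prod>l<m. (1 - 1 / b ^ (M + l)) ^ l)"
proof (induction m)
  case 0
  then show ?case by simp
next
  case (Suc m)
  have "(\<Prod>j<Suc m. qpoch (1 / b ^ (M + Suc m - 1)) b j) = (\<Prod>j<m. qpoch (1 / b ^ (M + m)) b (Suc j))"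
    by (subst prod.lessThan_Suc_shift) simp
  also have "\<dots> = (\<Prod>j<m. (1 - 1 / b ^ (M + m)) * qpoch (1 / b ^ (M + m - 1)) b j)"
  proof (intro prod.cong refl)
    fix j assume "j \<in> {..<m}"
    then obtain r where r: "M + m = Suc r" by (cases "M + m") auto
    have "1 / b ^ (M + m) * b = 1 / b ^ (M + m - 1)"
      using assms by (simp add: r)
    then show "qpoch (1 / b ^ (M + m)) b (Suc j) = (1 - 1 / b ^ (M + m)) * qpoch (1 / b ^ (M + m - 1)) b j"
      by (simp only: qpoch_Suc_shift)
  qed
  finally show ?case using Suc by (simp add: prod.distrib mult.commute)
qed

text \<open>
  Passing from \<open>N\<close> and \<open>\<beta>\<close> to \<open>N - j\<close> and \<open>\<beta> b^(m-1-j)\<close> multiplies the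
  \<open>k\<close>-th term of the series by \<open>(b^(k-N); b)_j (\<beta> b^k; b)_(m-1-j)\<close> up to a factor
  independent of \<open>k\<close>. All columns are thus sums with the same weights \<open>w\<close>, and after
  expanding by multilinearity \<open>qpoch_det\<close> applies.
\<close>
lemma phi43_det:
  fixes b a \<beta> :: complex and x :: "nat \<Rightarrow> complex"
  assumes b: "b \<noteq> 0" "\<And>k. k > 0 \<Longrightarrow> b ^ k \<noteq> 1" and \<beta>: "\<And>k. \<beta> * b ^ k \<noteq> 1" and N: "N + 1 = M + m"
  shows "detf m (\<lambda>i j. phi43 b a den (N - j) (\<beta> * b ^ (m - 1 - j)) (x i)) =
    (\<Prod>l<m. qpoch (\<beta> * b ^ (M + l)) b l / ((1 - b ^ (M + l)) ^ l * qpoch \<beta> b l)) *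
    (\<Sum>k\<in>{..<m} \<rightarrow>\<^sub>E {..N}. (\<Prod>j<m. \<Prod>i<j. b ^ k j - b ^ k i) *
      (\<Prod>i<m. qpochs [1 / b ^ N, \<beta>, a * x i, a / x i] b (k i) / qpochs den b (k i) * b ^ k i))"
proof -
  define w where "w i k = qpochs [1 / b ^ N, \<beta>, a * x i, a / x i] b k / qpochs den b k * b ^ k" for i k
  define P where "P j = 1 / (qpoch (1 / b ^ N) b j * qpoch \<beta> b (m - 1 - j))" for j
  define g where "g k j = P j * (qpoch (1 / b ^ N * b ^ k) b j * qpoch (\<beta> * b ^ k) b (m - 1 - j))" for k j
  have nzN: "qpoch (1 / b ^ N) b j \<noteq> 0" if "j < m" "m \<le> N + 1" for j
  proof (rule qpoch_nonzero)
    fix i assume "i < j"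
    then have i: "N = i + (N - i)" "N - i > 0" using that by simp_all
    have "b ^ N = b ^ i * b ^ (N - i)" by (subst i(1)) (rule power_add)
    then have "1 / b ^ N * b ^ i = 1 / b ^ (N - i)" using b(1) by simp
    then show "1 / b ^ N * b ^ i \<noteq> 1" using b(2)[OF i(2)] by simp
  qed
  have nzB: "qpoch \<beta> b j \<noteq> 0" for j by (rule qpoch_nonzero) (rule \<beta>)
  have mN: "m \<le> N + 1" using N by simp
  have "detf m (\<lambda>i j. phi43 b a den (N - j) (\<beta> * b ^ (m - 1 - j)) (x i)) = detf m (\<lambda>i j. \<Sum>k\<in>{..N}. w i k * g k j)"
  proof (intro detf_cong refl)
    fix i j assume j: "j < m"
    show "phi43 b a den (N - j) (\<beta> * b ^ (m - 1 - j)) (x i) = (\<Sum>k\<in>{..N}. w i k * g k j)"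
      unfolding phi43_extend[OF diff_le_self b(1)]
    proof (intro sum.cong refl)
      fix k
      have jN: "j \<le> N" using j mN by simp
      have "1 / b ^ N * b ^ j = 1 / b ^ (N - j)" using b(1) jN by (simp add: power_diff)
      then have 1: "qpoch (1 / b ^ (N - j)) b k = qpoch (1 / b ^ N) b k * qpoch (1 / b ^ N * b ^ k) b j / qpoch (1 / b ^ N) b j"
        using qpoch_add[of "1 / b ^ N" b j k] qpoch_add[of "1 / b ^ N" b k j] nzN[OF j mN]
        by (simp add: add.commute field_simps)
      have 2: "qpoch (\<beta> * b ^ (m - 1 - j)) b k = qpoch \<beta> b k * qpoch (\<beta> * b ^ k) b (m - 1 - j) / qpoch \<beta> b (m - 1 - j)"
        using qpoch_add[of \<beta> b "m - 1 - j" k] qpoch_add[of \<beta> b k "m - 1 - j"] nzB[of "m - 1 - j"]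
        by (simp add: add.commute field_simps)
      show "qpochs [1 / b ^ (N - j), \<beta> * b ^ (m - 1 - j), a * x i, a / x i] b k / qpochs den b k * b ^ k = w i k * g k j"
        unfolding w_def g_def P_def qpochs_Cons qpochs_Nil 1 2 by (simp add: mult_ac)
    qed
  qed
  also have "\<dots> = (\<Sum>k\<in>{..<m} \<rightarrow>\<^sub>E {..N}. (\<Prod>i<m. w i (k i)) * detf m (\<lambda>i j. g (k i) j))"
    by (rule detf_multilinear) simp
  also have "\<dots> = (\<Sum>k\<in>{..<m} \<rightarrow>\<^sub>E {..N}. (\<Prod>l<m. qpoch (\<beta> * b ^ (M + l)) b l / ((1 - b ^ (M + l)) ^ l * qpoch \<beta> b l)) *
      ((\<Prod>j<m. \<Prod>i<j. b ^ k j - b ^ k i) * (\<Prod>i<m. w i (k i))))"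
  proof (intro sum.cong refl)
    fix k :: "nat \<Rightarrow> nat"
    \<comment> \<open>With this \<open>c\<close> the zeros of \<open>qpoch_det\<close> fit the parameter \<open>b^(-N)\<close>.\<close>
    define c where "c = b ^ m / b ^ N"
    have c: "c \<noteq> 0" "c / b ^ m = 1 / b ^ N" using b(1) by (simp_all add: c_def)
    have cl: "c / b ^ Suc l = 1 / b ^ (M + l)" "b ^ Suc l / c = b ^ (M + l)" for l
    proof -
      have "b ^ N * b = b ^ M * b ^ m" using N by (metis power_Suc power_add Suc_eq_plus1 mult.commute)
      then have "b ^ Suc l * b ^ N = b ^ (M + l) * b ^ m" by (simp add: power_add mult_ac)
      then show "b ^ Suc l / c = b ^ (M + l)" "c / b ^ Suc l = 1 / b ^ (M + l)"
        using b(1) unfolding c_def by (simp_all add: divide_simps mult_ac)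
    qed
    have "detf m (\<lambda>i j. g (k i) j) = detf m (\<lambda>i j. 1 * P j *
        (qpoch (c / b ^ m * b ^ k i) b j * qpoch (\<beta> * b ^ k i) b (m - 1 - j)))"
      unfolding g_def c by simp
    also have "\<dots> = (\<Prod>j<m. P j) * ((\<Prod>l<m. (-1) ^ l * (c / b ^ Suc l) ^ l * qpoch (\<beta> * (b ^ Suc l / c)) b l) *
        (\<Prod>j<m. \<Prod>i<j. b ^ k j - b ^ k i))"
      unfolding detf_scale qpoch_det[OF b(1) c(1)] by simp
    also have "(\<Prod>j<m. P j) = 1 / ((\<Prod>l<m. (1 - 1 / b ^ (M + l)) ^ l) * (\<Prod>l<m. qpoch \<beta> b l))"
    proof -
      have "(\<Prod>j<m. qpoch \<beta> b (m - 1 - j)) = (\<Prod>j<m. qpoch \<beta> b (m - Suc j))" by simp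
      also have "\<dots> = (\<Prod>l<m. qpoch \<beta> b l)" by (rule prod.nat_diff_reindex)
      moreover have "M + m - 1 = N" using N by simp
      ultimately show ?thesis
        using prod_qpoch_neg_power[OF b(1), of M m] unfolding P_def
        by (simp only: prod_dividef prod.distrib) simp
    qed
    also have "\<dots> * ((\<Prod>l<m. (-1) ^ l * (c / b ^ Suc l) ^ l * qpoch (\<beta> * (b ^ Suc l / c)) b l) *
        (\<Prod>j<m. \<Prod>i<j. b ^ k j - b ^ k i)) =
       (\<Prod>l<m. qpoch (\<beta> * b ^ (M + l)) b l / ((1 - b ^ (M + l)) ^ l * qpoch \<beta> b l)) * (\<Prod>j<m. \<Prod>i<j. b ^ k j - b ^ k i)"
    proof -
      have t: "qpoch (\<beta> * b ^ (M + l)) b l / ((1 - b ^ (M + l)) ^ l * qpoch \<beta> b l) =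
        (-1) ^ l * (c / b ^ Suc l) ^ l * qpoch (\<beta> * (b ^ Suc l / c)) b l / ((1 - 1 / b ^ (M + l)) ^ l * qpoch \<beta> b l)" for l
      proof -
        define B where "B = b ^ (M + l)"
        have B: "B \<noteq> 0" using b(1) by (simp add: B_def)
        have "1 / (1 - B) = (-1) * (1 / B) / (1 - 1 / B)"
          using B by (cases "B = 1") (simp_all add: divide_simps)
        then have "(1 / (1 - B)) ^ l = (-1) ^ l * (1 / B) ^ l / (1 - 1 / B) ^ l"
          by (simp only: power_divide power_mult_distrib)
        then have "1 / (1 - B) ^ l = (-1) ^ l * (1 / B) ^ l / (1 - 1 / B) ^ l" by (simp add: power_divide)
        then have "v * (1 / (1 - B) ^ l) / u = v * ((-1) ^ l * (1 / B) ^ l / (1 - 1 / B) ^ l) / u" for u v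
          by simp
        from this[of "qpoch (\<beta> * B) b l" "qpoch \<beta> b l"] show ?thesis unfolding cl B_def[symmetric]
          by (simp add: mult.commute)
      qed
      show ?thesis unfolding t prod_dividef prod.distrib[of _ "\<lambda>l. qpoch \<beta> b l"] by simp
    qed
    finally show "(\<Prod>i<m. w i (k i)) * detf m (\<lambda>i j. g (k i) j) =
       (\<Prod>l<m. qpoch (\<beta> * b ^ (M + l)) b l / ((1 - b ^ (M + l)) ^ l * qpoch \<beta> b l)) *
      ((\<Prod>j<m. \<Prod>i<j. b ^ k j - b ^ k i) * (\<Prod>i<m. w i (k i)))"
      by (simp only: mult_ac)
  qed
  finally show ?thesis unfolding w_def sum_distrib_left .
qed

lemma pair_prod_shift:
  "(\<Prod>i=1..m. \<Prod>j=i+1..m. h i j) = (\<Prod>j<m. \<Prod>i<j. h (Suc i) (Suc j) :: 'a :: comm_monoid_mult)"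
proof -
  have "(\<Prod>i=1..m. \<Prod>j=i+1..m. h i j) = (\<Prod>(i, j)\<in>(SIGMA i:{1..m}. {i+1..m}). h i j)"
    by (rule prod.Sigma) auto
  also have "\<dots> = (\<Prod>(j, i)\<in>(SIGMA j:{..<m}. {..<j}). h (Suc i) (Suc j))"
    by (rule prod.reindex_bij_witness[of _ "\<lambda>(j, i). (Suc i, Suc j)" "\<lambda>(i, j). (j - 1, i - 1)"]) auto
  also have "\<dots> = (\<Prod>j<m. \<Prod>i<j. h (Suc i) (Suc j))"
    by (rule prod.Sigma[symmetric]) auto
  finally show ?thesis .
qed

lemma prod_shift: "(\<Prod>i=1..m. f i) = (\<Prod>i<m. f (Suc i) :: 'a :: comm_monoid_mult)"
  using prod.atLeast1_atMost_eq[of f m] by simp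

text \<open>
  Renumbers variables and summation indices from \<open>1, ..., m\<close> to \<open>0, ..., m - 1\<close>.
\<close>
lemma sum_PiE_shift:
  fixes D :: "nat \<Rightarrow> nat \<Rightarrow> complex" and f :: "nat \<Rightarrow> nat \<Rightarrow> complex"
  shows "(\<Sum>k\<in>{1..m} \<rightarrow>\<^sub>E {0..N}. (\<Prod>i=1..m. \<Prod>j=i+1..m. D (k i) (k j)) * (\<Prod>i=1..m. f i (k i))) =
    (\<Sum>k\<in>{..<m} \<rightarrow>\<^sub>E {..N}. (\<Prod>j<m. \<Prod>i<j. D (k i) (k j)) * (\<Prod>i<m. f (Suc i) (k i)))"
proof (rule sum.reindex_bij_witness[where j = "\<lambda>k. \<lambda>i\<in>{..<m}. k (Suc i)" and i = "\<lambda>k. \<lambda>i\<in>{1..m}. k (i - 1)"])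
  fix k assume k: "k \<in> {1..m} \<rightarrow>\<^sub>E {0..N}"
  show "(\<lambda>i\<in>{1..m}. (\<lambda>i\<in>{..<m}. k (Suc i)) (i - 1)) = k"
    by (rule ext) (use PiE_arb[OF k] in auto)
  show "(\<lambda>i\<in>{..<m}. k (Suc i)) \<in> {..<m} \<rightarrow>\<^sub>E {..N}"
    using k by (auto simp: PiE_iff)
  have "(\<Prod>j<m. \<Prod>i<j. D ((\<lambda>i\<in>{..<m}. k (Suc i)) i) ((\<lambda>i\<in>{..<m}. k (Suc i)) j)) =
      (\<Prod>j<m. \<Prod>i<j. D (k (Suc i)) (k (Suc j)))"
    by (intro prod.cong refl) auto
  then show "(\<Prod>j<m. \<Prod>i<j. D ((\<lambda>i\<in>{..<m}. k (Suc i)) i) ((\<lambda>i\<in>{..<m}. k (Suc i)) j)) *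
      (\<Prod>i<m. f (Suc i) ((\<lambda>i\<in>{..<m}. k (Suc i)) i)) =
      (\<Prod>i=1..m. \<Prod>j=i+1..m. D (k i) (k j)) * (\<Prod>i=1..m. f i (k i))"
    unfolding pair_prod_shift prod_shift by simp
next
  fix k assume k: "k \<in> {..<m} \<rightarrow>\<^sub>E {..N}"
  show "(\<lambda>i\<in>{..<m}. (\<lambda>i\<in>{1..m}. k (i - 1)) (Suc i)) = k"
    by (rule ext) (use PiE_arb[OF k] in auto)
  show "(\<lambda>i\<in>{1..m}. k (i - 1)) \<in> {1..m} \<rightarrow>\<^sub>E {0..N}"
    using k by (auto simp: PiE_iff)
qed

context generic_q
begin

text \<open>
  Reversal of q-shifted factorials: \<open>(q; q)_n / (q; q)_(n-k)\<close> is \<open>(-1)^k\<close> and a power of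
  \<open>q\<close> times \<open>(q^(-n); q)_k\<close>, and \<open>(-q; q)_n / (-q; q)_(n-k)\<close> is the same power of \<open>q\<close>
  times \<open>(-q^(-n); q)_k\<close>.
\<close>
lemma gco_diff:
  "k \<le> n \<Longrightarrow> (-1) ^ k * gco (n - k) = gco n * (qpoch (1 / q ^ n) q k / qpoch (- (1 / q ^ n)) q k)"
proof (induction k)
  case 0
  then show ?case by simp
next
  case (Suc k)
  define t where "t = q ^ (n - k)"
  have t: "t \<noteq> 0" "t \<noteq> 1" "1 + t \<noteq> 0" "1 / q ^ n * q ^ k = 1 / t" "gco (n - k) = (1 + t) / (1 - t) * gco (n - Suc k)"
  proof -
    show "t \<noteq> 0" "t \<noteq> 1" "1 + t \<noteq> 0" using q_nz q_not_root[of "n - k"] q_pow_plus_one_nz Suc.prems by (simp_all add: t_def)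
    have "q ^ n = q ^ k * t" using Suc.prems by (simp add: t_def power_add[symmetric])
    then show "1 / q ^ n * q ^ k = 1 / t" using q_nz by simp
    have "n - k = Suc (n - Suc k)" using Suc.prems by simp
    then show "gco (n - k) = (1 + t) / (1 - t) * gco (n - Suc k)"
      using gco_Suc[of "n - Suc k"] by (simp add: cth_def t_def)
  qed
  have "(-1) ^ Suc k * gco (n - Suc k) = (-1) ^ k * gco (n - k) * ((1 - 1 / t) / (1 + 1 / t))"
    unfolding t(5) using t(1-3) by (simp add: divide_simps) (simp add: algebra_simps)
  also have "\<dots> = gco n * (qpoch (1 / q ^ n) q (Suc k) / qpoch (- (1 / q ^ n)) q (Suc k))"
    using Suc t(4) by (simp add: qpoch_Suc)
  finally show ?case .
qed

lemma Pn_eq_mrogers: "Pn q n m x = mrogers n m (\<lambda>i. x (Suc i))"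
proof -
  define w where "w k = qpochs [- q, q powi (- int n)] q k / qpochs [q, - (q powi (- int n))] q k" for k
  have w: "gco n * w k = rco n k" if "k \<le> n" for k
  proof -
    have "rco n k = gco k * ((-1) ^ k * gco (n - k))" using that by (simp add: rco_def)
    also have "\<dots> = gco n * w k"
      unfolding gco_diff[OF that]
      by (simp add: w_def qpochs_Cons gco_def[of k] power_int_minus inverse_eq_divide mult_ac)
    finally show ?thesis by simp
  qed
  have "Pn q n m x = gco n ^ m *
     (\<Sum>k\<in>{..<m} \<rightarrow>\<^sub>E {..n}. (\<Prod>j<m. \<Prod>i<j. (q ^ k j - q ^ k i) / (q ^ k j + q ^ k i)) * (\<Prod>i<m. w (k i) * x (Suc i) ^ k i))"
    unfolding Pn_def w_def[symmetric] sum_PiE_shift[where m = m and N = n and D = "\<lambda>a b. (q ^ b - q ^ a) / (q ^ b + q ^ a)" and f = "\<lambda>i k. w k * x i ^ k"]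
    by (simp add: gco_def power_divide)
  also have "\<dots> = mrogers n m (\<lambda>i. x (Suc i))"
    unfolding mrogers_def sum_distrib_left
  proof (intro sum.cong refl)
    fix k assume k: "k \<in> {..<m} \<rightarrow>\<^sub>E {..n}"
    have "gco n ^ m * (\<Prod>i<m. w (k i) * x (Suc i) ^ k i) = (\<Prod>i<m. gco n * (w (k i) * x (Suc i) ^ k i))"
      by (subst prod.distrib) simp
    also have "\<dots> = (\<Prod>i<m. rco n (k i) * x (Suc i) ^ k i)"
    proof (intro prod.cong refl)
      fix i assume "i \<in> {..<m}"
      then have "k i \<le> n" using k by auto
      from w[OF this] show "gco n * (w (k i) * x (Suc i) ^ k i) = rco n (k i) * x (Suc i) ^ k i"
        by (simp only: mult.assoc[symmetric])
    qed
    finally show "gco n ^ m * ((\<Prod>j<m. \<Prod>i<j. (q ^ k j - q ^ k i) / (q ^ k j + q ^ k i)) * (\<Prod>i<m. w (k i) * x (Suc i) ^ k i)) =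
       schur m (\<lambda>i. q ^ k i) * (\<Prod>i<m. rco n (k i) * x (Suc i) ^ k i)"
      unfolding schur_def by (simp only: mult.left_commute[of "gco n ^ m"])
  qed
  finally show ?thesis .
qed

lemma cth_pairs_nz: "m \<le> n + 1 \<Longrightarrow> cth_pairs n m \<noteq> 0"
  unfolding cth_pairs_def using cth_nz by auto

text \<open>
  Here \<open>d = 0\<close> or \<open>1\<close> is the parity of the indices in the determinant formula, which run
  through \<open>2 (N - j) + d\<close> for \<open>j < m\<close>, from \<open>2 M + d\<close> up to \<open>2 N + d\<close>; and \<open>X x\<close> is the
  extra factor, \<open>1\<close> for even and \<open>1 - x\<close> for odd index. The factor number \<open>l\<close> of the
  constant collects the contributions of \<open>\<kappa> (M + l)\<close>, of \<open>phi43_det\<close> and of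
  \<open>cth_pairs\<close>.
\<close>
lemma multivariate_from_univariate:
  fixes b a e :: complex and x :: "nat \<Rightarrow> complex" and \<kappa> :: "nat \<Rightarrow> complex"
  assumes b: "b \<noteq> 0" "\<forall>k>0. b ^ k \<noteq> 1" and e: "\<forall>k>0. e * b ^ k \<noteq> 1"
    and uni: "\<forall>K x. x \<noteq> 0 \<longrightarrow> rogers (2 * K + d) x = \<kappa> K * (X x * x ^ K) * phi43 b a den K (e * b ^ (K + 1 + d)) x"
    and N: "N + 1 = M + m" and n: "n + 1 = 2 * M + d + m"
    and x: "\<forall>i\<in>{1..m}. x i \<noteq> 0"
  shows "(\<Prod>i=1..m. \<Prod>j=i+1..m. 1 - x i * x j) * Pn q n m x =
    (\<Prod>l<m. \<kappa> (M + l) * qpoch (e * b ^ (2 * M + 1 + d + l)) b l /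
       ((1 - b ^ (M + l)) ^ l * qpoch (e * b ^ (M + 1 + d)) b l * (\<Prod>i<l. cth (2 * M + d + 1 + i + l)))) *
    (\<Prod>i=1..m. X (x i) * x i ^ N) *
    (\<Sum>k\<in>{1..m} \<rightarrow>\<^sub>E {0..N}. (\<Prod>i=1..m. \<Prod>j=i+1..m. b ^ k j - b ^ k i) *
      (\<Prod>i=1..m. qpochs [1 / b ^ N, e * b ^ (M + 1 + d), a * x i, a / x i] b (k i) / qpochs den b (k i) * b ^ k i))"
proof -
  define y where "y i = x (Suc i)" for i
  define \<beta> where "\<beta> = e * b ^ (M + 1 + d)"
  have y: "y i \<noteq> 0" if "i < m" for i using x that by (simp add: y_def)
  have mn: "m \<le> n + 1" using n by simp
  have \<beta>b: "\<beta> * b ^ k \<noteq> 1" for k using e[rule_format, of "M + 1 + d + k"] by (simp add: \<beta>_def power_add mult_ac)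
  define S where "S = (\<Sum>k\<in>{..<m} \<rightarrow>\<^sub>E {..N}. (\<Prod>j<m. \<Prod>i<j. b ^ k j - b ^ k i) *
      (\<Prod>i<m. qpochs [1 / b ^ N, \<beta>, a * y i, a / y i] b (k i) / qpochs den b (k i) * b ^ k i))"
  have "rogers_det n m y = detf m (\<lambda>i j. (X (y i) * y i ^ N) * \<kappa> (N - j) * phi43 b a den (N - j) (\<beta> * b ^ (m - 1 - j)) (y i))"
    unfolding rogers_det_def
  proof (intro detf_cong refl, goal_cases)
    case ij: (1 i j)
    have 1: "n + m - 1 - 2 * j = 2 * (N - j) + d" using ij N n by simp
    have 2: "y i ^ j * y i ^ (N - j) = y i ^ N" using ij N by (simp add: power_add[symmetric])
    have 3: "e * b ^ (N - j + 1 + d) = \<beta> * b ^ (m - 1 - j)"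
      unfolding \<beta>_def mult.assoc power_add[symmetric] using ij N by (intro arg_cong2[where f = "(*)"] arg_cong2[where f = "(^)"]) auto
    have "y i ^ j * rogers (n + m - 1 - 2 * j) (y i) =
      (X (y i) * (y i ^ j * y i ^ (N - j))) * \<kappa> (N - j) * phi43 b a den (N - j) (\<beta> * b ^ (m - 1 - j)) (y i)"
      unfolding 1 uni[rule_format, OF y[OF ij(1)]] 3 by (simp only: mult_ac)
    then show ?case
      unfolding 2 .
  qed
  also have "\<dots> = (\<Prod>i<m. X (y i) * y i ^ N) * (\<Prod>j<m. \<kappa> (N - j)) *
     ((\<Prod>l<m. qpoch (\<beta> * b ^ (M + l)) b l / ((1 - b ^ (M + l)) ^ l * qpoch \<beta> b l)) * S)"
  proof -
    have "detf m (\<lambda>i j. phi43 b a den (N - j) (\<beta> * b ^ (m - 1 - j)) (y i)) =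
       (\<Prod>l<m. qpoch (\<beta> * b ^ (M + l)) b l / ((1 - b ^ (M + l)) ^ l * qpoch \<beta> b l)) * S"
      unfolding S_def by (rule phi43_det) (use b \<beta>b N in auto)
    then show ?thesis unfolding detf_scale by simp
  qed
  also have "(\<Prod>j<m. \<kappa> (N - j)) = (\<Prod>l<m. \<kappa> (M + l))"
  proof -
    have "(\<Prod>j<m. \<kappa> (N - j)) = (\<Prod>j<m. \<kappa> (M + (m - Suc j)))"
      by (intro prod.cong refl arg_cong[where f = \<kappa>]) (use N in auto)
    also have "\<dots> = (\<Prod>l<m. \<kappa> (M + l))" by (rule prod.nat_diff_reindex)
    finally show ?thesis .
  qed
  finally have R: "rogers_det n m y = (\<Prod>l<m. \<kappa> (M + l) * (qpoch (\<beta> * b ^ (M + l)) b l / ((1 - b ^ (M + l)) ^ l * qpoch \<beta> b l))) *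
     (\<Prod>i<m. X (y i) * y i ^ N) * S"
    unfolding prod.distrib by (simp only: mult_ac)
  have P: "cth_pairs n m = (\<Prod>l<m. \<Prod>i<l. cth (2 * M + d + 1 + i + l))"
    unfolding cth_pairs_def by (intro prod.cong refl arg_cong[where f = cth]) (use n in auto)
  have "(\<Prod>i=1..m. \<Prod>j=i+1..m. 1 - x i * x j) * Pn q n m x = (\<Prod>j<m. \<Prod>i<j. 1 - y i * y j) * mrogers n m y"
    unfolding pair_prod_shift Pn_eq_mrogers y_def ..
  also have "\<dots> = rogers_det n m y / cth_pairs n m"
    using mrogers_rogers_det[OF mn, of y] cth_pairs_nz[OF mn] by (simp add: field_simps)
  also have "\<dots> = (\<Prod>l<m. \<kappa> (M + l) * (qpoch (\<beta> * b ^ (M + l)) b l / ((1 - b ^ (M + l)) ^ l * qpoch \<beta> b l)) /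
       (\<Prod>i<l. cth (2 * M + d + 1 + i + l))) * (\<Prod>i<m. X (y i) * y i ^ N) * S"
    unfolding R P by (simp only: prod_dividef times_divide_eq_left)
  also have "(\<Prod>l<m. \<kappa> (M + l) * (qpoch (\<beta> * b ^ (M + l)) b l / ((1 - b ^ (M + l)) ^ l * qpoch \<beta> b l)) /
       (\<Prod>i<l. cth (2 * M + d + 1 + i + l))) =
     (\<Prod>l<m. \<kappa> (M + l) * qpoch (e * b ^ (2 * M + 1 + d + l)) b l /
       ((1 - b ^ (M + l)) ^ l * qpoch (e * b ^ (M + 1 + d)) b l * (\<Prod>i<l. cth (2 * M + d + 1 + i + l))))"
  proof (intro prod.cong refl, goal_cases)
    case (1 l)
    have "\<beta> * b ^ (M + l) = e * b ^ (2 * M + 1 + d + l)"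
      unfolding \<beta>_def mult.assoc power_add[symmetric] by (simp add: mult_2 add_ac)
    then show ?case
      unfolding \<beta>_def[symmetric] by simp
  qed
  also have "(\<Prod>i<m. X (y i) * y i ^ N) = (\<Prod>i=1..m. X (x i) * x i ^ N)"
    unfolding prod_shift y_def ..
  also have "S = (\<Sum>k\<in>{1..m} \<rightarrow>\<^sub>E {0..N}. (\<Prod>i=1..m. \<Prod>j=i+1..m. b ^ k j - b ^ k i) *
      (\<Prod>i=1..m. qpochs [1 / b ^ N, \<beta>, a * x i, a / x i] b (k i) / qpochs den b (k i) * b ^ k i))"
    unfolding S_def y_def
    by (rule sum_PiE_shift[symmetric, where m = m and N = N and D = "\<lambda>u v. b ^ v - b ^ u"
         and f = "\<lambda>i k. qpochs [1 / b ^ N, \<beta>, a * x i, a / x i] b k / qpochs den b k * b ^ k"])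
  finally show ?thesis unfolding \<beta>_def .
qed

end

lemma prod_scale_const: "(\<Prod>l<m. c * f l) = c ^ m * (\<Prod>l<m. f l :: complex)"
  by (simp add: prod.distrib)

lemma prod_minus_one_power: "(\<Prod>l<m. (-1) ^ l) = (-1 :: complex) ^ (m choose 2)"
  by (induction m) (simp_all add: numeral_2_eq_2 power_add)

lemma sum_shifted_index: "2 * (\<Sum>l<m. int (M + l)) = (2 * int M + int m - 1) * int m"
  by (induction m) (simp_all add: algebra_simps)

text \<open>
  The powers of \<open>q\<close> in front of the sums are distributed over the \<open>m\<close> factors of the
  constant, here and in \<open>power_sum_shifted_square\<close> and \<open>power_sum_weighted\<close>. In the
  exponents \<open>2 M + m - 1\<close> stands for \<open>n\<close> or \<open>n - 1\<close>, depending on the parity of \<open>n + m\<close>.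
\<close>
lemma power_sum_shifted:
  fixes t :: complex
  shows "t powi (- (((2 * int M + int m - 1) * int m) div 2)) = (\<Prod>l<m. 1 / t ^ (M + l))"
proof -
  have "((2 * int M + int m - 1) * int m) div 2 = int (\<Sum>l<m. M + l)"
    using sum_shifted_index[of M m] by simp
  then have "t powi (- (((2 * int M + int m - 1) * int m) div 2)) = inverse (t ^ (\<Sum>l<m. M + l))"
    by (simp only: power_int_minus power_int_of_nat)
  also have "t ^ (\<Sum>l<m. M + l) = (\<Prod>l<m. t ^ (M + l))" by (rule power_sum)
  finally show ?thesis by (simp add: prod_dividef inverse_eq_divide)
qed

lemma power_sum_shifted_square:
  fixes t :: complex
  shows "t powi (- ((2 * int M + int m - 1) * int m)) = (\<Prod>l<m. 1 / (t\<^sup>2) ^ (M + l))"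
proof -
  have e: "(2 * int M + int m - 1) * int m = 2 * (((2 * int M + int m - 1) * int m) div 2)"
    using sum_shifted_index[of M m] by (metis dvd_mult_div_cancel dvd_triv_left)
  have "t powi (- ((2 * int M + int m - 1) * int m)) = (t\<^sup>2) powi (- (((2 * int M + int m - 1) * int m) div 2))"
    by (subst e) (simp only: mult_minus_right[symmetric] power_int_mult power_int_numeral)
  then show ?thesis by (simp only: power_sum_shifted)
qed

lemma sum_weighted_index:
  "int ((m + 1) choose 3) + (2 * int M + int m - 1) * int ((m + 1) choose 2) = 2 * (\<Sum>l<m. int ((M + l) * (l + 1)))"
proof (induction m)
  case 0
  then show ?case by (simp add: binomial_eq_0)
next
  case (Suc m)
  have c3: "int ((Suc m + 1) choose 3) = int ((m + 1) choose 3) + int ((m + 1) choose 2)"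
    by (simp add: numeral_eq_Suc)
  have c2: "int ((Suc m + 1) choose 2) = int ((m + 1) choose 2) + int m + 1"
    by (simp add: numeral_eq_Suc)
  have "2 * ((m + 1) choose 2) = (m + 1) * m"
    by (induction m) (simp_all add: numeral_eq_Suc)
  then have d: "2 * int ((m + 1) choose 2) = (int m + 1) * int m"
    by (metis of_nat_1 of_nat_add of_nat_mult of_nat_numeral)
  have "int ((Suc m + 1) choose 3) + (2 * int M + int (Suc m) - 1) * int ((Suc m + 1) choose 2) =
     (int ((m + 1) choose 3) + (2 * int M + int m - 1) * int ((m + 1) choose 2)) +
     2 * int ((m + 1) choose 2) + (2 * int M + int m) * (int m + 1)"
    unfolding c3 c2 by (simp add: algebra_simps)
  then show ?case unfolding Suc.IH d by (simp add: algebra_simps)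
qed

lemma power_sum_weighted:
  fixes t :: complex
  shows "t powi (- int ((m + 1) choose 3) - (2 * int M + int m - 1) * int ((m + 1) choose 2)) =
     (\<Prod>l<m. 1 / (t\<^sup>2) ^ ((M + l) * (l + 1)))"
proof -
  have "- int ((m + 1) choose 3) - (2 * int M + int m - 1) * int ((m + 1) choose 2) =
      2 * - int (\<Sum>l<m. (M + l) * (l + 1))"
    using sum_weighted_index[of m M] by simp
  then have "t powi (- int ((m + 1) choose 3) - (2 * int M + int m - 1) * int ((m + 1) choose 2)) =
      inverse ((t\<^sup>2) ^ (\<Sum>l<m. (M + l) * (l + 1)))"
    by (simp only: power_int_mult power_int_numeral power_int_minus power_int_of_nat)
  also have "(t\<^sup>2) ^ (\<Sum>l<m. (M + l) * (l + 1)) = (\<Prod>l<m. (t\<^sup>2) ^ ((M + l) * (l + 1)))" by (rule power_sum)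
  finally show ?thesis by (simp add: prod_dividef inverse_eq_divide)
qed

text \<open>
  For \<open>0 < i < m\<close> the factor \<open>1 - b^(M+i)\<close> occurs \<open>i\<close> times in the power with \<open>l = i\<close>
  and \<open>m - i\<close> times in the q-shifted factorials with \<open>l \<ge> i\<close>, hence \<open>m\<close> times.
\<close>
lemma prod_nested_qpoch:
  "(\<Prod>l<m. (1 - b ^ (M + l)) ^ l * qpoch (b ^ (M + 1)) b l) = qpoch (b ^ (M + 1)) b (m - 1) ^ m"
proof (induction m)
  case (Suc m)
  show ?case
  proof (cases m)
    case m: (Suc m')
    have "qpoch (b ^ (M + 1)) b m = qpoch (b ^ (M + 1)) b (m - 1) * (1 - b ^ (M + m))"
      by (simp add: m qpoch_Suc power_add mult_ac)
    then have "qpoch (b ^ (M + 1)) b (m - 1) ^ m * ((1 - b ^ (M + m)) ^ m * qpoch (b ^ (M + 1)) b m) =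
        qpoch (b ^ (M + 1)) b m ^ m * qpoch (b ^ (M + 1)) b m"
      by (simp only: power_mult_distrib mult.assoc)
    then show ?thesis using Suc by simp
  qed simp
qed simp

text \<open>
  The function \<open>f (l + i)\<close> is symmetric: the square of index pairs consists of its
  diagonal and two triangles.
\<close>
lemma prod_square:
  fixes f :: "nat \<Rightarrow> complex"
  shows "(\<Prod>l<m. \<Prod>i<m. f (l + i)) = (\<Prod>l<m. f (2 * l) * (\<Prod>i<l. f (l + i))\<^sup>2)"
proof (induction m)
  case (Suc m)
  have "(\<Prod>l<Suc m. \<Prod>i<Suc m. f (l + i)) = (\<Prod>l<m. (\<Prod>i<m. f (l + i)) * f (l + m)) * ((\<Prod>i<m. f (m + i)) * f (m + m))"
    by simp
  also have "\<dots> = (\<Prod>l<m. \<Prod>i<m. f (l + i)) * (f (2 * m) * (\<Prod>i<m. f (m + i))\<^sup>2)"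
    by (simp add: prod.distrib power2_eq_square mult_ac add.commute mult_2_right[symmetric])
  finally show ?case using Suc by simp
qed simp

lemma prod_qpoch_square:
  "(\<Prod>l<m. qpoch (q ^ (c + l)) q m) = (\<Prod>l<m. (1 - q ^ (c + 2 * l)) * (qpoch (q ^ (c + l)) q l)\<^sup>2)"
  using prod_square[of "\<lambda>j. 1 - q ^ (c + j)" m]
  by (simp add: qpoch_def power_add[symmetric] add.assoc)

context generic_q
begin

text \<open>
  The factor of index \<open>l\<close> of the constant for base \<open>q\<close> (\<open>weight_q\<close>) and base \<open>q\<^sup>2\<close>
  (\<open>weight_q2\<close>), after cancellation with \<open>cth_pairs\<close>: dividing by \<open>cth j\<close> turns
  \<open>1 + q^j\<close> into \<open>1 - q^j\<close>, and \<open>1 - q^(2j)\<close> into \<open>(1 - q^j)\<^sup>2\<close>.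
\<close>
definition weight_q :: "(nat \<Rightarrow> complex) \<Rightarrow> nat \<Rightarrow> nat \<Rightarrow> nat \<Rightarrow> complex" where
  "weight_q \<kappa> M d l = \<kappa> (M + l) * qpoch (q ^ (2 * M + d + 1 + l)) q l /
       ((1 - q ^ (M + l)) ^ l * qpoch (- (q ^ (M + 1 + d))) q l)"

definition weight_q2 :: "(nat \<Rightarrow> complex) \<Rightarrow> nat \<Rightarrow> nat \<Rightarrow> nat \<Rightarrow> complex" where
  "weight_q2 \<kappa> M d l = \<kappa> (M + l) * (qpoch (q ^ (2 * M + d + 1 + l)) q l)\<^sup>2 /
       ((1 - (q\<^sup>2) ^ (M + l)) ^ l * qpoch ((q\<^sup>2) ^ (M + 1 + d)) (q\<^sup>2) l)"

lemma multivariate_base_q: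
  fixes a :: complex and x :: "nat \<Rightarrow> complex" and \<kappa> :: "nat \<Rightarrow> complex"
  assumes uni: "\<forall>K x. x \<noteq> 0 \<longrightarrow> rogers (2 * K + d) x = \<kappa> K * (X x * x ^ K) * phi43 q a den K (- 1 * q ^ (K + 1 + d)) x"
    and N: "N + 1 = M + m" and n: "n + 1 = 2 * M + d + m"
    and x: "\<forall>i\<in>{1..m}. x i \<noteq> 0"
  shows "(\<Prod>i=1..m. \<Prod>j=i+1..m. 1 - x i * x j) * Pn q n m x =
    (\<Prod>l<m. weight_q \<kappa> M d l) *
    (\<Prod>i=1..m. X (x i) * x i ^ N) *
    (\<Sum>k\<in>{1..m} \<rightarrow>\<^sub>E {0..N}. (\<Prod>i=1..m. \<Prod>j=i+1..m. q ^ k j - q ^ k i) *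
      (\<Prod>i=1..m. qpochs [1 / q ^ N, - (q ^ (M + 1 + d)), a * x i, a / x i] q (k i) / qpochs den q (k i) * q ^ k i))"
proof -
  have e: "- 1 * q ^ k \<noteq> 1" for k
    using q_pow_plus_one_nz[of k] by (simp add: minus_equation_iff[of _ 1] add_eq_0_iff)
  have t: "\<kappa> (M + l) * qpoch (- 1 * q ^ (2 * M + 1 + d + l)) q l /
       ((1 - q ^ (M + l)) ^ l * qpoch (- 1 * q ^ (M + 1 + d)) q l * (\<Prod>i<l. cth (2 * M + d + 1 + i + l))) =
     weight_q \<kappa> M d l" for l
  proof -
    have "qpoch (- 1 * q ^ (2 * M + 1 + d + l)) q l = (\<Prod>i<l. cth (2 * M + d + 1 + i + l)) * qpoch (q ^ (2 * M + d + 1 + l)) q l"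
      unfolding qpoch_def prod.distrib[symmetric]
    proof (intro prod.cong refl)
      fix i
      have "q ^ (2 * M + d + 1 + i + l) \<noteq> 1" by (rule q_not_root) simp
      then show "1 - - 1 * q ^ (2 * M + 1 + d + l) * q ^ i = cth (2 * M + d + 1 + i + l) * (1 - q ^ (2 * M + d + 1 + l) * q ^ i)"
        by (simp add: cth_def power_add mult_ac)
    qed
    moreover have "(\<Prod>i<l. cth (2 * M + d + 1 + i + l)) \<noteq> 0" using cth_nz by auto
    ultimately show ?thesis by (simp add: weight_q_def)
  qed
  have "\<forall>k>0. q ^ k \<noteq> 1" "\<forall>k>0. - 1 * q ^ k \<noteq> 1" using q_not_root e by auto
  from multivariate_from_univariate[OF q_nz this uni N n x, unfolded t] show ?thesis by simp
qed

lemma multivariate_base_q2: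
  fixes a :: complex and x :: "nat \<Rightarrow> complex" and \<kappa> :: "nat \<Rightarrow> complex"
  assumes uni: "\<forall>K x. x \<noteq> 0 \<longrightarrow> rogers (2 * K + d) x = \<kappa> K * (X x * x ^ K) * phi43 (q\<^sup>2) a den K (1 * (q\<^sup>2) ^ (K + 1 + d)) x"
    and N: "N + 1 = M + m" and n: "n + 1 = 2 * M + d + m"
    and x: "\<forall>i\<in>{1..m}. x i \<noteq> 0"
  shows "(\<Prod>i=1..m. \<Prod>j=i+1..m. 1 - x i * x j) * Pn q n m x =
    (\<Prod>l<m. weight_q2 \<kappa> M d l) *
    (\<Prod>i=1..m. X (x i) * x i ^ N) *
    (\<Sum>k\<in>{1..m} \<rightarrow>\<^sub>E {0..N}. (\<Prod>i=1..m. \<Prod>j=i+1..m. (q\<^sup>2) ^ k j - (q\<^sup>2) ^ k i) *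
      (\<Prod>i=1..m. qpochs [1 / (q\<^sup>2) ^ N, (q\<^sup>2) ^ (M + 1 + d), a * x i, a / x i] (q\<^sup>2) (k i) / qpochs den (q\<^sup>2) (k i) * (q\<^sup>2) ^ k i))"
proof -
  have b: "(q\<^sup>2) ^ k \<noteq> 1" if "k > 0" for k
    using q_not_root[of "2 * k"] that by (simp add: power_mult)
  have t: "\<kappa> (M + l) * qpoch (1 * (q\<^sup>2) ^ (2 * M + 1 + d + l)) (q\<^sup>2) l /
       ((1 - (q\<^sup>2) ^ (M + l)) ^ l * qpoch (1 * (q\<^sup>2) ^ (M + 1 + d)) (q\<^sup>2) l * (\<Prod>i<l. cth (2 * M + d + 1 + i + l))) =
     weight_q2 \<kappa> M d l" for l
  proof -
    have "qpoch (1 * (q\<^sup>2) ^ (2 * M + 1 + d + l)) (q\<^sup>2) l = (\<Prod>i<l. cth (2 * M + d + 1 + i + l)) * (qpoch (q ^ (2 * M + d + 1 + l)) q l)\<^sup>2"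
      unfolding qpoch_def prod_power_distrib prod.distrib[symmetric]
    proof (intro prod.cong refl, goal_cases)
      case (1 i)
      define t where "t = q ^ (2 * M + d + 1 + i + l)"
      have t1: "t \<noteq> 1" unfolding t_def by (rule q_not_root) simp
      have e1: "1 * (q\<^sup>2) ^ (2 * M + 1 + d + l) * (q\<^sup>2) ^ i = t\<^sup>2"
        by (simp add: t_def power_add power_mult_distrib power2_eq_square mult_ac)
      have e2: "q ^ (2 * M + d + 1 + l) * q ^ i = t" by (simp add: t_def power_add mult_ac)
      have e3: "1 - t\<^sup>2 = (1 + t) / (1 - t) * (1 - t)\<^sup>2"
        using t1 by (simp add: divide_simps power2_eq_square) (simp add: algebra_simps)
      show ?case
        unfolding e1 e2 cth_def t_def[symmetric] by (rule e3)
    qed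
    moreover have "(\<Prod>i<l. cth (2 * M + d + 1 + i + l)) \<noteq> 0" using cth_nz by auto
    ultimately show ?thesis by (simp add: weight_q2_def)
  qed
  have "q\<^sup>2 \<noteq> 0" "\<forall>k>0. (q\<^sup>2) ^ k \<noteq> 1" "\<forall>k>0. 1 * (q\<^sup>2) ^ k \<noteq> 1" using q_nz b by auto
  from multivariate_from_univariate[OF this uni N n x, unfolded t] show ?thesis by simp
qed

end

section \<open>The constants\<close>

lemma prod_reverse_shift:
  fixes f :: "nat \<Rightarrow> complex" and m :: nat
  shows "(\<Prod>i=1..m. f (M + m - i)) = (\<Prod>l<m. f (M + l))"
proof -
  have "(\<Prod>i=1..m. f (M + m - i)) = (\<Prod>l<m. f (M + (m - Suc l)))"
    unfolding prod_shift by (intro prod.cong refl arg_cong[where f = f]) auto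
  then show ?thesis by (simp only: prod.nat_diff_reindex[where g = "\<lambda>l. f (M + l)"])
qed

context generic_sqrt_q
begin

text \<open>
  The constant for base \<open>q\<close> and \<open>a = q\<close>, common to both parities \<open>d\<close>. The sign and a
  part of the power of \<open>q\<close> compensate for the passage from \<open>1 - q^(-(M+l))\<close> to
  \<open>1 - q^(M+l)\<close>.
\<close>
lemma constant_q_a_q:
  "(-1) ^ (m choose 2) * s powi (- int ((m + 1) choose 3) - (2 * int M + int m - 1) * int ((m + 1) choose 2)) *
     (\<Prod>i=1..m. qpoch (q ^ (2 * M + d + i)) q i / qpochs [1 / q ^ (M + m - 1), - (q ^ (M + 1 + d))] q (i - 1)) =
   (\<Prod>l<m. 1 / q ^ (M + l) * qpoch (q ^ (2 * M + d + 1 + l)) q (Suc l) /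
     ((1 - q ^ (M + l)) ^ l * qpoch (- (q ^ (M + 1 + d))) q l))"
proof -
  have "(\<Prod>i=1..m. qpoch (q ^ (2 * M + d + i)) q i / qpochs [1 / q ^ (M + m - 1), - (q ^ (M + 1 + d))] q (i - 1)) =
     (\<Prod>l<m. qpoch (q ^ (2 * M + d + 1 + l)) q (Suc l)) /
       ((\<Prod>l<m. qpoch (1 / q ^ (M + m - 1)) q l) * (\<Prod>l<m. qpoch (- (q ^ (M + 1 + d))) q l))"
    unfolding prod_shift by (simp add: qpochs_Cons prod_dividef prod.distrib)
  also have "\<dots> = (\<Prod>l<m. qpoch (q ^ (2 * M + d + 1 + l)) q (Suc l) /
      ((1 - 1 / q ^ (M + l)) ^ l * qpoch (- (q ^ (M + 1 + d))) q l))"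
    unfolding prod_qpoch_neg_power[OF q_nz] by (simp only: prod_dividef prod.distrib)
  finally have "(-1) ^ (m choose 2) * s powi (- int ((m + 1) choose 3) - (2 * int M + int m - 1) * int ((m + 1) choose 2)) *
     (\<Prod>i=1..m. qpoch (q ^ (2 * M + d + i)) q i / qpochs [1 / q ^ (M + m - 1), - (q ^ (M + 1 + d))] q (i - 1)) =
     (\<Prod>l<m. (-1) ^ l * (1 / q ^ ((M + l) * (l + 1))) * (qpoch (q ^ (2 * M + d + 1 + l)) q (Suc l) /
      ((1 - 1 / q ^ (M + l)) ^ l * qpoch (- (q ^ (M + 1 + d))) q l)))"
    unfolding power_sum_weighted s2 prod_minus_one_power[symmetric] prod.distrib by simp
  also have "\<dots> = (\<Prod>l<m. 1 / q ^ (M + l) * qpoch (q ^ (2 * M + d + 1 + l)) q (Suc l) /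
     ((1 - q ^ (M + l)) ^ l * qpoch (- (q ^ (M + 1 + d))) q l))"
  proof (intro prod.cong refl, goal_cases)
    case (1 l)
    define Y where "Y = q ^ (M + l)"
    have Y: "Y \<noteq> 0" using q_nz by (simp add: Y_def)
    have "Y ^ l * (1 - 1 / Y) ^ l = (-1) ^ l * (1 - Y) ^ l"
      using Y by (simp only: power_mult_distrib[symmetric]) (simp add: right_diff_distrib)
    then have y: "(1 - 1 / Y) ^ l = (-1) ^ l * (1 - Y) ^ l / Y ^ l" using Y by (simp add: field_simps)
    have "(-1) ^ l * (1 / q ^ ((M + l) * (l + 1))) * (U / ((1 - 1 / Y) ^ l * V)) = 1 / Y * U / ((1 - Y) ^ l * V)" for U V
    proof -
      have "q ^ ((M + l) * (l + 1)) = Y ^ l * Y" unfolding Y_def power_mult[symmetric] power_add[symmetric] by (simp add: algebra_simps)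
      moreover have "(-1 :: complex) ^ l * (-1) ^ l = 1" by (simp add: power_mult_distrib[symmetric])
      ultimately show ?thesis unfolding y using Y by (simp add: divide_simps mult_ac)
    qed
    then show ?case
      unfolding Y_def .
  qed
  finally show ?thesis .
qed

lemma const_odd_q_a_q:
  "(-1) ^ (m choose 2) * s powi (- int ((m + 1) choose 3) - (2 * int M + int m - 1) * int ((m + 1) choose 2)) / (1 - q) ^ m *
     (\<Prod>i=1..m. qpoch (q ^ (2 * M + i)) q i / qpochs [1 / q ^ (M + m - 1), - (q ^ (M + 1))] q (i - 1)) =
   (\<Prod>l<m. weight_q kap_even M 0 l)"
proof -
  have "(\<Prod>l<m. weight_q kap_even M 0 l) =
    (\<Prod>l<m. 1 / (1 - q) * (1 / q ^ (M + l) * qpoch (q ^ (2 * M + 0 + 1 + l)) q (Suc l) /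
     ((1 - q ^ (M + l)) ^ l * qpoch (- (q ^ (M + 1 + 0))) q l)))"
  proof (intro prod.cong refl, goal_cases)
    case (1 l)
    have e: "q ^ (2 * M + 0 + 1 + l) * q ^ l = q ^ (2 * (M + l) + 1)" by (simp only: power_add[symmetric]) (rule arg_cong[where f = "(^) q"], simp)
    show ?case
      unfolding weight_q_def kap_even_def qpoch_Suc e by (simp add: mult_ac)
  qed
  then show ?thesis
    unfolding prod_scale_const using constant_q_a_q[of m M 0]
    by (simp add: power_divide)
qed

lemma const_even_q_a_q:
  "(-1) ^ (m choose 2) * s powi (- int ((m + 1) choose 3) - (2 * int M + int m - 1) * int ((m + 1) choose 2)) / (1 - q) ^ (2 * m) *
     (\<Prod>i=1..m. qpoch (q ^ (2 * M + 1 + i)) q i / qpochs [1 / q ^ (M + m - 1), - (q ^ (M + 2))] q (i - 1)) =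
   (\<Prod>l<m. weight_q kap_odd M 1 l)"
proof -
  have "(\<Prod>l<m. weight_q kap_odd M 1 l) =
    (\<Prod>l<m. 1 / (1 - q)\<^sup>2 * (1 / q ^ (M + l) * qpoch (q ^ (2 * M + 1 + 1 + l)) q (Suc l) /
     ((1 - q ^ (M + l)) ^ l * qpoch (- (q ^ (M + 1 + 1))) q l)))"
  proof (intro prod.cong refl, goal_cases)
    case (1 l)
    have e: "q ^ (2 * M + 1 + 1 + l) * q ^ l = q ^ (2 * (M + l) + 2)" by (simp only: power_add[symmetric]) (rule arg_cong[where f = "(^) q"], simp)
    show ?case
      unfolding weight_q_def kap_odd_def qpoch_Suc e by (simp add: mult_ac)
  qed
  then show ?thesis
    unfolding prod_scale_const using constant_q_a_q[of m M 1]
    by (simp add: power_divide power_mult)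
qed

text \<open>
  The constant for base \<open>q\<close> and \<open>a = s\<close>; the parameter \<open>r\<close> is \<open>- s\<close> for even and \<open>- s^3\<close>
  for odd index.
\<close>
lemma constant_q_a_s:
  "s powi (- (((2 * int M + int m - 1) * int m) div 2)) * qpoch (- q) q (M + d) ^ m / qpoch q q (M + m - 1) ^ m *
    (\<Prod>i=1..m. qpoch (q ^ (2 * M + d + i)) q (i - 1) * qpoch (s ^ 3) q (M + m - i) / qpoch r q (M + m - i)) =
   (\<Prod>l<m. qpoch (- q) q (M + l + d) * qpoch (s ^ 3) q (M + l) / (s ^ (M + l) * qpoch q q (M + l) * qpoch r q (M + l)) *
      qpoch (q ^ (2 * M + d + 1 + l)) q l / ((1 - q ^ (M + l)) ^ l * qpoch (- (q ^ (M + 1 + d))) q l))"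
proof -
  have nz: "qpoch (- (q ^ (M + 1 + d))) q l \<noteq> 0" for l
  proof (rule qpoch_nonzero)
    fix j
    have e: "- (q ^ (M + 1 + d)) * q ^ j = - (q ^ (M + 1 + d + j))" by (simp add: power_add)
    have "1 + q ^ (M + 1 + d + j) \<noteq> 0" by (rule q_pow_plus_one_nz)
    then show "- (q ^ (M + 1 + d)) * q ^ j \<noteq> 1"
      unfolding e by (auto simp only: minus_equation_iff[of _ 1] add_eq_0_iff)
  qed
  have D: "(\<Prod>l<m. qpoch q q (M + l) * (1 - q ^ (M + l)) ^ l) = qpoch q q (M + m - 1) ^ m"
  proof (cases m)
    case (Suc m')
    have "(\<Prod>l<m. qpoch q q (M + l) * (1 - q ^ (M + l)) ^ l) =
        (\<Prod>l<m. qpoch q q M * ((1 - q ^ (M + l)) ^ l * qpoch (q ^ (M + 1)) q l))"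
      by (simp add: qpoch_add mult_ac)
    also have "\<dots> = qpoch q q M ^ m * qpoch (q ^ (M + 1)) q (m - 1) ^ m"
      unfolding prod_scale_const prod_nested_qpoch ..
    also have "\<dots> = qpoch q q (M + m - 1) ^ m"
      unfolding power_mult_distrib[symmetric] using Suc by (simp add: qpoch_add)
    finally show ?thesis .
  qed simp
  have "(\<Prod>l<m. qpoch (- q) q (M + l + d) * qpoch (s ^ 3) q (M + l) / (s ^ (M + l) * qpoch q q (M + l) * qpoch r q (M + l)) *
      qpoch (q ^ (2 * M + d + 1 + l)) q l / ((1 - q ^ (M + l)) ^ l * qpoch (- (q ^ (M + 1 + d))) q l)) =
    (\<Prod>l<m. qpoch (- q) q (M + d) * (1 / s ^ (M + l) * (qpoch (q ^ (2 * M + d + 1 + l)) q l * (qpoch (s ^ 3) q (M + l) / qpoch r q (M + l))) /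
      (qpoch q q (M + l) * (1 - q ^ (M + l)) ^ l)))"
  proof (intro prod.cong refl, goal_cases)
    case (1 l)
    have "M + l + d = (M + d) + l" by simp
    then have "qpoch (- q) q (M + l + d) = qpoch (- q) q (M + d) * qpoch (- (q ^ (M + 1 + d))) q l"
      by (simp only: qpoch_add) (simp add: power_add mult_ac)
    then show ?case
      using nz[of l] by (simp add: mult_ac)
  qed
  also have "\<dots> = qpoch (- q) q (M + d) ^ m * ((\<Prod>l<m. 1 / s ^ (M + l)) *
      ((\<Prod>l<m. qpoch (q ^ (2 * M + d + 1 + l)) q l) * (\<Prod>l<m. qpoch (s ^ 3) q (M + l) / qpoch r q (M + l))) /
      qpoch q q (M + m - 1) ^ m)"
    unfolding prod_scale_const
    by (simp only: prod_dividef prod.distrib D[unfolded prod.distrib])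
  also have "(\<Prod>l<m. qpoch (s ^ 3) q (M + l) / qpoch r q (M + l)) = (\<Prod>i=1..m. qpoch (s ^ 3) q (M + m - i) / qpoch r q (M + m - i))"
    by (rule prod_reverse_shift[symmetric, where f = "\<lambda>l. qpoch (s ^ 3) q l / qpoch r q l"])
  also have "(\<Prod>l<m. qpoch (q ^ (2 * M + d + 1 + l)) q l) = (\<Prod>i=1..m. qpoch (q ^ (2 * M + d + i)) q (i - 1))"
    unfolding prod_shift by simp
  also have "(\<Prod>l<m. 1 / s ^ (M + l)) = s powi (- (((2 * int M + int m - 1) * int m) div 2))"
    by (rule power_sum_shifted[symmetric])
  finally show ?thesis by (simp add: prod.distrib prod_dividef mult_ac)
qed

lemma const_odd_q_a_s:
  "s powi (- (((2 * int M + int m - 1) * int m) div 2)) * qpoch (- q) q M ^ m / qpoch q q (M + m - 1) ^ m *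
    (\<Prod>i=1..m. qpoch (q ^ (2 * M + i)) q (i - 1) * qpoch (s ^ 3) q (M + m - i) / qpoch (- s) q (M + m - i)) =
   (\<Prod>l<m. weight_q kap_even_s M 0 l)"
  using constant_q_a_s[of M m 0 "- s"] by (simp add: weight_q_def kap_even_s_def)

lemma const_even_q_a_s:
  "s powi (- (((2 * int M + int m - 1) * int m) div 2)) * qpoch (- q) q (M + 1) ^ m / ((1 - q) ^ m * qpoch q q (M + m - 1) ^ m) *
    (\<Prod>i=1..m. qpoch (q ^ (2 * M + 1 + i)) q (i - 1) * qpoch (s ^ 3) q (M + m - i) / qpoch (- (s ^ 3)) q (M + m - i)) =
   (\<Prod>l<m. weight_q kap_odd_s M 1 l)"
proof -
  have "(\<Prod>l<m. weight_q kap_odd_s M 1 l) =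
    (\<Prod>l<m. 1 / (1 - q) * (qpoch (- q) q (M + l + 1) * qpoch (s ^ 3) q (M + l) / (s ^ (M + l) * qpoch q q (M + l) * qpoch (- (s ^ 3)) q (M + l)) *
      qpoch (q ^ (2 * M + 1 + 1 + l)) q l / ((1 - q ^ (M + l)) ^ l * qpoch (- (q ^ (M + 1 + 1))) q l)))"
    by (intro prod.cong refl) (simp add: weight_q_def kap_odd_s_def mult_ac)
  then show ?thesis
    unfolding prod_scale_const constant_q_a_s[symmetric] by (simp add: power_divide)
qed

lemma const_odd_q2_a_q:
  "s powi (- ((2 * int M + int m - 1) * int m)) / ((1 - q) ^ m * qpoch ((q\<^sup>2) ^ (M + 1)) (q\<^sup>2) (m - 1) ^ m) *
     (\<Prod>i=1..m. qpoch (q ^ (2 * M + i)) q m) =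
   (\<Prod>l<m. weight_q2 kap_even M 0 l)"
proof -
  have "(\<Prod>i=1..m. qpoch (q ^ (2 * M + i)) q m) = (\<Prod>l<m. qpoch (q ^ (2 * M + 1 + l)) q m)"
    unfolding prod_shift by simp
  also have "\<dots> = (\<Prod>l<m. (1 - q ^ (2 * (M + l) + 1)) * (qpoch (q ^ (2 * M + 1 + l)) q l)\<^sup>2)"
    unfolding prod_qpoch_square by (simp add: algebra_simps)
  finally have n: "(\<Prod>i=1..m. qpoch (q ^ (2 * M + i)) q m) = (\<Prod>l<m. (1 - q ^ (2 * (M + l) + 1)) * (qpoch (q ^ (2 * M + 1 + l)) q l)\<^sup>2)" .
  have "(\<Prod>l<m. weight_q2 kap_even M 0 l) =
     (\<Prod>l<m. 1 / (1 - q) * (1 / q ^ (M + l) * ((1 - q ^ (2 * (M + l) + 1)) * (qpoch (q ^ (2 * M + 1 + l)) q l)\<^sup>2) /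
       ((1 - (q\<^sup>2) ^ (M + l)) ^ l * qpoch ((q\<^sup>2) ^ (M + 1)) (q\<^sup>2) l)))"
    by (intro prod.cong refl) (simp add: weight_q2_def kap_even_def)
  also have "\<dots> = (1 / (1 - q)) ^ m * ((\<Prod>l<m. 1 / q ^ (M + l)) *
      (\<Prod>l<m. (1 - q ^ (2 * (M + l) + 1)) * (qpoch (q ^ (2 * M + 1 + l)) q l)\<^sup>2) / qpoch ((q\<^sup>2) ^ (M + 1)) (q\<^sup>2) (m - 1) ^ m)"
    unfolding prod_scale_const prod_nested_qpoch[symmetric] by (simp only: prod_dividef prod.distrib)
  finally show ?thesis
    unfolding n power_sum_shifted_square s2 by (simp add: power_divide)
qed

lemma const_odd_q2_a_q2:
  "q powi (- ((2 * int M + int m - 1) * int m)) / ((1 - q) ^ (2 * m) * qpoch ((q\<^sup>2) ^ (M + 1)) (q\<^sup>2) (m - 1) ^ m) *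
     (\<Prod>i=1..m. (qpoch (q ^ (2 * M + i)) q i)\<^sup>2) =
   (\<Prod>l<m. weight_q2 kap_even2 M 0 l)"
proof -
  have "(\<Prod>l<m. weight_q2 kap_even2 M 0 l) =
     (\<Prod>l<m. 1 / (1 - q)\<^sup>2 * (1 / (q\<^sup>2) ^ (M + l) * (qpoch (q ^ (2 * M + 1 + l)) q (Suc l))\<^sup>2 /
       ((1 - (q\<^sup>2) ^ (M + l)) ^ l * qpoch ((q\<^sup>2) ^ (M + 1)) (q\<^sup>2) l)))"
  proof (intro prod.cong refl, goal_cases)
    case (1 l)
    have e: "q ^ (2 * M + 1 + l) * q ^ l = q ^ (2 * (M + l) + 1)" by (simp only: power_add[symmetric]) (rule arg_cong[where f = "(^) q"], simp)
    have e': "(q\<^sup>2) ^ (M + l) = q ^ (2 * (M + l))" by (simp only: power_mult)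
    show ?case
      unfolding weight_q2_def kap_even2_def qpoch_Suc e e' by (simp add: power_mult_distrib mult_ac)
  qed
  also have "\<dots> = (1 / (1 - q)\<^sup>2) ^ m * ((\<Prod>l<m. 1 / (q\<^sup>2) ^ (M + l)) *
      (\<Prod>l<m. (qpoch (q ^ (2 * M + 1 + l)) q (Suc l))\<^sup>2) / qpoch ((q\<^sup>2) ^ (M + 1)) (q\<^sup>2) (m - 1) ^ m)"
    unfolding prod_scale_const prod_nested_qpoch[symmetric] by (simp only: prod_dividef prod.distrib)
  finally show ?thesis
    unfolding power_sum_shifted_square prod_shift by (simp add: power_divide power_mult)
qed

text \<open>
  A version of \<open>prod_nested_qpoch\<close> for odd index. For \<open>m = 1\<close> the subscript on the right
  is \<open>- 1\<close>, and the value \<open>1 / (1 - b^(M+1))\<close> given to the symbol is the one that the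
  formula needs.
\<close>
lemma prod_nested_qpoch_int:
  assumes "m \<ge> 1"
  shows "(\<Prod>l<m. (1 - (q\<^sup>2) ^ (M + l)) ^ l * qpoch ((q\<^sup>2) ^ (M + 2)) (q\<^sup>2) l / (1 - q ^ (2 * (M + l) + 2))) =
     qpoch_int ((q\<^sup>2) ^ (M + 2)) (q\<^sup>2) (int m - 2) ^ m"
proof -
  define b where "b = q\<^sup>2"
  have b0: "b \<noteq> 0" using q_nz by (simp add: b_def)
  have b1: "1 - b ^ (M + 1 + l) \<noteq> 0" for l
  proof -
    have "b ^ (M + 1 + l) = q ^ (2 * (M + 1 + l))" by (simp only: b_def power_mult)
    then show ?thesis using q_not_root[of "2 * (M + 1 + l)"] by simp
  qed
  have bq: "q ^ (2 * (M + l) + 2) = b ^ (M + 1 + l)" for l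
    unfolding b_def power_mult[symmetric] by (simp add: algebra_simps)
  have sh: "qpoch (b ^ (M + 2)) b l = qpoch (b ^ (M + 1)) b (Suc l) / (1 - b ^ (M + 1))" for l
    using b1[of 0] qpoch_Suc_shift[of "b ^ (M + 1)" b l] by (simp add: mult_ac)
  have "(\<Prod>l<m. (1 - b ^ (M + l)) ^ l * qpoch (b ^ (M + 2)) b l / (1 - b ^ (M + 1 + l))) =
      (\<Prod>l<m. 1 / (1 - b ^ (M + 1)) * ((1 - b ^ (M + l)) ^ l * qpoch (b ^ (M + 1)) b l))"
  proof (intro prod.cong refl, goal_cases)
    case (1 l)
    have "qpoch (b ^ (M + 1)) b (Suc l) = qpoch (b ^ (M + 1)) b l * (1 - b ^ (M + 1 + l))"
      by (simp only: qpoch_Suc power_add)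
    then show ?case
      unfolding sh using b1[of l] by simp
  qed
  also have "\<dots> = (qpoch (b ^ (M + 1)) b (m - 1) / (1 - b ^ (M + 1))) ^ m"
    unfolding prod_scale_const prod_nested_qpoch by (simp add: power_divide)
  also have "qpoch (b ^ (M + 1)) b (m - 1) / (1 - b ^ (M + 1)) = qpoch_int (b ^ (M + 2)) b (int m - 2)"
  proof (cases "m = 1")
    case True
    have "b ^ (M + 2) / b = b ^ (M + 1)" using b0 by simp
    then show ?thesis using True by (simp add: qpoch_int_minus_one)
  next
    case False
    then obtain l where l: "m = Suc (Suc l)" using assms by (cases m; cases "m - 1") auto
    then have "qpoch_int (b ^ (M + 2)) b (int m - 2) = qpoch (b ^ (M + 2)) b l"
      using qpoch_int_of_nat[of "b ^ (M + 2)" b l] by simp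
    then show ?thesis unfolding sh using l by simp
  qed
  finally show ?thesis unfolding b_def[symmetric] bq .
qed

lemma const_even_q2_a_q:
  assumes "m \<ge> 1"
  shows "s powi (- ((2 * int M + int m - 1) * int m)) / ((1 - q) ^ (2 * m) * qpoch_int ((q\<^sup>2) ^ (M + 2)) (q\<^sup>2) (int m - 2) ^ m) *
     (\<Prod>i=1..m. (qpoch (q ^ (2 * M + 1 + i)) q (i - 1))\<^sup>2) =
   (\<Prod>l<m. weight_q2 kap_odd M 1 l)"
proof -
  have "(\<Prod>l<m. weight_q2 kap_odd M 1 l) =
     (\<Prod>l<m. 1 / (1 - q)\<^sup>2 * (1 / q ^ (M + l) * (qpoch (q ^ (2 * M + 2 + l)) q l)\<^sup>2 /
       ((1 - (q\<^sup>2) ^ (M + l)) ^ l * qpoch ((q\<^sup>2) ^ (M + 2)) (q\<^sup>2) l / (1 - q ^ (2 * (M + l) + 2)))))"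
    by (intro prod.cong refl) (simp add: weight_q2_def kap_odd_def mult_ac)
  also have "\<dots> = (1 / (1 - q)\<^sup>2) ^ m * ((\<Prod>l<m. 1 / q ^ (M + l)) *
      (\<Prod>l<m. (qpoch (q ^ (2 * M + 2 + l)) q l)\<^sup>2) / qpoch_int ((q\<^sup>2) ^ (M + 2)) (q\<^sup>2) (int m - 2) ^ m)"
    unfolding prod_scale_const prod_nested_qpoch_int[OF assms, symmetric] by (simp only: prod_dividef prod.distrib)
  finally show ?thesis
    unfolding power_sum_shifted_square s2 prod_shift by (simp add: power_divide power_mult)
qed

lemma const_even_q2_a_q2:
  assumes "m \<ge> 1"
  shows "q powi (- ((2 * int M + int m - 1) * int m)) /
      ((1 - q) ^ (2 * m) * (1 - q\<^sup>2) ^ m * qpoch_int ((q\<^sup>2) ^ (M + 2)) (q\<^sup>2) (int m - 2) ^ m) *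
     (\<Prod>i=1..m. qpoch (q ^ (2 * M + 1 + i)) q m) =
   (\<Prod>l<m. weight_q2 kap_odd2 M 1 l)"
proof -
  have "(\<Prod>i=1..m. qpoch (q ^ (2 * M + 1 + i)) q m) = (\<Prod>l<m. qpoch (q ^ (2 * M + 2 + l)) q m)"
    unfolding prod_shift by simp
  also have "\<dots> = (\<Prod>l<m. (1 - q ^ (2 * (M + l) + 2)) * (qpoch (q ^ (2 * M + 2 + l)) q l)\<^sup>2)"
    unfolding prod_qpoch_square by (simp add: algebra_simps)
  finally have n: "(\<Prod>i=1..m. qpoch (q ^ (2 * M + 1 + i)) q m) = (\<Prod>l<m. (1 - q ^ (2 * (M + l) + 2)) * (qpoch (q ^ (2 * M + 2 + l)) q l)\<^sup>2)" .
  have "(\<Prod>l<m. weight_q2 kap_odd2 M 1 l) =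
     (\<Prod>l<m. 1 / ((1 - q)\<^sup>2 * (1 - q\<^sup>2)) * (1 / (q\<^sup>2) ^ (M + l) * ((1 - q ^ (2 * (M + l) + 2)) * (qpoch (q ^ (2 * M + 2 + l)) q l)\<^sup>2) /
       ((1 - (q\<^sup>2) ^ (M + l)) ^ l * qpoch ((q\<^sup>2) ^ (M + 2)) (q\<^sup>2) l / (1 - q ^ (2 * (M + l) + 2)))))"
  proof (intro prod.cong refl, goal_cases)
    case (1 l)
    have e: "(q\<^sup>2) ^ (M + l) = q ^ (2 * (M + l))" "2 * M + 1 + 1 + l = 2 * M + 2 + l" "M + 1 + 1 = M + 2"
      by (simp_all only: power_mult)
    define t where "t = 1 - q ^ (2 * (M + l) + 2)"
    show ?case
      unfolding weight_q2_def kap_odd2_def e t_def[symmetric] by (simp add: power2_eq_square[of t] mult_ac)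
  qed
  also have "\<dots> = (1 / ((1 - q)\<^sup>2 * (1 - q\<^sup>2))) ^ m * ((\<Prod>l<m. 1 / (q\<^sup>2) ^ (M + l)) *
      (\<Prod>l<m. (1 - q ^ (2 * (M + l) + 2)) * (qpoch (q ^ (2 * M + 2 + l)) q l)\<^sup>2) / qpoch_int ((q\<^sup>2) ^ (M + 2)) (q\<^sup>2) (int m - 2) ^ m)"
    unfolding prod_scale_const prod_nested_qpoch_int[OF assms, symmetric] by (simp only: prod_dividef prod.distrib)
  finally show ?thesis
    unfolding power_sum_shifted_square n by (simp add: power_divide power_mult power_mult_distrib)
qed

end

section \<open>The eight multiple sums\<close>

context generic_sqrt_q
begin

lemma s_powi_even: "s powi (- (2 * int N)) = 1 / q ^ N"
  by (simp add: power_int_minus power_int_mult s2 inverse_eq_divide)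

lemma q_powi_even: "q powi (- (2 * int N)) = 1 / (q\<^sup>2) ^ N"
  by (simp add: power_int_minus power_int_mult inverse_eq_divide)

end

theorem theorem7p3:
  fixes q s F :: complex and m n :: nat and x :: "nat \<Rightarrow> complex"
  assumes "q \<noteq> 0" and "\<And>k. k > 0 \<Longrightarrow> q ^ k \<noteq> 1"
    and "s\<^sup>2 = q"
    and "m \<ge> 1" and "n \<ge> m - 1"
    and "\<And>i. i \<in> {1..m} \<Longrightarrow> x i \<noteq> 0"
    and "F = (\<Prod>i=1..m. \<Prod>j=i+1..m. 1 - x i * x j) * Pn q n m x"
  shows
    "(odd (n + m) \<longrightarrow>
       F =
         (- 1) ^ (m choose 2) * s powi (- int ((m + 1) choose 3) - int n * int ((m + 1) choose 2)) / (1 - q) ^ m *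
         (\<Prod>i=1..m. qpoch (q ^ (n + 1 - m + i)) q i /
                     qpochs [s powi (1 - int n - int m), - (s ^ (3 + n - m))] q (i - 1) * x i ^ ((n + m - 1) div 2)) *
         (\<Sum>k\<in>{1..m} \<rightarrow>\<^sub>E {0..(n + m - 1) div 2}.
            (\<Prod>i=1..m. \<Prod>j=i+1..m. q ^ k j - q ^ k i) *
            (\<Prod>i=1..m. qpochs [s powi (1 - int n - int m), - (s ^ (3 + n - m)), q * x i, q / x i] q (k i) /
                        qpochs [q, q, s ^ 3, - (s ^ 3)] q (k i) * q ^ k i)) \<and>
       F =
         s powi (- (int n * int m div 2)) * qpoch (- q) q ((n + 1 - m) div 2) ^ m /
           qpoch q q ((n + m - 1) div 2) ^ m *
         (\<Prod>i=1..m. qpoch (q ^ (n + 1 - m + i)) q (i - 1) * qpoch (s ^ 3) q ((n + m + 1 - 2 * i) div 2) /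
                     qpoch (- s) q ((n + m + 1 - 2 * i) div 2) * x i ^ ((n + m - 1) div 2)) *
         (\<Sum>k\<in>{1..m} \<rightarrow>\<^sub>E {0..(n + m - 1) div 2}.
            (\<Prod>i=1..m. \<Prod>j=i+1..m. q ^ k j - q ^ k i) *
            (\<Prod>i=1..m. qpochs [s powi (1 - int n - int m), - (s ^ (3 + n - m)), s * x i, s / x i] q (k i) /
                        qpochs [q, s, s ^ 3, - q] q (k i) * q ^ k i)) \<and>
       F =
         s powi (- (int n * int m)) / ((1 - q) ^ m * qpoch (q ^ (3 + n - m)) (q\<^sup>2) (m - 1) ^ m) *
         (\<Prod>i=1..m. qpoch (q ^ (n + 1 - m + i)) q m * x i ^ ((n + m - 1) div 2)) *
         (\<Sum>k\<in>{1..m} \<rightarrow>\<^sub>E {0..(n + m - 1) div 2}.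
            (\<Prod>i=1..m. \<Prod>j=i+1..m. q ^ (2 * k j) - q ^ (2 * k i)) *
            (\<Prod>i=1..m. qpochs [q powi (1 - int n - int m), q ^ (3 + n - m), q * x i, q / x i] (q\<^sup>2) (k i) /
                        qpochs [q, q\<^sup>2, q\<^sup>2, q ^ 3] (q\<^sup>2) (k i) * q ^ (2 * k i))) \<and>
       F =
         q powi (- (int n * int m)) / ((1 - q) ^ (2 * m) * qpoch (q ^ (3 + n - m)) (q\<^sup>2) (m - 1) ^ m) *
         (\<Prod>i=1..m. qpoch (q ^ (n + 1 - m + i)) q i ^ 2 * x i ^ ((n + m - 1) div 2)) *
         (\<Sum>k\<in>{1..m} \<rightarrow>\<^sub>E {0..(n + m - 1) div 2}.
            (\<Prod>i=1..m. \<Prod>j=i+1..m. q ^ (2 * k j) - q ^ (2 * k i)) *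
            (\<Prod>i=1..m. qpochs [q powi (1 - int n - int m), q ^ (3 + n - m), q\<^sup>2 * x i, q\<^sup>2 / x i] (q\<^sup>2) (k i) /
                        qpochs [q\<^sup>2, q\<^sup>2, q ^ 3, q ^ 3] (q\<^sup>2) (k i) * q ^ (2 * k i)))) \<and>
     (even (n + m) \<longrightarrow>
       F =
         (- 1) ^ (m choose 2) * s powi (- int ((m + 1) choose 3) - (int n - 1) * int ((m + 1) choose 2)) / (1 - q) ^ (2 * m) *
         (\<Prod>i=1..m. qpoch (q ^ (n + 1 - m + i)) q i /
                     qpochs [s powi (2 - int n - int m), - (s ^ (4 + n - m))] q (i - 1)) *
         (\<Prod>i=1..m. (1 - x i) * x i ^ ((n + m - 2) div 2)) *
         (\<Sum>k\<in>{1..m} \<rightarrow>\<^sub>E {0..(n + m - 2) div 2}.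
            (\<Prod>i=1..m. \<Prod>j=i+1..m. q ^ k j - q ^ k i) *
            (\<Prod>i=1..m. qpochs [s powi (2 - int n - int m), - (s ^ (4 + n - m)), q * x i, q / x i] q (k i) /
                        qpochs [q, q\<^sup>2, s ^ 3, - (s ^ 3)] q (k i) * q ^ k i)) \<and>
       F =
         s powi (- ((int n - 1) * int m div 2)) * qpoch (- q) q ((n + 2 - m) div 2) ^ m /
           ((1 - q) ^ m * qpoch q q ((n + m - 2) div 2) ^ m) *
         (\<Prod>i=1..m. qpoch (q ^ (n + 1 - m + i)) q (i - 1) * qpoch (s ^ 3) q ((n + m - 2 * i) div 2) /
                     qpoch (- (s ^ 3)) q ((n + m - 2 * i) div 2)) *
         (\<Prod>i=1..m. (1 - x i) * x i ^ ((n + m - 2) div 2)) *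
         (\<Sum>k\<in>{1..m} \<rightarrow>\<^sub>E {0..(n + m - 2) div 2}.
            (\<Prod>i=1..m. \<Prod>j=i+1..m. q ^ k j - q ^ k i) *
            (\<Prod>i=1..m. qpochs [s powi (2 - int n - int m), - (s ^ (4 + n - m)), s * x i, s / x i] q (k i) /
                        qpochs [q, s ^ 3, s ^ 3, - q] q (k i) * q ^ k i)) \<and>
       F =
         s powi (- ((int n - 1) * int m)) / ((1 - q) ^ (2 * m) * qpoch_int (q ^ (4 + n - m)) (q\<^sup>2) (int m - 2) ^ m) *
         (\<Prod>i=1..m. qpoch (q ^ (n + 1 - m + i)) q (i - 1) ^ 2) *
         (\<Prod>i=1..m. (1 - x i) * x i ^ ((n + m - 2) div 2)) *
         (\<Sum>k\<in>{1..m} \<rightarrow>\<^sub>E {0..(n + m - 2) div 2}.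
            (\<Prod>i=1..m. \<Prod>j=i+1..m. q ^ (2 * k j) - q ^ (2 * k i)) *
            (\<Prod>i=1..m. qpochs [q powi (2 - int n - int m), q ^ (4 + n - m), q * x i, q / x i] (q\<^sup>2) (k i) /
                        qpochs [q\<^sup>2, q\<^sup>2, q ^ 3, q ^ 3] (q\<^sup>2) (k i) * q ^ (2 * k i))) \<and>
       F =
         q powi (- ((int n - 1) * int m)) /
           ((1 - q) ^ (2 * m) * (1 - q\<^sup>2) ^ m * qpoch_int (q ^ (4 + n - m)) (q\<^sup>2) (int m - 2) ^ m) *
         (\<Prod>i=1..m. qpoch (q ^ (n + 1 - m + i)) q m) *
         (\<Prod>i=1..m. (1 - x i) * x i ^ ((n + m - 2) div 2)) *
         (\<Sum>k\<in>{1..m} \<rightarrow>\<^sub>E {0..(n + m - 2) div 2}.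
            (\<Prod>i=1..m. \<Prod>j=i+1..m. q ^ (2 * k j) - q ^ (2 * k i)) *
            (\<Prod>i=1..m. qpochs [q powi (2 - int n - int m), q ^ (4 + n - m), q\<^sup>2 * x i, q\<^sup>2 / x i] (q\<^sup>2) (k i) /
                        qpochs [q\<^sup>2, q ^ 3, q ^ 3, q ^ 4] (q\<^sup>2) (k i) * q ^ (2 * k i))))"
proof -
  interpret generic_sqrt_q q s
    by unfold_locales (use assms(1-3) in auto)
  have x: "\<forall>i\<in>{1..m}. x i \<noteq> 0" using assms(6) by blast
  note m = assms(4)
  have sq: "q ^ (2 * k) = (q\<^sup>2) ^ k" for k by (rule power_mult)
  show ?thesis
    unfolding assms(7)
  proof ((rule conjI; rule impI), goal_cases)
    case 1
    then have "odd (n + m)" .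
    \<comment> \<open>\<open>2 M\<close> is the smallest index in the determinant formula.\<close>
    obtain M where n: "n + 1 = 2 * M + m"
    proof -
      have "even (n + 1 - m)" using \<open>odd (n + m)\<close> assms(4,5) by auto
      then obtain M where "n + 1 - m = 2 * M" by blast
      then have "n + 1 = 2 * M + m" using assms(4,5) by simp
      then show ?thesis by (rule that)
    qed
    have n': "n + 1 = 2 * M + 0 + m" and N: "M + m - 1 + 1 = M + m" using m n by simp_all
    have idx: "n + 1 - m + i = 2 * M + i"
      "3 + n - m = 2 * (M + 1)"
      "(n + m - 1) div 2 = M + m - 1"
      "(n + 1 - m) div 2 = M"
      "(n + m + 1 - 2 * i) div 2 = M + m - i"
      "1 - int n - int m = - (2 * int (M + m - 1))"
      "int n = 2 * int M + int m - 1" for i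
      using m n by simp_all
    show ?case
    proof (intro conjI, goal_cases)
      case 1
      have "\<forall>K x. x \<noteq> 0 \<longrightarrow> rogers (2 * K + 0) x = kap_even K * (1 * x ^ K) *
          phi43 q q [q, q, s ^ 3, - (s ^ 3)] K (- 1 * q ^ (K + 1 + 0)) x"
        using rogers_phi43_q_a_q by simp
      note F = multivariate_base_q[where X = "\<lambda>_. 1", OF this N n' x,
        folded const_odd_q_a_q, unfolded prod.distrib]
      show ?case
        unfolding idx(1-6) s_powi_even q_pow_s[symmetric] unfolding idx(7) prod.distrib using F by (simp add: mult_ac)
    next
      case 2
      have "\<forall>K x. x \<noteq> 0 \<longrightarrow> rogers (2 * K + 0) x = kap_even_s K * (1 * x ^ K) *
          phi43 q s [q, s, s ^ 3, - q] K (- 1 * q ^ (K + 1 + 0)) x"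
        using rogers_phi43_q_a_s by simp
      note F = multivariate_base_q[where X = "\<lambda>_. 1", OF this N n' x,
        folded const_odd_q_a_s, unfolded prod.distrib]
      show ?case
        unfolding idx(1-6) s_powi_even q_pow_s[symmetric] unfolding idx(7) prod.distrib using F by (simp add: mult_ac)
    next
      case 3
      have "\<forall>K x. x \<noteq> 0 \<longrightarrow> rogers (2 * K + 0) x = kap_even K * (1 * x ^ K) *
          phi43 (q\<^sup>2) q [q\<^sup>2, q, q\<^sup>2, q ^ 3] K (1 * (q\<^sup>2) ^ (K + 1 + 0)) x"
        using rogers_phi43_q2_a_q by simp
      note F = multivariate_base_q2[where X = "\<lambda>_. 1", OF this N n' x,
        folded const_odd_q2_a_q, unfolded prod.distrib]
      have den: "qpochs [q, q\<^sup>2, q\<^sup>2, q ^ 3] b k = qpochs [q\<^sup>2, q, q\<^sup>2, q ^ 3] b k" for b k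
        by (simp add: qpochs_Cons s2[symmetric] power2_eq_square power3_eq_cube power4_eq_xxxx mult_ac)
      show ?case
        unfolding idx(1-6) q_powi_even sq den unfolding idx(7) prod.distrib using F by (simp add: mult_ac)
    next
      case 4
      have "\<forall>K x. x \<noteq> 0 \<longrightarrow> rogers (2 * K + 0) x = kap_even2 K * (1 * x ^ K) *
          phi43 (q\<^sup>2) (q\<^sup>2) [q\<^sup>2, q\<^sup>2, q ^ 3, q ^ 3] K (1 * (q\<^sup>2) ^ (K + 1 + 0)) x"
        using rogers_phi43_q2_a_q2 by simp
      note F = multivariate_base_q2[where X = "\<lambda>_. 1", OF this N n' x,
        folded const_odd_q2_a_q2, unfolded prod.distrib]
      show ?case
        unfolding idx(1-6) q_powi_even sq unfolding idx(7) prod.distrib using F by (simp add: mult_ac)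
    qed
  next
    case 2
    then have "even (n + m)" .
    \<comment> \<open>Now \<open>2 M + 1\<close> is the smallest index. The case \<open>n = m - 1\<close> is excluded by the
      parity.\<close>
    obtain M where n: "n = 2 * M + m"
    proof -
      have "m \<le> n" using \<open>even (n + m)\<close> assms(4,5) by (cases "n = m - 1") auto
      then have "even (n - m)" using \<open>even (n + m)\<close> by auto
      then obtain M where "n - m = 2 * M" by blast
      then have "n = 2 * M + m" using \<open>m \<le> n\<close> by simp
      then show ?thesis by (rule that)
    qed
    have n': "n + 1 = 2 * M + 1 + m" and N: "M + m - 1 + 1 = M + m" using m n by simp_all
    have idx: "n + 1 - m + i = 2 * M + 1 + i"
      "4 + n - m = 2 * (M + 2)"
      "(n + m - 2) div 2 = M + m - 1"
      "(n + 2 - m) div 2 = M + 1"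
      "(n + m - 2 * i) div 2 = M + m - i"
      "2 - int n - int m = - (2 * int (M + m - 1))"
      "int n - 1 = 2 * int M + int m - 1" for i
      using m n by simp_all
    show ?case
    proof (intro conjI, goal_cases)
      case 1
      have "\<forall>K x. x \<noteq> 0 \<longrightarrow> rogers (2 * K + 1) x = kap_odd K * ((1 - x) * x ^ K) *
          phi43 q q [q, q * q, s ^ 3, - (s ^ 3)] K (- 1 * q ^ (K + 1 + 1)) x"
        using rogers_phi43_q_a_q by simp
      note F = multivariate_base_q[where X = "\<lambda>x. 1 - x", OF this N n' x,
        folded const_even_q_a_q, unfolded prod.distrib]
      have den: "qpochs [q, q\<^sup>2, s ^ 3, - (s ^ 3)] b k = qpochs [q, q * q, s ^ 3, - (s ^ 3)] b k" for b k
        by (simp add: qpochs_Cons s2[symmetric] power2_eq_square power3_eq_cube power4_eq_xxxx mult_ac)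
      show ?case
        unfolding idx(1-6) s_powi_even q_pow_s[symmetric] den unfolding idx(7) prod.distrib using F by (simp add: mult_ac)
    next
      case 2
      have "\<forall>K x. x \<noteq> 0 \<longrightarrow> rogers (2 * K + 1) x = kap_odd_s K * ((1 - x) * x ^ K) *
          phi43 q s [q, s * q, s ^ 3, - q] K (- 1 * q ^ (K + 1 + 1)) x"
        using rogers_phi43_q_a_s by simp
      note F = multivariate_base_q[where X = "\<lambda>x. 1 - x", OF this N n' x,
        folded const_even_q_a_s, unfolded prod.distrib]
      have den: "qpochs [q, s ^ 3, s ^ 3, - q] b k = qpochs [q, s * q, s ^ 3, - q] b k" for b k
        by (simp add: qpochs_Cons s2[symmetric] power2_eq_square power3_eq_cube power4_eq_xxxx mult_ac)
      show ?case
        unfolding idx(1-6) s_powi_even q_pow_s[symmetric] den unfolding idx(7) prod.distrib using F by (simp add: mult_ac)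
    next
      case 3
      have "\<forall>K x. x \<noteq> 0 \<longrightarrow> rogers (2 * K + 1) x = kap_odd K * ((1 - x) * x ^ K) *
          phi43 (q\<^sup>2) q [q\<^sup>2, q * q\<^sup>2, q\<^sup>2, q ^ 3] K (1 * (q\<^sup>2) ^ (K + 1 + 1)) x"
        using rogers_phi43_q2_a_q by simp
      note F = multivariate_base_q2[where X = "\<lambda>x. 1 - x", OF this N n' x,
        folded const_even_q2_a_q[OF m], unfolded prod.distrib]
      have den: "qpochs [q\<^sup>2, q\<^sup>2, q ^ 3, q ^ 3] b k = qpochs [q\<^sup>2, q * q\<^sup>2, q\<^sup>2, q ^ 3] b k" for b k
        by (simp add: qpochs_Cons s2[symmetric] power2_eq_square power3_eq_cube power4_eq_xxxx mult_ac)
      show ?case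
        unfolding idx(1-6) q_powi_even sq den unfolding idx(7) prod.distrib using F by (simp add: mult_ac)
    next
      case 4
      have "\<forall>K x. x \<noteq> 0 \<longrightarrow> rogers (2 * K + 1) x = kap_odd2 K * ((1 - x) * x ^ K) *
          phi43 (q\<^sup>2) (q\<^sup>2) [q\<^sup>2, q\<^sup>2 * q\<^sup>2, q ^ 3, q ^ 3] K (1 * (q\<^sup>2) ^ (K + 1 + 1)) x"
        using rogers_phi43_q2_a_q2 by simp
      note F = multivariate_base_q2[where X = "\<lambda>x. 1 - x", OF this N n' x,
        folded const_even_q2_a_q2[OF m], unfolded prod.distrib]
      have den: "qpochs [q\<^sup>2, q ^ 3, q ^ 3, q ^ 4] b k = qpochs [q\<^sup>2, q\<^sup>2 * q\<^sup>2, q ^ 3, q ^ 3] b k" for b k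
        by (simp add: qpochs_Cons s2[symmetric] power2_eq_square power3_eq_cube power4_eq_xxxx mult_ac)
      show ?case
        unfolding idx(1-6) q_powi_even sq den unfolding idx(7) prod.distrib using F by (simp add: mult_ac)
    qed
  qed
qed

end
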